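(* Let $G=(V,E)$ be a homogeneous graph on $V=\{1,\dots,m\}$ with vertices ordered according to the Hasse perfect vertex elimination scheme. Let $U$ be an $m\times m$ positive definite matrix and $\alpha\in\mathbb{R}^m$ have nonnegative entries, with $z_G(U,\alpha)<\infty$. If $\Sigma\sim\pi^{P_G}_{U,\alpha}$ and $\Sigma=LDL^T$ is its modified Cholesky decomposition, then the random elements $$\big(D_{ii},\,(\Sigma^{\prec i})^{-1}\Sigma^{\prec}_{\cdot i}\big),\qquad 1\le i\le m,$$ are mutually independent. Furthermore, for all $i=1,\dots,m$, $$(\Sigma^{\prec i})^{-1}\Sigma^{\prec}_{\cdot i}\mid D_{ii}\ \sim\ \mathcal{N}\big((U^{\prec i})^{-1}U^{\prec}_{\cdot i},\ D_{ii}(U^{\prec i})^{-1}\big),$$ $$D_{ii}\ \sim\ \operatorname{IG}\Big(\frac{\alpha_i}{2}-\frac{|\mathcal{N}^{\prec}(i)|}{2}-1,\ \frac{U_{ii}-(U^{\prec}_{\cdot i})^T(U^{\prec i})^{-1}U^{\prec}_{\cdot i}}{2}\Big).$$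
   Context: Edges are undirected, no loops. Write $N[i]=\{i\}\cup\{u:(u,i)\in E\}$. $G$ is homogeneous if for every $(i,j)\in E$ either $N[j]\subseteq N[i]$ or $N[i]\subseteq N[j]$. Write $i\to j$ if $N[j]\subseteq N[i]$, and $iRj$ if $i\to j$ and $j\to i$. The Hasse diagram of $G$ is the directed rooted tree (a forest if $G$ is disconnected) on the $R$-equivalence classes $\bar i$, with a directed edge from $\bar i$ to $\bar j\neq\bar i$ when $i\to j$ and there is no $k$ with $i\to k\to j$, $\bar k\ne\bar i,\bar j$. The Hasse perfect vertex elimination scheme orders vertices by labeling them in descending order starting from the root of the tree (so a vertex in a proper ancestor class has a larger label than a vertex in a descendant class), with vertices in the same class labeled in any order among themselves. $P_G$ is the set of $m\times m$ symmetric positive definite matrices $\Sigma$ with $\Sigma_{ij}=0$ whenever $i\neq j$ and $(i,j)\notin E$. $\mathcal{L}_G$ is the set of lower-triangular matrices $L$ with unit diagonal and $L_{ij}=0$ for $i>j$, $(i,j)\notin E$. $\Theta_G=\{(L,D):L\in\mathcal{L}_G,\ D\text{ diagonal},\ D_{ii}>0\}$. The modified Cholesky decomposition of a positive definite $\Sigma$ is the unique $\Sigma=LDL^T$ with $L$ lower-triangular with unit diagonal and $D$ diagonal with positive entries; when the vertices of the homogeneous graph $G$ are ordered according to the Hasse perfect vertex elimination scheme, $(L,D)\mapsto LDL^T$ is a bijection $\Theta_G\to P_G$. Let $z_G(U,\alpha)=\int_{\Theta_G}\exp(-\frac12\{\operatorname{tr}((LDL^T)^{-1}U)+\sum_i\alpha_i\log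 D_{ii}\})\,dL\,dD$ with $dL\,dD=\prod_{(i,j)\in E,\,i>j}dL_{ij}\prod_i dD_{ii}$. When $z_G(U,\alpha)<\infty$, $\pi_{U,\alpha}$ is the probability distribution on $\Theta_G$ with density $z_G(U,\alpha)^{-1}\exp(-\frac12\{\operatorname{tr}((LDL^T)^{-1}U)+\sum_i\alpha_i\log D_{ii}\})$ with respect to $dL\,dD$, and $\pi^{P_G}_{U,\alpha}$ is its image on $P_G$ under $(L,D)\mapsto LDL^T$. For an $m\times m$ symmetric matrix $A$: $\mathcal{N}^{\prec}(i)=\{j:(i,j)\in E,\ j<i\}$, $A^{\prec i}=(A_{kl})_{k,l\in\mathcal{N}^{\prec}(i)}$, $A^{\prec}_{\cdot i}=(A_{ki})_{k\in\mathcal{N}^{\prec}(i)}$. If $\mathcal{N}^{\prec}(i)=\emptyset$, then $A^{\prec i}$ and $A^{\prec}_{\cdot i}$ are vacuous, $D_{ii}=\Sigma_{ii}$, and quadratic forms in them are $0$. $\operatorname{IG}(a,b)$ is the inverse-gamma distribution with density proportional to $x^{-a-1}e^{-b/x}$ on $(0,\infty)$. *)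

theory Defs
  imports "HOL-Probability.Probability"
begin

(* The vertex set {1,...,m} is a finite linearly ordered type 'n with m = CARD('n).
   An undirected graph on it is a symmetric irreflexive relation E (edges in both directions). *)

(* Square real matrices indexed by 'n; the built-in notation for real ^ 'n ^ 'n cannot be used
   where 'n carries a sort other than finite. *)
type_synonym 'n sqmat = "((real, 'n) vec, 'n) vec"

subsection \<open>Homogeneous graphs and Hasse orderings\<close>

definition closed_nbhd :: "('n \<times> 'n) set \<Rightarrow> 'n \<Rightarrow> 'n set" where
  "closed_nbhd E i = {i} \<union> {u. (u, i) \<in> E}"

definition homogeneous :: "('n \<times> 'n) set \<Rightarrow> bool" where
  "homogeneous E \<longleftrightarrow> (\<forall>(i, j) \<in> E.
     closed_nbhd E j \<subseteq> closed_nbhd E i \<or> closed_nbhd E i \<subseteq> closed_nbhd E j)"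

definition dominates :: "('n \<times> 'n) set \<Rightarrow> 'n \<Rightarrow> 'n \<Rightarrow> bool" where
  "dominates E i j \<longleftrightarrow> closed_nbhd E j \<subseteq> closed_nbhd E i"

definition hasse_class :: "('n \<times> 'n) set \<Rightarrow> 'n \<Rightarrow> 'n set" where
  "hasse_class E i = {j. dominates E i j \<and> dominates E j i}"

definition hasse_diagram :: "('n \<times> 'n) set \<Rightarrow> ('n set \<times> 'n set) set" where
  "hasse_diagram E = {(hasse_class E i, hasse_class E j) | i j.
     hasse_class E i \<noteq> hasse_class E j \<and> dominates E i j \<and>
     \<not> (\<exists>k. dominates E i k \<and> dominates E k j \<and>
            hasse_class E k \<noteq> hasse_class E i \<and> hasse_class E k \<noteq> hasse_class E j)}"

(* The given order on 'n is a Hasse perfect vertex elimination scheme: labels decrease along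
   directed paths of the Hasse diagram; nothing is required inside a class. *)
definition hasse_ordered :: "('n::linorder \<times> 'n) set \<Rightarrow> bool" where
  "hasse_ordered E \<longleftrightarrow>
     (\<forall>i j. (hasse_class E i, hasse_class E j) \<in> (hasse_diagram E)\<^sup>+ \<longrightarrow> j < i)"

definition preds :: "('n::linorder \<times> 'n) set \<Rightarrow> 'n \<Rightarrow> 'n set" where
  "preds E i = {j. (i, j) \<in> E \<and> j < i}"

subsection \<open>Matrices\<close>

definition positive_definite :: "'n::finite sqmat \<Rightarrow> bool" where
  "positive_definite A \<longleftrightarrow> transpose A = A \<and> (\<forall>x. x \<noteq> 0 \<longrightarrow> 0 < x \<bullet> (A *v x))"

definition unit_lower_triangular :: "'n::{finite,linorder} sqmat \<Rightarrow> bool" where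
  "unit_lower_triangular L \<longleftrightarrow> (\<forall>i. L $ i $ i = 1) \<and> (\<forall>i j. i < j \<longrightarrow> L $ i $ j = 0)"

definition positive_diagonal :: "'n::finite sqmat \<Rightarrow> bool" where
  "positive_diagonal D \<longleftrightarrow> (\<forall>i j. i \<noteq> j \<longrightarrow> D $ i $ j = 0) \<and> (\<forall>i. 0 < D $ i $ i)"

definition modified_cholesky ::
  "'n::{finite,linorder} sqmat \<Rightarrow> 'n sqmat \<Rightarrow> 'n sqmat \<Rightarrow> bool" where
  "modified_cholesky S L D \<longleftrightarrow>
     unit_lower_triangular L \<and> positive_diagonal D \<and> S = L ** D ** transpose L"

(* Inverse and determinant of the principal submatrix (A $ k $ l) with k, l in I.  As I is not
   a type, these are matrix_inv and det with all indices relativised to I; the inverse is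
   padded with zeros outside I x I.  For empty I they are the zero matrix and 1. *)
definition sub_inv :: "'n::finite set \<Rightarrow> 'n sqmat \<Rightarrow> 'n sqmat" where
  "sub_inv I A = (SOME B.
     (\<forall>k\<in>I. \<forall>l\<in>I. (\<Sum>p\<in>I. A $ k $ p * B $ p $ l) = (if k = l then 1 else 0)) \<and>
     (\<forall>k\<in>I. \<forall>l\<in>I. (\<Sum>p\<in>I. B $ k $ p * A $ p $ l) = (if k = l then 1 else 0)) \<and>
     (\<forall>k l. k \<notin> I \<or> l \<notin> I \<longrightarrow> B $ k $ l = 0))"

definition sub_det :: "'n::finite set \<Rightarrow> 'n sqmat \<Rightarrow> real" where
  "sub_det I A = (\<Sum>p | p permutes I. of_int (sign p) * (\<Prod>k\<in>I. A $ k $ p k))"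

(* The vector (A restricted to preds x preds)^{-1} (A $ k $ i)_{k in preds}, as an element of
   the extensional function space over preds E i. *)
definition pred_coef ::
  "('n::{finite,linorder} \<times> 'n) set \<Rightarrow> 'n sqmat \<Rightarrow> 'n \<Rightarrow> 'n \<Rightarrow> real" where
  "pred_coef E A i = (\<lambda>k\<in>preds E i. \<Sum>l\<in>preds E i. sub_inv (preds E i) A $ k $ l * A $ l $ i)"

definition pred_quad :: "('n::{finite,linorder} \<times> 'n) set \<Rightarrow> 'n sqmat \<Rightarrow> 'n \<Rightarrow> real" where
  "pred_quad E A i = (\<Sum>k\<in>preds E i. \<Sum>l\<in>preds E i.
     A $ k $ i * sub_inv (preds E i) A $ k $ l * A $ l $ i)"

subsection \<open>The prior on the Cholesky space and its image on the covariance space\<close>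

definition P_space :: "('n::finite \<times> 'n) set \<Rightarrow> 'n sqmat set" where
  "P_space E = {S. positive_definite S \<and> (\<forall>i j. i \<noteq> j \<and> (i, j) \<notin> E \<longrightarrow> S $ i $ j = 0)}"

definition L_space :: "('n::{finite,linorder} \<times> 'n) set \<Rightarrow> 'n sqmat set" where
  "L_space E = {L. unit_lower_triangular L \<and> (\<forall>i j. j < i \<and> (i, j) \<notin> E \<longrightarrow> L $ i $ j = 0)}"

definition Theta :: "('n::{finite,linorder} \<times> 'n) set \<Rightarrow> ('n sqmat \<times> 'n sqmat) set" where
  "Theta E = {(L, D). L \<in> L_space E \<and> positive_diagonal D}"

definition lower_edges :: "('n::linorder \<times> 'n) set \<Rightarrow> ('n \<times> 'n) set" where
  "lower_edges E = {(i, j) \<in> E. j < i}"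

definition theta_of_coords ::
  "('n::{finite,linorder} \<times> 'n) set \<Rightarrow> ('n \<times> 'n \<Rightarrow> real) \<times> ('n \<Rightarrow> real)
     \<Rightarrow> 'n sqmat \<times> 'n sqmat" where
  "theta_of_coords E = (\<lambda>(l, d).
     (\<chi> i j. if i = j then 1 else if (i, j) \<in> lower_edges E then l (i, j) else 0,
      \<chi> i j. if i = j then d i else 0))"

(* dL dD: Lebesgue measure in the free coordinates, transported to pairs of matrices. *)
definition theta_measure ::
  "('n::{finite,linorder} \<times> 'n) set \<Rightarrow> ('n sqmat \<times> 'n sqmat) measure" where
  "theta_measure E = restrict_space
     (distr ((\<Pi>\<^sub>M e\<in>lower_edges E. lborel) \<Otimes>\<^sub>M (\<Pi>\<^sub>M i\<in>UNIV. lborel)) borel (theta_of_coords E))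
     (Theta E)"

definition kernel_density ::
  "'n::finite sqmat \<Rightarrow> (real, 'n) vec \<Rightarrow> 'n sqmat \<times> 'n sqmat \<Rightarrow> real" where
  "kernel_density U \<alpha> = (\<lambda>(L, D).
     exp (- (1/2) * (trace (matrix_inv (L ** D ** transpose L) ** U)
                       + (\<Sum>i\<in>UNIV. \<alpha> $ i * ln (D $ i $ i)))))"

definition z_const ::
  "('n::{finite,linorder} \<times> 'n) set \<Rightarrow> 'n sqmat \<Rightarrow> (real, 'n) vec \<Rightarrow> ennreal" where
  "z_const E U \<alpha> = (\<integral>\<^sup>+ \<theta>. ennreal (kernel_density U \<alpha> \<theta>) \<partial>theta_measure E)"

definition pi_Theta ::
  "('n::{finite,linorder} \<times> 'n) set \<Rightarrow> 'n sqmat \<Rightarrow> (real, 'n) vec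
     \<Rightarrow> ('n sqmat \<times> 'n sqmat) measure" where
  "pi_Theta E U \<alpha> =
     density (theta_measure E) (\<lambda>\<theta>. ennreal (kernel_density U \<alpha> \<theta>) / z_const E U \<alpha>)"

definition P_algebra :: "('n::finite \<times> 'n) set \<Rightarrow> 'n sqmat measure" where
  "P_algebra E = restrict_space borel (P_space E)"

definition pi_P ::
  "('n::{finite,linorder} \<times> 'n) set \<Rightarrow> 'n sqmat \<Rightarrow> (real, 'n) vec \<Rightarrow> 'n sqmat measure" where
  "pi_P E U \<alpha> = distr (pi_Theta E U \<alpha>) (P_algebra E) (\<lambda>(L, D). L ** D ** transpose L)"

subsection \<open>Distributions\<close>

(* N(mu, C) on the coordinates in I, where C is positive definite on I x I. For empty I it is the
   point mass on the one-point space. *)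
definition mv_normal ::
  "'n::finite set \<Rightarrow> ('n \<Rightarrow> real) \<Rightarrow> 'n sqmat \<Rightarrow> ('n \<Rightarrow> real) measure" where
  "mv_normal I \<mu> C = density (\<Pi>\<^sub>M k\<in>I. lborel) (\<lambda>x. ennreal
     (exp (- (1/2) * (\<Sum>k\<in>I. \<Sum>l\<in>I. (x k - \<mu> k) * sub_inv I C $ k $ l * (x l - \<mu> l)))
        / sqrt ((2 * pi) ^ card I * sub_det I C)))"

definition inverse_gamma_density :: "real \<Rightarrow> real \<Rightarrow> real \<Rightarrow> real" where
  "inverse_gamma_density a b x =
     (if x \<le> 0 then 0 else b powr a / Gamma a * x powr (- a - 1) * exp (- b / x))"

(* X given Y has law K(Y): K is a regular conditional distribution of X given the
   sigma-algebra generated by Y. *)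
definition has_conditional_law ::
  "'w measure \<Rightarrow> ('w \<Rightarrow> 'x) \<Rightarrow> 'x measure \<Rightarrow> ('w \<Rightarrow> 'y) \<Rightarrow> 'y measure
     \<Rightarrow> ('y \<Rightarrow> 'x measure) \<Rightarrow> bool" where
  "has_conditional_law M X N Y N' K \<longleftrightarrow>
     X \<in> M \<rightarrow>\<^sub>M N \<and> Y \<in> M \<rightarrow>\<^sub>M N' \<and>
     (AE \<omega> in M. prob_space (K (Y \<omega>)) \<and> sets (K (Y \<omega>)) = sets N) \<and>
     (\<forall>B\<in>sets N.
        (\<lambda>\<omega>. measure (K (Y \<omega>)) B) \<in> borel_measurable (vimage_algebra (space M) Y N') \<and>
        (AE \<omega> in M.
           real_cond_exp M (vimage_algebra (space M) Y N') (indicator (X -` B \<inter> space M)) \<omega>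
             = measure (K (Y \<omega>)) B))"

end

theory Submission
  imports Defs
begin

text \<open>Write \<open>\<prec>i\<close> for the set \<open>preds E i\<close>. In a Hasse ordering of a homogeneous graph the relation
  \<open>k \<in> preds E i\<close> is transitive, so \<open>T = L\<^sup>-\<^sup>1\<close> has the same zeros as \<open>L\<close>. Reading \<open>T \<Sigma> = D L\<^sup>T\<close> row by row gives
  \<open>(\<Sigma>\<^sup>\<prec>\<^sup>i)\<^sup>-\<^sup>1 \<Sigma>\<^sup>\<prec>\<^sub>i = - T\<^sub>i\<close> on \<open>\<prec>i\<close> and identifies \<open>D\<^sub>i\<^sub>i\<close> with the residual variance. As \<open>\<Sigma>\<^sup>-\<^sup>1 = T\<^sup>T D\<^sup>-\<^sup>1 T\<close>, the exponent
  \<open>tr (\<Sigma>\<^sup>-\<^sup>1 U)\<close> is the sum over \<open>i\<close> of \<open>T\<^sub>i U T\<^sub>i\<^sup>T / D\<^sub>i\<^sub>i\<close>; completing the square yields a Gaussian in the \<open>i\<close>-th regression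
  vector times an inverse gamma kernel in \<open>D\<^sub>i\<^sub>i\<close>. Finally \<open>L \<mapsto> - T\<close> is a composition of shears of the free
  coordinates and so preserves Lebesgue measure: the joint density is a product over the vertices.
  Finiteness of the normalising constant forces the inverse gamma shape to be positive.\<close>

subsection \<open>Homogeneous graphs and the inverse Cholesky factor\<close>

text \<open>Transitivity of predecessors is inclusion of closed neighbourhoods in disguise:
  homogeneity makes the neighbourhoods of adjacent vertices comparable, and the Hasse ordering
  excludes the wrong direction. In the theorem \<open>L\<close> and \<open>D\<close> are given only
  pointwise, as Cholesky factors of a random covariance. Each block is therefore treated as a
  function \<open>block_stat\<close> of the covariance alone, measurable by Cramer's rule, and
  matched with the Cholesky coordinates on \<open>Theta E\<close>. A single identity for nonnegative
  test functions carries the whole conclusion: the expectation of a product of functions of the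
  blocks is the product of iterated integrals, inverse gamma outside and normal inside.
  Independence, conditional laws and marginals are choices of test functions in it. Passing from a
  finite \<open>z_const\<close> to the single vertices needs care: in [0, infinity] a product can be
  finite although one factor is infinite, if another one is zero. So every factor is first shown to
  be nonzero. One elimination step, splitting off a diagonal entry and passing to the Schur
  complement, yields determinants, positive definiteness and Gaussian integrals alike.\<close>

lemma hasse_class_eq_iff:
  "hasse_class E i = hasse_class E j \<longleftrightarrow> closed_nbhd E i = closed_nbhd E j"
proof
  assume "hasse_class E i = hasse_class E j"
  moreover have "i \<in> hasse_class E i" by (simp add: hasse_class_def dominates_def)
  ultimately have "i \<in> hasse_class E j" by simp
  then show "closed_nbhd E i = closed_nbhd E j" by (auto simp: hasse_class_def dominates_def)
qed (simp add: hasse_class_def dominates_def)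

text \<open>\<open>hasse_ordered\<close> speaks only of paths in the diagram. A strict inclusion of
  neighbourhoods is refined into a chain of covering steps, by induction on the difference of the
  cardinalities.\<close>

lemma strict_dominates_less:
  fixes E :: "('n::{finite,linorder} \<times> 'n) set"
  assumes hasse: "hasse_ordered E" and dom: "closed_nbhd E j \<subset> closed_nbhd E i"
  shows "j < i"
proof -
  have "closed_nbhd E j \<subset> closed_nbhd E i \<Longrightarrow>
      (hasse_class E i, hasse_class E j) \<in> (hasse_diagram E)\<^sup>+" for i j
  proof (induction "card (closed_nbhd E i) - card (closed_nbhd E j)" arbitrary: i j
      rule: less_induct)
    case less
    show ?case
    proof (cases "\<exists>k. closed_nbhd E j \<subset> closed_nbhd E k \<and> closed_nbhd E k \<subset> closed_nbhd E i")
      case True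
      then obtain k where k: "closed_nbhd E j \<subset> closed_nbhd E k" "closed_nbhd E k \<subset> closed_nbhd E i"
        by blast
      then have "card (closed_nbhd E j) < card (closed_nbhd E k)"
        "card (closed_nbhd E k) < card (closed_nbhd E i)"
        by (simp_all add: psubset_card_mono)
      then show ?thesis
        using less.hyps[of i k] less.hyps[of k j] k
        by (metis diff_less_mono2 diff_less_mono less_imp_le less_trans trancl_trans)
    next
      case False
      then have "(hasse_class E i, hasse_class E j) \<in> hasse_diagram E"
        using less.prems unfolding hasse_diagram_def hasse_class_eq_iff dominates_def
        by blast
      then show ?thesis by blast
    qed
  qed
  with dom hasse show ?thesis unfolding hasse_ordered_def by blast
qed

locale hasse_graph =
  fixes E :: "('n::{finite,linorder} \<times> 'n) set"
  assumes sym: "sym E" and irrefl: "irrefl E"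
    and homogeneous: "homogeneous E" and hasse: "hasse_ordered E"
begin

text \<open>For an edge, homogeneity leaves two inclusions and the Hasse ordering rules out a strict
  one against the labels; equal neighbourhoods are left to the labels alone. Conversely
  \<open>j\<close> lies in its own closed neighbourhood, so the inclusion already forces adjacency.
  In this form transitivity of predecessors is immediate.\<close>

lemma preds_iff: "j \<in> preds E i \<longleftrightarrow> j < i \<and> closed_nbhd E j \<subseteq> closed_nbhd E i"
proof
  assume j: "j \<in> preds E i"
  then have "closed_nbhd E j \<subseteq> closed_nbhd E i \<or> closed_nbhd E i \<subseteq> closed_nbhd E j"
    using homogeneous by (auto simp: homogeneous_def preds_def)
  moreover have "\<not> closed_nbhd E i \<subset> closed_nbhd E j"
    using strict_dominates_less[OF hasse, of i j] j by (metis (mono_tags, lifting) less_asym mem_Collect_eq preds_def)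
  ultimately show "j < i \<and> closed_nbhd E j \<subseteq> closed_nbhd E i"
    using j by (auto simp: preds_def)
next
  assume j: "j < i \<and> closed_nbhd E j \<subseteq> closed_nbhd E i"
  then have "j \<in> closed_nbhd E i" by (auto simp: closed_nbhd_def)
  with j have "(j, i) \<in> E" by (auto simp: closed_nbhd_def)
  with j show "j \<in> preds E i" using sym by (auto simp: preds_def dest: symD)
qed

lemma preds_less: "j \<in> preds E i \<Longrightarrow> j < i"
  by (simp add: preds_iff)

lemma not_self_preds [simp]: "i \<notin> preds E i"
  by (simp add: preds_iff)

lemma preds_trans: "k \<in> preds E j \<Longrightarrow> j \<in> preds E i \<Longrightarrow> k \<in> preds E i"
  by (auto simp: preds_iff)

text \<open>Here \<open>i\<close> lies in the neighbourhood of \<open>k\<close>, which is contained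
  in that of \<open>j\<close>. This rules out fill-in: a product \<open>L_ik L_jk\<close> can be
  nonzero only if \<open>i = j\<close> or \<open>(i, j)\<close> is an edge.\<close>

lemma common_preds_edge:
  assumes "k \<in> insert i (preds E i)" "k \<in> insert j (preds E j)" "i \<noteq> j"
  shows "(i, j) \<in> E"
proof -
  have "closed_nbhd E k \<subseteq> closed_nbhd E j" using assms by (auto simp: preds_iff)
  moreover have "i \<in> closed_nbhd E k"
    using assms by (auto simp: closed_nbhd_def preds_def)
  ultimately show ?thesis using assms(3) by (auto simp: closed_nbhd_def)
qed

lemma L_space_supp: "L \<in> L_space E \<Longrightarrow> L $ i $ j \<noteq> 0 \<Longrightarrow> j \<in> insert i (preds E i)"
  by (cases i j rule: linorder_cases) (auto simp: L_space_def unit_lower_triangular_def preds_def)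

end

section \<open>Covariances and Cholesky factors with the zero pattern of the graph\<close>

lemma matrix_inv_eqI:
  fixes A :: "'n::finite sqmat"
  assumes "A ** B = mat 1"
  shows "matrix_inv A = B"
proof -
  have "A ** B = mat 1 \<and> B ** A = mat 1" using assms matrix_left_right_inverse by blast
  then have "A ** matrix_inv A = mat 1 \<and> matrix_inv A ** A = mat 1"
    unfolding matrix_inv_def by (rule someI)
  then show ?thesis using assms by (metis matrix_mul_assoc matrix_mul_lid matrix_mul_rid)
qed

lemma LDLt_nth:
  assumes "positive_diagonal (D :: 'n::finite sqmat)"
  shows "(L ** D ** transpose L) $ i $ j = (\<Sum>k\<in>UNIV. L $ i $ k * D $ k $ k * L $ j $ k)"
proof -
  have "(L ** D) $ i $ k = L $ i $ k * D $ k $ k" for k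
    using assms unfolding matrix_matrix_mult_def positive_diagonal_def vec_lambda_beta
    by (subst sum.remove[of _ k]) (auto intro!: sum.neutral)
  then show ?thesis
    by (subst matrix_matrix_mult_def) (simp add: transpose_def)
qed

text \<open>Only the covariance matrix is known to have the right zeros; those of its Cholesky factor
  follow column by column.\<close>

lemma (in hasse_graph) cholesky_in_Theta:
  assumes S: "S \<in> P_space E" and chol: "modified_cholesky S L D"
  shows "(L, D) \<in> Theta E"
proof -
  have L: "unit_lower_triangular L" and D: "positive_diagonal D"
    and S_eq: "S = L ** D ** transpose L"
    using chol by (auto simp: modified_cholesky_def)
  have zero: "j < i \<Longrightarrow> (i, j) \<notin> E \<Longrightarrow> L $ i $ j = 0" for i j
  proof (induction "card {..<j}" arbitrary: i j rule: less_induct)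
    case less
    \<comment> \<open>Only \<open>k = j\<close> survives in the expansion of
      \<open>S $ i $ j\<close>: above \<open>j\<close> the factor \<open>L $ j $ k\<close> is zero,
      and below it the non-adjacent \<open>i\<close> and \<open>j\<close> share no predecessor, so
      an earlier column supplies a zero.\<close>
    have small: "L $ i $ k * D $ k $ k * L $ j $ k = 0" if "k \<noteq> j" for k
    proof (cases "k < j")
      case True
      then have "card {..<k} < card {..<j}" by (intro psubset_card_mono) auto
      then have *: "(i, k) \<notin> E \<Longrightarrow> L $ i $ k = 0" "(j, k) \<notin> E \<Longrightarrow> L $ j $ k = 0"
        using less.hyps[of k i] less.hyps[of k j] True less.prems by auto
      have "(i, k) \<notin> E \<or> (j, k) \<notin> E"
        using common_preds_edge[of k i j] True less.prems by (force simp: preds_def)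
      with * show ?thesis by auto
    next
      case False
      with that have "j < k" by simp
      then show ?thesis using L by (simp add: unit_lower_triangular_def)
    qed
    have "S $ i $ j = L $ i $ j * D $ j $ j * L $ j $ j"
      unfolding S_eq LDLt_nth[OF D]
      by (subst sum.remove[of _ j]) (simp_all add: small del: mult_eq_0_iff)
    moreover have "S $ i $ j = 0" using S less.prems by (auto simp: P_space_def)
    ultimately show ?case using L D
      by (auto simp: unit_lower_triangular_def positive_diagonal_def) (metis less_irrefl)
  qed
  show ?thesis using L D zero by (auto simp: Theta_def L_space_def)
qed

text \<open>Writing \<open>T = L\<^sup>-\<^sup>1\<close>, the entries \<open>- T\<^sub>i\<^sub>k\<close> with \<open>k \<in> preds E i\<close> solve the triangular system
  \<open>T L = 1\<close>, read here as a recursion in \<open>k\<close> running downwards from \<open>i\<close>.\<close>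

function regr :: "('n::{finite,linorder} \<times> 'n) set \<Rightarrow> ('n \<times> 'n \<Rightarrow> real) \<Rightarrow> 'n \<Rightarrow> 'n \<Rightarrow> real" where
  "regr E l i k = l (i, k) - (\<Sum>j | j \<in> preds E i \<and> k \<in> preds E j. regr E l i j * l (j, k))"
  by auto
termination
proof (relation "Wellfounded.measure (\<lambda>(E, l, i, k). card {k<..})")
  fix E :: "('n::{finite,linorder} \<times> 'n) set" and l :: "'n \<times> 'n \<Rightarrow> real" and i k j
  assume "j \<in> {j. j \<in> preds E i \<and> k \<in> preds E j}"
  then have "k < j" by (simp add: preds_def)
  then have "card {j<..} < card {k<..}" by (intro psubset_card_mono) auto
  then show "((E, l, i, j), (E, l, i, k)) \<in> Wellfounded.measure (\<lambda>(E, l, i, k). card {k<..})"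
    by simp
qed simp

declare regr.simps [simp del]

text \<open>The matrix \<open>T\<close> of the overview: regression coefficients are the negated
  off-diagonal entries of the inverse of \<open>L\<close>.\<close>

definition regr_matrix :: "('n::{finite,linorder} \<times> 'n) set \<Rightarrow> 'n sqmat \<Rightarrow> 'n sqmat" where
  "regr_matrix E L = (\<chi> i k. if k = i then 1 else
     if k \<in> preds E i then - regr E (\<lambda>(i, k). L $ i $ k) i k else 0)"

context hasse_graph
begin

lemma regr_matrix_sum:
  "(\<Sum>j\<in>UNIV. regr_matrix E L $ i $ j * f j) =
     f i - (\<Sum>j\<in>preds E i. regr E (\<lambda>(i, k). L $ i $ k) i j * f j)"
proof -
  have "(\<Sum>j\<in>UNIV. regr_matrix E L $ i $ j * f j)
      = (\<Sum>j\<in>insert i (preds E i). regr_matrix E L $ i $ j * f j)"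
    by (intro sum.mono_neutral_right) (auto simp: regr_matrix_def)
  also have "\<dots> = f i + (\<Sum>j\<in>preds E i. - regr E (\<lambda>(i, k). L $ i $ k) i j * f j)"
    by (auto simp: regr_matrix_def intro!: sum.cong)
  finally show ?thesis by (simp add: sum_negf)
qed

text \<open>For \<open>k\<close> in \<open>preds E i\<close> the recursion of \<open>regr\<close>
  states exactly that entry \<open>(i, k)\<close> of the product vanishes. For other
  \<open>k\<close>, transitivity of predecessors makes every term zero, which is why the inverse may
  be supported on \<open>preds\<close>.\<close>

lemma regr_matrix_mult:
  assumes L: "L \<in> L_space E"
  shows "regr_matrix E L ** L = mat 1"
proof -
  let ?x = "\<lambda>i k. regr E (\<lambda>(i, k). L $ i $ k) i k"
  have "L $ i $ k - (\<Sum>j\<in>preds E i. ?x i j * L $ j $ k) = (if i = k then 1 else 0)" for i k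
  proof (cases "k \<in> preds E i")
    case True
    have "(\<Sum>j\<in>preds E i. ?x i j * L $ j $ k)
        = (\<Sum>j\<in>insert k {j. j \<in> preds E i \<and> k \<in> preds E j}. ?x i j * L $ j $ k)"
      using L_space_supp[OF L] True by (intro sum.mono_neutral_right) auto
    also have "\<dots> = ?x i k + (\<Sum>j | j \<in> preds E i \<and> k \<in> preds E j. ?x i j * L $ j $ k)"
      using L by (simp add: L_space_def unit_lower_triangular_def)
    also have "\<dots> = L $ i $ k" by (subst regr.simps) simp
    finally show ?thesis using True by auto
  next
    case False
    have "L $ j $ k = 0" if "j \<in> preds E i" for j
    proof (rule ccontr)
      assume "L $ j $ k \<noteq> 0"
      then show False using L_space_supp[OF L] that False preds_trans by blast
    qed
    then have "(\<Sum>j\<in>preds E i. ?x i j * L $ j $ k) = 0" by simp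
    moreover have "L $ i $ k = (if i = k then 1 else 0)"
      using L_space_supp[OF L, of i k] False L by (auto simp: L_space_def unit_lower_triangular_def)
    ultimately show ?thesis by simp
  qed
  then show ?thesis
    by (simp add: vec_eq_iff matrix_matrix_mult_def mat_def regr_matrix_sum)
qed

lemma regr_matrix_mult':
  "L \<in> L_space E \<Longrightarrow> L ** regr_matrix E L = mat 1"
  using regr_matrix_mult matrix_left_right_inverse by blast

lemma regr_matrix_mult_cov:
  assumes \<theta>: "(L, D) \<in> Theta E"
  shows "(\<Sum>j\<in>UNIV. regr_matrix E L $ i $ j * (L ** D ** transpose L) $ j $ k)
    = D $ i $ i * L $ k $ i"
proof -
  have L: "L \<in> L_space E" and D: "positive_diagonal D" using \<theta> by (auto simp: Theta_def)
  have "(\<Sum>j\<in>UNIV. regr_matrix E L $ i $ j * (L ** D ** transpose L) $ j $ k)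
      = (regr_matrix E L ** (L ** D ** transpose L)) $ i $ k"
    by (simp add: matrix_matrix_mult_def)
  also have "regr_matrix E L ** (L ** D ** transpose L) = D ** transpose L"
    by (simp add: matrix_mul_assoc regr_matrix_mult[OF L])
  also have "(D ** transpose L) $ i $ k = D $ i $ i * L $ k $ i"
    using D unfolding matrix_matrix_mult_def positive_diagonal_def
    by (simp, subst sum.remove[of _ i]) (auto simp: transpose_def intro!: sum.neutral)
  finally show ?thesis .
qed

text \<open>Normal equations of the regression on the predecessors: for \<open>k < i\<close> the
  right side \<open>D_ii L_ki\<close> of \<open>regr_matrix_mult_cov\<close> is zero. The case
  \<open>k = i\<close> gives the residual variance in \<open>cov_residual\<close>.\<close>

lemma cov_regr_system:
  assumes "(L, D) \<in> Theta E" and "k \<in> preds E i"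
  defines "S \<equiv> L ** D ** transpose L"
  shows "(\<Sum>j\<in>preds E i. regr E (\<lambda>(i, k). L $ i $ k) i j * S $ j $ k) = S $ i $ k"
proof -
  have "L $ k $ i = 0"
    using assms(1) preds_less[OF assms(2)] by (auto simp: Theta_def L_space_def unit_lower_triangular_def)
  then show ?thesis
    using regr_matrix_mult_cov[OF assms(1), of i k] by (simp add: regr_matrix_sum S_def)
qed

lemma cov_residual:
  assumes "(L, D) \<in> Theta E"
  defines "S \<equiv> L ** D ** transpose L"
  shows "S $ i $ i - (\<Sum>j\<in>preds E i. regr E (\<lambda>(i, k). L $ i $ k) i j * S $ j $ i) = D $ i $ i"
proof -
  have "L $ i $ i = 1"
    using assms(1) by (auto simp: Theta_def L_space_def unit_lower_triangular_def)
  then show ?thesis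
    using regr_matrix_mult_cov[OF assms(1), of i i] by (simp add: regr_matrix_sum S_def)
qed

lemma cov_in_P_space:
  assumes \<theta>: "(L, D) \<in> Theta E"
  shows "L ** D ** transpose L \<in> P_space E"
proof -
  have L: "L \<in> L_space E" and D: "positive_diagonal D" using \<theta> by (auto simp: Theta_def)
  let ?S = "L ** D ** transpose L"
  have sym: "transpose ?S = ?S"
    by (auto simp: vec_eq_iff transpose_def LDLt_nth[OF D, unfolded transpose_def] mult_ac
        intro!: sum.cong)
  have pos: "0 < x \<bullet> (?S *v x)" if "x \<noteq> 0" for x
  proof -
    have "x \<bullet> (?S *v x) = (\<Sum>i\<in>UNIV. \<Sum>j\<in>UNIV. \<Sum>k\<in>UNIV.
        x $ i * (L $ i $ k * D $ k $ k * L $ j $ k * x $ j))"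
      by (simp add: inner_vec_def matrix_vector_mult_def LDLt_nth[OF D] sum_distrib_left
          sum_distrib_right mult_ac)
    also have "\<dots> = (\<Sum>i\<in>UNIV. \<Sum>k\<in>UNIV. \<Sum>j\<in>UNIV.
        x $ i * (L $ i $ k * D $ k $ k * L $ j $ k * x $ j))"
      by (intro sum.cong refl sum.swap)
    also have "\<dots> = (\<Sum>k\<in>UNIV. \<Sum>i\<in>UNIV. \<Sum>j\<in>UNIV.
        x $ i * (L $ i $ k * D $ k $ k * L $ j $ k * x $ j))"
      by (rule sum.swap)
    also have "\<dots> = (\<Sum>k\<in>UNIV. D $ k $ k * ((transpose L *v x) $ k)\<^sup>2)"
      by (simp add: matrix_vector_mult_def transpose_def power2_eq_square sum_product
          sum_distrib_left mult_ac)
    finally have eq: "x \<bullet> (?S *v x) = (\<Sum>k\<in>UNIV. D $ k $ k * ((transpose L *v x) $ k)\<^sup>2)" .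
    \<comment> \<open>A left inverse of the transpose of \<open>L\<close> shows that it is
      injective, so one of the squares above is strictly positive.\<close>
    have "transpose (regr_matrix E L) ** transpose L = mat 1"
      by (simp add: matrix_transpose_mul[symmetric] regr_matrix_mult'[OF L] transpose_mat)
    then have "transpose (regr_matrix E L) *v (transpose L *v x) = x"
      by (metis matrix_vector_mul_assoc matrix_vector_mul_lid)
    with that have "transpose L *v x \<noteq> 0" by auto
    then obtain k where "(transpose L *v x) $ k \<noteq> 0" by (auto simp: vec_eq_iff)
    then have "0 < D $ k $ k * ((transpose L *v x) $ k)\<^sup>2"
      using D by (simp add: positive_diagonal_def)
    moreover have "0 \<le> D $ j $ j * ((transpose L *v x) $ j)\<^sup>2" for j
      using D by (simp add: positive_diagonal_def less_imp_le)
    ultimately show ?thesis unfolding eq by (intro sum_pos2[of _ k]) auto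
  qed
  \<comment> \<open>A column \<open>k\<close> in which rows \<open>i\<close> and \<open>j\<close> of
    \<open>L\<close> are both nonzero would be a common weak predecessor and force an edge.\<close>
  have "?S $ i $ j = 0" if "i \<noteq> j" "(i, j) \<notin> E" for i j
  proof -
    have "L $ i $ k = 0 \<or> L $ j $ k = 0" for k
      using common_preds_edge[of k i j] L_space_supp[OF L] that by blast
    then show ?thesis unfolding LDLt_nth[OF D]
      by (metis (no_types, lifting) mult_zero_left mult_zero_right sum.neutral)
  qed
  with sym pos show ?thesis by (auto simp: P_space_def positive_definite_def)
qed

lemma trace_inverse_cov:
  assumes \<theta>: "(L, D) \<in> Theta E"
  shows "trace (matrix_inv (L ** D ** transpose L) ** U) =
    (\<Sum>i\<in>UNIV. (\<Sum>j\<in>UNIV. \<Sum>k\<in>UNIV.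
       regr_matrix E L $ i $ j * regr_matrix E L $ i $ k * U $ j $ k) / D $ i $ i)"
proof -
  have L: "L \<in> L_space E" and D: "positive_diagonal D" using \<theta> by (auto simp: Theta_def)
  let ?T = "regr_matrix E L"
  define D' where "D' = (\<chi> i j. if i = j then 1 / D $ i $ i else 0)"
  have Dne: "D $ i $ i \<noteq> 0" for i using D by (auto simp: positive_diagonal_def) (metis less_irrefl)
  then have D': "positive_diagonal D'" using D by (auto simp: D'_def positive_diagonal_def)
  have "D ** D' = mat 1"
    using D Dne unfolding positive_diagonal_def
    by (auto simp: vec_eq_iff matrix_matrix_mult_def mat_def D'_def if_distrib cong: if_cong)
  then have "L ** D ** transpose L ** (transpose ?T ** D' ** ?T) = mat 1"
    using regr_matrix_mult'[OF L]
    by (metis matrix_mul_assoc matrix_mul_rid matrix_transpose_mul regr_matrix_mult[OF L] transpose_mat)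
  then have "matrix_inv (L ** D ** transpose L) = transpose ?T ** D' ** ?T"
    by (rule matrix_inv_eqI)
  \<comment> \<open>The inverse is again of the form \<open>L D L^T\<close>, with the transpose of
    \<open>T\<close> for \<open>L\<close> and \<open>D'\<close> for \<open>D\<close>, so that
    \<open>LDLt_nth\<close> gives its entries.\<close>
  then have "trace (matrix_inv (L ** D ** transpose L) ** U)
      = (\<Sum>j\<in>UNIV. \<Sum>k\<in>UNIV. (\<Sum>i\<in>UNIV. ?T $ i $ j * D' $ i $ i * ?T $ i $ k) * U $ k $ j)"
    using LDLt_nth[OF D', of "transpose ?T"]
    by (simp add: trace_def matrix_matrix_mult_def[of _ U] transpose_transpose) 
      (simp add: transpose_def)
  also have "\<dots> = (\<Sum>j\<in>UNIV. \<Sum>k\<in>UNIV. \<Sum>i\<in>UNIV. ?T $ i $ j * ?T $ i $ k * U $ k $ j / D $ i $ i)"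
    by (simp add: sum_distrib_right sum_distrib_left D'_def mult_ac)
  also have "\<dots> = (\<Sum>j\<in>UNIV. \<Sum>i\<in>UNIV. \<Sum>k\<in>UNIV. ?T $ i $ j * ?T $ i $ k * U $ k $ j / D $ i $ i)"
    by (intro sum.cong refl sum.swap)
  also have "\<dots> = (\<Sum>i\<in>UNIV. \<Sum>j\<in>UNIV. \<Sum>k\<in>UNIV. ?T $ i $ j * ?T $ i $ k * U $ k $ j / D $ i $ i)"
    by (rule sum.swap)
  also have "\<dots> = (\<Sum>i\<in>UNIV. \<Sum>k\<in>UNIV. \<Sum>j\<in>UNIV. ?T $ i $ j * ?T $ i $ k * U $ k $ j / D $ i $ i)"
    by (intro sum.cong refl sum.swap)
  finally show ?thesis by (simp add: sum_divide_distrib mult_ac)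
qed

end

subsection \<open>Principal submatrices\<close>

text \<open>Filling up with the identity outside \<open>I\<close> turns inverses and determinants of
  a principal submatrix into those of a full matrix, where \<open>det\<close> and Cramer's rule are
  available.\<close>

definition padded :: "'n set \<Rightarrow> 'n::finite sqmat \<Rightarrow> 'n sqmat" where
  "padded I A = (\<chi> k l. if k \<in> I \<and> l \<in> I then A $ k $ l else if k = l then 1 else 0)"

lemma padded_mult:
  "padded I A ** padded I B = padded I (\<chi> k l. \<Sum>p\<in>I. A $ k $ p * B $ p $ l)"
proof -
  have "(\<Sum>p\<in>UNIV. padded I A $ k $ p * padded I B $ p $ l) =
      padded I (\<chi> k l. \<Sum>p\<in>I. A $ k $ p * B $ p $ l) $ k $ l" for k l
  proof (cases "k \<in> I")
    case True
    have "(\<Sum>p\<in>UNIV. padded I A $ k $ p * padded I B $ p $ l)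
        = (\<Sum>p\<in>I. padded I A $ k $ p * padded I B $ p $ l)"
      using True by (intro sum.mono_neutral_right) (auto simp: padded_def)
    also have "\<dots> = (if l \<in> I then \<Sum>p\<in>I. A $ k $ p * B $ p $ l else 0)"
      using True by (auto simp: padded_def intro!: sum.neutral)
    finally show ?thesis using True by (auto simp: padded_def)
  next
    case False
    then have "(\<Sum>p\<in>UNIV. padded I A $ k $ p * padded I B $ p $ l) = padded I B $ k $ l"
      by (subst sum.remove[of _ k]) (auto simp: padded_def intro!: sum.neutral)
    with False show ?thesis by (simp add: padded_def)
  qed
  then show ?thesis by (simp add: vec_eq_iff matrix_matrix_mult_def)
qed

lemma padded_eq_mat_1:
  "padded I A = mat 1 \<longleftrightarrow> (\<forall>k\<in>I. \<forall>l\<in>I. A $ k $ l = (if k = l then 1 else 0))"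
  by (auto simp: padded_def mat_def vec_eq_iff)

lemma padded_mult_eq_mat_1:
  "padded I A ** padded I B = mat 1 \<longleftrightarrow>
     (\<forall>k\<in>I. \<forall>l\<in>I. (\<Sum>p\<in>I. A $ k $ p * B $ p $ l) = (if k = l then 1 else 0))"
  by (simp add: padded_mult padded_eq_mat_1)

text \<open>A permutation moving a point outside \<open>I\<close> meets an off-diagonal zero of the
  padding; all others contribute factors 1 there.\<close>

lemma sub_det_eq: "sub_det I A = det (padded I (A :: 'n::finite sqmat))"
proof -
  have "det (padded I A) = (\<Sum>p | p permutes I. of_int (sign p) * (\<Prod>k\<in>UNIV. padded I A $ k $ p k))"
    unfolding det_def
  proof (rule sum.mono_neutral_right)
    show "{p. p permutes I} \<subseteq> {p. p permutes UNIV}"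
      using permutes_subset by blast
    show "\<forall>p\<in>{p. p permutes UNIV} - {p. p permutes I}.
        of_int (sign p) * (\<Prod>k\<in>UNIV. padded I A $ k $ p k) = 0"
    proof
      fix p assume p: "p \<in> {p. p permutes UNIV} - {p. p permutes I}"
      then obtain k where "k \<notin> I" "p k \<noteq> k" by (auto simp: permutes_def)
      then have "padded I A $ k $ p k = 0" by (auto simp: padded_def)
      then have "(\<Prod>k\<in>UNIV. padded I A $ k $ p k) = 0" by (auto intro: prod_zero)
      then show "of_int (sign p) * (\<Prod>k\<in>UNIV. padded I A $ k $ p k) = 0" by simp
    qed
  qed simp
  also have "\<dots> = sub_det I A"
    unfolding sub_det_def
  proof (rule sum.cong)
    fix p assume p: "p \<in> {p. p permutes I}"
    have "(\<Prod>k\<in>UNIV. padded I A $ k $ p k) = (\<Prod>k\<in>I. padded I A $ k $ p k)"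
      using p by (intro prod.mono_neutral_right) (auto simp: padded_def permutes_def)
    also have "\<dots> = (\<Prod>k\<in>I. A $ k $ p k)"
      using p by (intro prod.cong) (auto simp: padded_def permutes_in_image)
    finally show "of_int (sign p) * (\<Prod>k\<in>UNIV. padded I A $ k $ p k) =
        of_int (sign p) * (\<Prod>k\<in>I. A $ k $ p k)" by simp
  qed simp
  finally show ?thesis by simp
qed

text \<open>Inverses of the padded matrix are unique, and the zeros demanded outside
  \<open>I\<close> fix the remaining entries. So the choice in \<open>sub_inv\<close> has only one
  candidate.\<close>

lemma sub_inv_eqI:
  assumes "padded I A ** padded I B = mat 1" and "\<And>k l. k \<notin> I \<or> l \<notin> I \<Longrightarrow> B $ k $ l = 0"
  shows "sub_inv I A = B"
proof -
  have *: "padded I B ** padded I A = mat 1"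
    using assms(1) matrix_left_right_inverse by blast
  let ?P = "\<lambda>B. (\<forall>k\<in>I. \<forall>l\<in>I. (\<Sum>p\<in>I. A $ k $ p * B $ p $ l) = (if k = l then 1 else 0)) \<and>
     (\<forall>k\<in>I. \<forall>l\<in>I. (\<Sum>p\<in>I. B $ k $ p * A $ p $ l) = (if k = l then 1 else 0)) \<and>
     (\<forall>k l. k \<notin> I \<or> l \<notin> I \<longrightarrow> B $ k $ l = 0)"
  have "?P B" using assms * unfolding padded_mult_eq_mat_1 by blast
  then have C: "?P (sub_inv I A)" unfolding sub_inv_def by (rule someI)
  then have "padded I A ** padded I (sub_inv I A) = mat 1"
    unfolding padded_mult_eq_mat_1 by blast
  with * have "padded I (sub_inv I A) = padded I B"
    by (metis matrix_mul_assoc matrix_mul_lid matrix_mul_rid)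
  then have "sub_inv I A $ k $ l = B $ k $ l" if "k \<in> I" "l \<in> I" for k l
    using that by (simp add: padded_def vec_eq_iff) metis
  then show ?thesis using C assms(2) unfolding vec_eq_iff by metis
qed

lemma sub_inv_mult:
  assumes "sub_det I A \<noteq> 0"
  shows "padded I A ** padded I (sub_inv I A) = mat 1"
proof -
  obtain C where C: "padded I A ** C = mat 1"
    using assms invertible_det_nz unfolding sub_det_eq invertible_def by blast
  \<comment> \<open>For \<open>k\<close> in \<open>I\<close>, row \<open>k\<close> of the padded
    matrix is supported on \<open>I\<close>, so only the block of \<open>C\<close> over
    \<open>I\<close> matters.\<close>
  define B where "B = (\<chi> k l. if k \<in> I \<and> l \<in> I then C $ k $ l else 0)"
  have "(\<Sum>p\<in>I. A $ k $ p * B $ p $ l) = (if k = l then 1 else 0)" if "k \<in> I" "l \<in> I" for k l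
  proof -
    have "(\<Sum>p\<in>UNIV. padded I A $ k $ p * C $ p $ l) = (if k = l then 1 else 0)"
      using C by (simp add: vec_eq_iff matrix_matrix_mult_def mat_def)
    moreover have "(\<Sum>p\<in>UNIV. padded I A $ k $ p * C $ p $ l)
        = (\<Sum>p\<in>I. padded I A $ k $ p * C $ p $ l)"
      using that by (intro sum.mono_neutral_right) (auto simp: padded_def)
    moreover have "(\<Sum>p\<in>I. padded I A $ k $ p * C $ p $ l) = (\<Sum>p\<in>I. A $ k $ p * B $ p $ l)"
      using that by (intro sum.cong) (auto simp: padded_def B_def)
    ultimately show ?thesis by simp
  qed
  then have B: "padded I A ** padded I B = mat 1" unfolding padded_mult_eq_mat_1 by blast
  moreover have "sub_inv I A = B"
    using B by (rule sub_inv_eqI) (auto simp: B_def)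
  ultimately show ?thesis by simp
qed

lemma sub_inv_mult':
  "sub_det I A \<noteq> 0 \<Longrightarrow> padded I (sub_inv I A) ** padded I A = mat 1"
  using sub_inv_mult matrix_left_right_inverse by blast

lemma sub_det_sub_inv:
  assumes "sub_det I A \<noteq> 0"
  shows "sub_det I (sub_inv I A) = 1 / sub_det I A"
proof -
  have "det (padded I A ** padded I (sub_inv I A)) = 1" using sub_inv_mult[OF assms] by simp
  then show ?thesis using assms by (simp add: sub_det_eq det_mul field_simps)
qed

lemma sub_det_scaleR: "sub_det I (d *\<^sub>R A) = d ^ card I * sub_det I A"
  by (simp add: sub_det_def prod.distrib sum_distrib_left mult_ac)

text \<open>The precision matrix of a covariance \<open>d U^-1\<close> is \<open>U / d\<close>; this
  is what \<open>mv_normal\<close> sees in its exponent.\<close>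

lemma sub_inv_scaleR_sub_inv:
  assumes "sub_det I A \<noteq> 0" "d \<noteq> 0" "k \<in> I" "l \<in> I"
  shows "sub_inv I (d *\<^sub>R sub_inv I A) $ k $ l = A $ k $ l / d"
proof -
  let ?B = "\<chi> k l. if k \<in> I \<and> l \<in> I then A $ k $ l / d else 0"
  have "padded I (d *\<^sub>R sub_inv I A) ** padded I ?B = mat 1"
    using sub_inv_mult'[OF assms(1)] assms(2) unfolding padded_mult_eq_mat_1 by simp
  then have "sub_inv I (d *\<^sub>R sub_inv I A) = ?B" by (rule sub_inv_eqI) auto
  then show ?thesis using assms by simp
qed

text \<open>Relative to an index set, so that inductions can pass to Schur complements on smaller
  sets without keeping a positive definite full matrix.\<close>

definition pd_on :: "'n set \<Rightarrow> 'n::finite sqmat \<Rightarrow> bool" where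
  "pd_on I A \<longleftrightarrow> (\<forall>k\<in>I. \<forall>l\<in>I. A $ k $ l = A $ l $ k) \<and>
     (\<forall>x. (\<exists>k\<in>I. x k \<noteq> 0) \<longrightarrow> 0 < (\<Sum>k\<in>I. \<Sum>l\<in>I. x k * A $ k $ l * x l))"

lemma pd_on_pos:
  assumes "pd_on I A" "k \<in> I" "x k \<noteq> 0"
  shows "0 < (\<Sum>k\<in>I. \<Sum>l\<in>I. x k * A $ k $ l * x l)"
proof -
  have "(\<exists>k\<in>I. x k \<noteq> 0) \<longrightarrow> 0 < (\<Sum>k\<in>I. \<Sum>l\<in>I. x k * A $ k $ l * x l)"
    using assms(1) unfolding pd_on_def by (rule conjunct2[THEN spec])
  then show ?thesis by (rule mp) (use assms(2,3) in blast)
qed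

lemma pd_on_sym:
  assumes "pd_on I A" "k \<in> I" "l \<in> I"
  shows "A $ k $ l = A $ l $ k"
  by (rule assms(1)[unfolded pd_on_def, THEN conjunct1, rule_format, OF assms(2,3)])

lemma positive_definite_sym:
  assumes "positive_definite A"
  shows "A $ k $ l = A $ l $ k"
proof -
  have "transpose A $ k $ l = A $ k $ l" using assms by (simp add: positive_definite_def)
  then show ?thesis by (simp add: transpose_def)
qed

lemma positive_definite_imp_pd_on:
  assumes "positive_definite (A :: 'n::finite sqmat)"
  shows "pd_on I A"
proof -
  have pos: "0 < (\<Sum>k\<in>I. \<Sum>l\<in>I. x k * A $ k $ l * x l)" if "\<exists>k\<in>I. x k \<noteq> 0" for x
  proof -
    let ?v = "\<chi> k. if k \<in> I then x k else 0"
    have "?v \<noteq> 0" using that by (auto simp: vec_eq_iff)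
    then have "0 < ?v \<bullet> (A *v ?v)" using assms by (simp add: positive_definite_def)
    also have "\<dots> = (\<Sum>k\<in>UNIV. \<Sum>l\<in>UNIV. ?v $ k * A $ k $ l * ?v $ l)"
      by (simp add: inner_vec_def matrix_vector_mult_def sum_distrib_left mult_ac)
    also have "\<dots> = (\<Sum>k\<in>I. \<Sum>l\<in>UNIV. ?v $ k * A $ k $ l * ?v $ l)"
      by (intro sum.mono_neutral_right) auto
    also have "\<dots> = (\<Sum>k\<in>I. \<Sum>l\<in>I. ?v $ k * A $ k $ l * ?v $ l)"
      by (intro sum.cong refl sum.mono_neutral_right) auto
    finally show ?thesis by (simp cong: sum.cong)
  qed
  show ?thesis unfolding pd_on_def
  proof (intro conjI ballI allI impI)
    fix x :: "'n \<Rightarrow> real" assume "\<exists>k\<in>I. x k \<noteq> 0"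
    then show "0 < (\<Sum>k\<in>I. \<Sum>l\<in>I. x k * A $ k $ l * x l)" by (rule pos)
  qed (rule positive_definite_sym[OF assms])
qed

text \<open>Completing the square in the variable \<open>z i\<close>; what remains is the form of
  the Schur complement of the pivot \<open>A $ i $ i\<close>.\<close>

lemma quadratic_form_insert:
  fixes A :: "'n::finite sqmat"
  assumes i: "i \<notin> J" "A $ i $ i \<noteq> 0" and sym: "\<And>k. k \<in> J \<Longrightarrow> A $ k $ i = A $ i $ k"
  shows "(\<Sum>k\<in>insert i J. \<Sum>l\<in>insert i J. z k * A $ k $ l * z l) =
    A $ i $ i * (z i + (\<Sum>j\<in>J. A $ i $ j * z j) / A $ i $ i)\<^sup>2 +
    (\<Sum>k\<in>J. \<Sum>l\<in>J. z k * (A $ k $ l - A $ k $ i * A $ i $ l / A $ i $ i) * z l)"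
proof -
  define q where "q = (\<Sum>j\<in>J. A $ i $ j * z j)"
  have q': "(\<Sum>k\<in>J. z k * A $ k $ i) = q"
    unfolding q_def by (intro sum.cong refl) (simp add: sym mult.commute)
  have "(\<Sum>k\<in>insert i J. \<Sum>l\<in>insert i J. z k * A $ k $ l * z l)
      = A $ i $ i * (z i)\<^sup>2 + z i * q + q * z i + (\<Sum>k\<in>J. \<Sum>l\<in>J. z k * A $ k $ l * z l)"
  proof -
    have 1: "(\<Sum>l\<in>J. z i * A $ i $ l * z l) = z i * q"
      by (simp add: q_def sum_distrib_left mult.assoc)
    have 2: "(\<Sum>k\<in>J. z k * A $ k $ i * z i) = q * z i"
      by (simp add: q'[symmetric] sum_distrib_right)
    show ?thesis using i by (simp add: sum.distrib 1 2 power2_eq_square)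
  qed
  moreover have "(\<Sum>k\<in>J. \<Sum>l\<in>J. z k * (A $ k $ l - A $ k $ i * A $ i $ l / A $ i $ i) * z l)
      = (\<Sum>k\<in>J. \<Sum>l\<in>J. z k * A $ k $ l * z l) - q * q / A $ i $ i"
  proof -
    have "q * q / A $ i $ i = (\<Sum>k\<in>J. \<Sum>l\<in>J. z k * (A $ k $ i * A $ i $ l / A $ i $ i) * z l)"
    proof -
      have "q * q = (\<Sum>k\<in>J. z k * A $ k $ i) * (\<Sum>l\<in>J. A $ i $ l * z l)"
        unfolding q' q_def ..
      then show ?thesis by (simp add: sum_product sum_divide_distrib mult_ac)
    qed
    then show ?thesis by (simp add: sum_subtractf algebra_simps)
  qed
  moreover have "A $ i $ i * (z i)\<^sup>2 + z i * q + q * z i + R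
      = A $ i $ i * (z i + q / A $ i $ i)\<^sup>2 + (R - q * q / A $ i $ i)" for R
    using i(2) by (simp add: power2_eq_square field_simps)
  ultimately show ?thesis unfolding q_def[symmetric] by presburger
qed

text \<open>Gaussian elimination as a factorisation \<open>M u ** B ** transpose (M v)\<close> of
  the padded matrix. \<open>M u\<close> is the identity with column \<open>i\<close> replaced by
  \<open>u\<close>, whose determinant is \<open>u $ i = 1\<close> by Cramer's lemma, and
  \<open>B\<close> is the padded Schur complement \<open>C\<close> with row \<open>i\<close>
  multiplied by the pivot.\<close>

lemma sub_det_insert:
  fixes A :: "'n::finite sqmat"
  assumes i: "i \<notin> J" "A $ i $ i \<noteq> 0"
  shows "sub_det (insert i J) A =
    A $ i $ i * sub_det J (\<chi> k l. A $ k $ l - A $ k $ i * A $ i $ l / A $ i $ i)"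
proof -
  define C where "C = padded J (\<chi> k l. A $ k $ l - A $ k $ i * A $ i $ l / A $ i $ i)"
  define u where "u = (\<chi> k. if k = i then 1 else if k \<in> J then A $ k $ i / A $ i $ i else 0)"
  define v where "v = (\<chi> k. if k = i then 1 else if k \<in> J then A $ i $ k / A $ i $ i else 0)"
  define M where "M u = (\<chi> k l. if l = i then (mat 1 *v u) $ k else mat 1 $ k $ l)" for u :: "(real, 'n) vec"
  have M: "det (M u) = u $ i" for u unfolding M_def by (subst cramer_lemma) simp
  have M_nth: "M u $ k $ l = (if l = i then u $ k else mat 1 $ k $ l)" for u k l
    by (simp add: M_def)
  define B where "B = (\<chi> k. if k = i then A $ i $ i *s C $ k else C $ k)"
  have B: "det B = A $ i $ i * det C"
    unfolding B_def det_row_mul by (rule arg_cong[of _ _ "\<lambda>C. A $ i $ i * det C"]) (simp add: vec_eq_iff)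
  have Cii: "C $ i $ l = (if l = i then 1 else 0)" "C $ l $ i = (if l = i then 1 else 0)" for l
    using i by (auto simp: C_def padded_def)
  have BN: "(B ** transpose (M v)) $ k $ l = B $ k $ l + (if k = i \<and> l \<noteq> i then A $ i $ i * v $ l else 0)" for k l
  proof -
    have "(B ** transpose (M v)) $ k $ l = (\<Sum>p\<in>UNIV. B $ k $ p * M v $ l $ p)"
      by (simp add: matrix_matrix_mult_def transpose_def)
    also have "\<dots> = (\<Sum>p\<in>UNIV. (if p = i then B $ k $ i * v $ l else 0) +
        (if p = l \<and> l \<noteq> i then B $ k $ l else 0))"
      by (intro sum.cong) (auto simp: M_nth mat_def)
    also have "\<dots> = B $ k $ i * v $ l + (if l \<noteq> i then B $ k $ l else 0)"
      by (subst sum.distrib) (auto simp: sum.delta)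
    finally show ?thesis by (auto simp: B_def Cii v_def)
  qed
  have "(M u ** (B ** transpose (M v))) $ k $ l = padded (insert i J) A $ k $ l" for k l
  proof -
    let ?K = "B ** transpose (M v)"
    have "(M u ** ?K) $ k $ l = (\<Sum>p\<in>UNIV. M u $ k $ p * ?K $ p $ l)"
      by (simp add: matrix_matrix_mult_def)
    also have "\<dots> = (\<Sum>p\<in>UNIV. (if p = i then u $ k * ?K $ i $ l else 0) +
        (if p = k \<and> k \<noteq> i then ?K $ k $ l else 0))"
      by (intro sum.cong) (auto simp: M_nth mat_def)
    also have "\<dots> = u $ k * ?K $ i $ l + (if k \<noteq> i then ?K $ k $ l else 0)"
      by (subst sum.distrib) (auto simp: sum.delta)
    finally show ?thesis using i
      by (auto simp: BN) (auto simp: B_def Cii u_def v_def padded_def C_def)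
  qed
  then have "padded (insert i J) A = M u ** (B ** transpose (M v))" by (simp add: vec_eq_iff)
  then have "det (padded (insert i J) A) = A $ i $ i * det C"
    by (simp add: det_mul M B u_def v_def)
  then show ?thesis by (simp add: sub_det_eq C_def)
qed

lemma pd_on_diag_pos:
  assumes "pd_on I A" "i \<in> I"
  shows "0 < A $ i $ i"
proof -
  let ?x = "\<lambda>k. if k = i then 1 else 0 :: real"
  have "0 < (\<Sum>k\<in>I. \<Sum>l\<in>I. ?x k * A $ k $ l * ?x l)"
    by (rule pd_on_pos[OF assms]) simp
  also have "\<dots> = (\<Sum>k\<in>I. if k = i then A $ i $ i else 0)"
    using assms(2) by (intro sum.cong) (auto simp: if_distrib sum.delta cong: if_cong)
  also have "\<dots> = A $ i $ i" using assms(2) by (simp add: sum.delta)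
  finally show ?thesis .
qed

lemma pd_on_schur:
  fixes A :: "'n::finite sqmat"
  assumes pd: "pd_on (insert i J) A" and i: "i \<notin> J"
  shows "pd_on J (\<chi> k l. A $ k $ l - A $ k $ i * A $ i $ l / A $ i $ i)"
proof -
  have sym: "A $ k $ l = A $ l $ k" if "k \<in> insert i J" "l \<in> insert i J" for k l
    using pd that by (rule pd_on_sym)
  have Aii: "A $ i $ i \<noteq> 0" using pd_on_diag_pos[OF pd] by force
  have pos: "0 < (\<Sum>k\<in>J. \<Sum>l\<in>J. x k * (A $ k $ l - A $ k $ i * A $ i $ l / A $ i $ i) * x l)"
    if x: "\<exists>k\<in>J. x k \<noteq> 0" for x
  proof -
    \<comment> \<open>The value at \<open>i\<close> that makes the completed square vanish, so the
      full form at \<open>?z\<close> is the Schur form at \<open>x\<close>.\<close>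
    let ?z = "x(i := - (\<Sum>j\<in>J. A $ i $ j * x j) / A $ i $ i)"
    have zx: "?z j = x j" if "j \<in> J" for j using that i by auto
    obtain j where j: "j \<in> J" "x j \<noteq> 0" using x by blast
    then have "0 < (\<Sum>k\<in>insert i J. \<Sum>l\<in>insert i J. ?z k * A $ k $ l * ?z l)"
      by (intro pd_on_pos[OF pd, of j]) (use zx[OF j(1)] in simp_all)
    also have "\<dots> = A $ i $ i * (?z i + (\<Sum>j\<in>J. A $ i $ j * ?z j) / A $ i $ i)\<^sup>2 +
        (\<Sum>k\<in>J. \<Sum>l\<in>J. ?z k * (A $ k $ l - A $ k $ i * A $ i $ l / A $ i $ i) * ?z l)"
      using sym by (intro quadratic_form_insert i Aii) auto
    also have "(\<Sum>j\<in>J. A $ i $ j * ?z j) = (\<Sum>j\<in>J. A $ i $ j * x j)"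
      using i by (intro sum.cong refl) auto
    also have "(\<Sum>k\<in>J. \<Sum>l\<in>J. ?z k * (A $ k $ l - A $ k $ i * A $ i $ l / A $ i $ i) * ?z l)
        = (\<Sum>k\<in>J. \<Sum>l\<in>J. x k * (A $ k $ l - A $ k $ i * A $ i $ l / A $ i $ i) * x l)"
      using i by (intro sum.cong refl) auto
    also have "?z i + (\<Sum>j\<in>J. A $ i $ j * x j) / A $ i $ i = 0" by simp
    finally have "0 < A $ i $ i * 0\<^sup>2 +
        (\<Sum>k\<in>J. \<Sum>l\<in>J. x k * (A $ k $ l - A $ k $ i * A $ i $ l / A $ i $ i) * x l)" .
    then show ?thesis by simp
  qed
  have symm: "A $ k $ l - A $ k $ i * A $ i $ l / A $ i $ i = A $ l $ k - A $ l $ i * A $ i $ k / A $ i $ i"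
    if "k \<in> J" "l \<in> J" for k l
  proof -
    have "A $ k $ l = A $ l $ k" "A $ k $ i = A $ i $ k" "A $ i $ l = A $ l $ i"
      using sym that by blast+
    then show ?thesis by (metis mult.commute)
  qed
  show ?thesis unfolding pd_on_def vec_lambda_beta
  proof (intro conjI ballI allI impI)
    fix k l assume "k \<in> J" "l \<in> J"
    then show "A $ k $ l - A $ k $ i * A $ i $ l / A $ i $ i = A $ l $ k - A $ l $ i * A $ i $ k / A $ i $ i"
      by (rule symm)
  next
    fix x :: "'n \<Rightarrow> real" assume "\<exists>k\<in>J. x k \<noteq> 0"
    then show "0 < (\<Sum>k\<in>J. \<Sum>l\<in>J. x k * (A $ k $ l - A $ k $ i * A $ i $ l / A $ i $ i) * x l)"
      by (rule pos)
  qed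
qed

text \<open>The determinant is the product of the pivots; each is a diagonal entry of a positive
  definite Schur complement.\<close>

lemma sub_det_pos: "finite I \<Longrightarrow> pd_on I (A :: 'n::finite sqmat) \<Longrightarrow> 0 < sub_det I A"
proof (induction I arbitrary: A rule: finite_induct)
  case empty
  then show ?case by (simp add: sub_det_def)
next
  case (insert i J)
  have pos: "0 < A $ i $ i" using insert.prems by (rule pd_on_diag_pos) simp
  show ?case
    unfolding sub_det_insert[OF insert.hyps(2) less_imp_neq[OF pos, symmetric]]
    by (rule mult_pos_pos[OF pos insert.IH[OF pd_on_schur[OF insert.prems insert.hyps(2)]]])
qed

lemma pd_on_det_nz: "pd_on I (A :: 'n::finite sqmat) \<Longrightarrow> sub_det I A \<noteq> 0"
  using sub_det_pos[OF finite, of I A] by (rule less_imp_neq[symmetric])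

text \<open>Together with \<open>pred_coef_system\<close> this makes \<open>pred_coef\<close> the
  unique solution of the normal equations, so a regression vector is recognised by the system it
  solves.\<close>

lemma pred_coef_eqI:
  assumes "pd_on (preds E i) A" "k \<in> preds E i"
    and sys: "\<And>k. k \<in> preds E i \<Longrightarrow> (\<Sum>l\<in>preds E i. A $ k $ l * y l) = A $ k $ i"
  shows "pred_coef E A i k = y k"
proof -
  let ?I = "preds E i" and ?B = "sub_inv (preds E i) A"
  have inv: "(\<Sum>p\<in>?I. ?B $ k $ p * A $ p $ l) = (if k = l then 1 else 0)" if "l \<in> ?I" for l
    by (rule sub_inv_mult'[OF pd_on_det_nz[OF assms(1)], unfolded padded_mult_eq_mat_1,
          rule_format, OF assms(2) that])
  have "pred_coef E A i k = (\<Sum>l\<in>?I. ?B $ k $ l * (\<Sum>p\<in>?I. A $ l $ p * y p))"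
  proof -
    have "pred_coef E A i k = (\<Sum>l\<in>?I. ?B $ k $ l * A $ l $ i)"
      using assms(2) by (simp add: pred_coef_def)
    also have "\<dots> = (\<Sum>l\<in>?I. ?B $ k $ l * (\<Sum>p\<in>?I. A $ l $ p * y p))"
      by (intro sum.cong refl) (simp only: sys)
    finally show ?thesis .
  qed
  also have "\<dots> = (\<Sum>l\<in>?I. \<Sum>p\<in>?I. ?B $ k $ l * A $ l $ p * y p)"
    by (simp add: sum_distrib_left mult_ac)
  also have "\<dots> = (\<Sum>p\<in>?I. (\<Sum>l\<in>?I. ?B $ k $ l * A $ l $ p) * y p)"
    by (subst sum.swap) (simp add: sum_distrib_right)
  also have "\<dots> = (\<Sum>p\<in>?I. if k = p then y p else 0)"
    by (intro sum.cong refl) (simp add: inv)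
  also have "\<dots> = y k" using assms(2) by (simp add: sum.delta')
  finally show ?thesis .
qed

lemma pred_coef_system:
  assumes "pd_on (preds E i) A" "k \<in> preds E i"
  shows "(\<Sum>l\<in>preds E i. A $ k $ l * pred_coef E A i l) = A $ k $ i"
proof -
  let ?I = "preds E i" and ?B = "sub_inv (preds E i) A"
  have inv: "(\<Sum>p\<in>?I. A $ k $ p * ?B $ p $ l) = (if k = l then 1 else 0)" if "l \<in> ?I" for l
    by (rule sub_inv_mult[OF pd_on_det_nz[OF assms(1)], unfolded padded_mult_eq_mat_1,
          rule_format, OF assms(2) that])
  have "(\<Sum>l\<in>?I. A $ k $ l * pred_coef E A i l) = (\<Sum>l\<in>?I. \<Sum>p\<in>?I. A $ k $ l * ?B $ l $ p * A $ p $ i)"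
    by (simp add: pred_coef_def sum_distrib_left mult_ac)
  also have "\<dots> = (\<Sum>p\<in>?I. (\<Sum>l\<in>?I. A $ k $ l * ?B $ l $ p) * A $ p $ i)"
    by (subst sum.swap) (simp add: sum_distrib_right)
  also have "\<dots> = (\<Sum>p\<in>?I. if k = p then A $ p $ i else 0)"
    by (intro sum.cong refl) (simp add: inv)
  also have "\<dots> = A $ k $ i" using assms(2) by (simp add: sum.delta')
  finally show ?thesis .
qed

lemma pred_quad_eq: "pred_quad E A i = (\<Sum>k\<in>preds E i. pred_coef E A i k * A $ k $ i)"
  by (simp add: pred_quad_def pred_coef_def sum_distrib_left mult_ac)

text \<open>The left side is the form of \<open>A\<close> at the vector with entry 1 at
  \<open>i\<close> and \<open>- x\<close> on the predecessors. Since \<open>\<mu>\<close> solves the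
  normal equations, the cross terms of the square centred at \<open>\<mu>\<close> reproduce the
  linear terms, and the constant left over is the residual variance.\<close>

lemma residual_form:
  fixes E :: "('n::{finite,linorder} \<times> 'n) set" and A :: "'n sqmat" and i :: 'n
  assumes pd: "positive_definite A"
  defines "\<mu> \<equiv> pred_coef E A i"
  shows "A $ i $ i - 2 * (\<Sum>k\<in>preds E i. x k * A $ k $ i)
      + (\<Sum>k\<in>preds E i. \<Sum>l\<in>preds E i. x k * A $ k $ l * x l)
    = (\<Sum>k\<in>preds E i. \<Sum>l\<in>preds E i. (x k - \<mu> k) * A $ k $ l * (x l - \<mu> l))
      + (A $ i $ i - pred_quad E A i)"
proof -
  let ?I = "preds E i"
  have pdI: "pd_on ?I A" using pd by (rule positive_definite_imp_pd_on)
  have sym: "A $ k $ l = A $ l $ k" for k l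
    using pd by (rule positive_definite_sym)
  have sys: "(\<Sum>l\<in>?I. A $ k $ l * \<mu> l) = A $ k $ i" if "k \<in> ?I" for k
    unfolding \<mu>_def using pred_coef_system[OF pdI that] .
  have lin: "(\<Sum>k\<in>?I. \<Sum>l\<in>?I. y k * A $ k $ l * \<mu> l) = (\<Sum>k\<in>?I. y k * A $ k $ i)" for y
    by (intro sum.cong refl) (simp add: sys[symmetric] sum_distrib_left mult_ac)
  have "(\<Sum>k\<in>?I. \<Sum>l\<in>?I. \<mu> k * A $ k $ l * x l) = (\<Sum>l\<in>?I. \<Sum>k\<in>?I. \<mu> k * A $ k $ l * x l)"
    by (rule sum.swap)
  also have "\<dots> = (\<Sum>k\<in>?I. \<Sum>l\<in>?I. x k * A $ k $ l * \<mu> l)"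
    by (intro sum.cong refl) (simp add: sym mult_ac)
  finally have lin': "(\<Sum>k\<in>?I. \<Sum>l\<in>?I. \<mu> k * A $ k $ l * x l) = (\<Sum>k\<in>?I. x k * A $ k $ i)"
    by (simp add: lin)
  have "(\<Sum>k\<in>?I. \<Sum>l\<in>?I. (x k - \<mu> k) * A $ k $ l * (x l - \<mu> l))
      = (\<Sum>k\<in>?I. \<Sum>l\<in>?I. x k * A $ k $ l * x l) - (\<Sum>k\<in>?I. \<Sum>l\<in>?I. x k * A $ k $ l * \<mu> l)
        - (\<Sum>k\<in>?I. \<Sum>l\<in>?I. \<mu> k * A $ k $ l * x l) + (\<Sum>k\<in>?I. \<Sum>l\<in>?I. \<mu> k * A $ k $ l * \<mu> l)"
    by (simp add: algebra_simps sum.distrib sum_subtractf)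
  then show ?thesis
    by (simp add: lin lin' pred_quad_eq \<mu>_def[symmetric])
qed

lemma (in hasse_graph) residual_pos:
  assumes pd: "positive_definite A"
  shows "0 < A $ i $ i - pred_quad E A i"
proof -
  let ?I = "preds E i"
  have sym: "A $ k $ l = A $ l $ k" for k l
    using pd by (rule positive_definite_sym)
  define s where "s = (\<Sum>k\<in>?I. pred_coef E A i k * A $ k $ i)"
  \<comment> \<open>At this vector \<open>x\<close> equals the centre in
    \<open>residual_form\<close>, so the square drops out and the form takes the residual as its
    value.\<close>
  define z where "z = (\<lambda>k. if k = i then 1 else - pred_coef E A i k)"
  have zi: "z i = 1" by (simp add: z_def)
  have z: "z k = - pred_coef E A i k" if "k \<in> ?I" for k
    using that by (auto simp: z_def)
  have "0 < (\<Sum>k\<in>insert i ?I. \<Sum>l\<in>insert i ?I. z k * A $ k $ l * z l)"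
    by (rule pd_on_pos[OF positive_definite_imp_pd_on[OF pd], of i]) (simp_all add: zi)
  also have "\<dots> = z i * A $ i $ i * z i + (\<Sum>l\<in>?I. z i * A $ i $ l * z l) +
      ((\<Sum>k\<in>?I. z k * A $ k $ i * z i) + (\<Sum>k\<in>?I. \<Sum>l\<in>?I. z k * A $ k $ l * z l))"
    by (simp only: sum.insert[OF finite not_self_preds] sum.distrib)
  also have "(\<Sum>l\<in>?I. z i * A $ i $ l * z l) = - s"
    unfolding s_def sum_negf[symmetric]
  proof (rule sum.cong)
    fix l assume "l \<in> ?I"
    then show "z i * A $ i $ l * z l = - (pred_coef E A i l * A $ l $ i)"
      using sym[of i l] by (simp add: z zi)
  qed simp
  also have "(\<Sum>k\<in>?I. z k * A $ k $ i * z i) = - s"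
    unfolding s_def sum_negf[symmetric] by (intro sum.cong refl) (simp add: z zi)
  also have "(\<Sum>k\<in>?I. \<Sum>l\<in>?I. z k * A $ k $ l * z l)
      = (\<Sum>k\<in>?I. \<Sum>l\<in>?I. pred_coef E A i k * A $ k $ l * pred_coef E A i l)"
    by (intro sum.cong refl) (simp add: z)
  also have "z i * A $ i $ i * z i + - s +
      (- s + (\<Sum>k\<in>?I. \<Sum>l\<in>?I. pred_coef E A i k * A $ k $ l * pred_coef E A i l))
    = A $ i $ i - 2 * s
      + (\<Sum>k\<in>?I. \<Sum>l\<in>?I. pred_coef E A i k * A $ k $ l * pred_coef E A i l)"
    by (simp add: zi)
  also have "\<dots> = A $ i $ i - pred_quad E A i"
    unfolding s_def by (subst residual_form[OF pd]) simp
  finally show ?thesis .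
qed

lemma borel_measurable_entry [measurable]:
  "(\<lambda>A :: 'n::finite sqmat. A $ i $ j) \<in> borel_measurable borel"
  by (intro borel_measurable_continuous_onI continuous_intros)

lemma borel_measurable_det:
  assumes "\<And>i j. (\<lambda>\<omega>. A \<omega> $ i $ j) \<in> borel_measurable M"
  shows "(\<lambda>\<omega>. det (A \<omega> :: 'n::finite sqmat)) \<in> borel_measurable M"
  unfolding det_def using assms by (intro borel_measurable_sum borel_measurable_times borel_measurable_prod) auto

text \<open>Serves measurability: \<open>sub_inv\<close> is given by a choice, whereas Cramer's rule
  presents the coefficients as quotients of determinants, which are polynomials in the entries of
  \<open>A\<close>.\<close>

lemma pred_coef_cramer:
  assumes "pd_on (preds E i) A" "k \<in> preds E i"
  shows "pred_coef E A i k =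
    det (\<chi> p q. if q = k then (if p \<in> preds E i then A $ p $ i else 0) else padded (preds E i) A $ p $ q)
      / det (padded (preds E i) A)"
proof -
  let ?I = "preds E i"
  let ?y = "\<chi> k. if k \<in> ?I then pred_coef E A i k else 0"
  let ?b = "\<chi> p. if p \<in> ?I then A $ p $ i else 0"
  have "padded ?I A *v ?y = ?b"
  proof -
    have "(\<Sum>q\<in>UNIV. padded ?I A $ p $ q * ?y $ q) = ?b $ p" for p
    proof -
      have "(\<Sum>q\<in>UNIV. padded ?I A $ p $ q * ?y $ q) = (\<Sum>q\<in>?I. padded ?I A $ p $ q * ?y $ q)"
        by (intro sum.mono_neutral_right) auto
      also have "\<dots> = (if p \<in> ?I then \<Sum>q\<in>?I. A $ p $ q * pred_coef E A i q else 0)"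
        by (auto simp: padded_def intro!: sum.neutral)
      finally show ?thesis using pred_coef_system[OF assms(1)] by simp
    qed
    then show ?thesis by (simp add: vec_eq_iff matrix_vector_mult_def)
  qed
  moreover have "det (padded ?I A) \<noteq> 0" using pd_on_det_nz[OF assms(1)] by (simp add: sub_det_eq)
  ultimately have "?y = (\<chi> k. det (\<chi> p q. if q = k then ?b $ p else padded ?I A $ p $ q) / det (padded ?I A))"
    using cramer by blast
  then have "?y $ k = det (\<chi> p q. if q = k then ?b $ p else padded ?I A $ p $ q) / det (padded ?I A)"
    by (metis (no_types, lifting) vec_lambda_beta)
  then show ?thesis using assms(2) by (simp cong: if_cong)
qed

lemma measurable_P_algebra_entry [measurable]:
  "(\<lambda>A. A $ i $ j) \<in> borel_measurable (P_algebra E)"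
  unfolding P_algebra_def by (rule measurable_restrict_space1) measurable

lemma measurable_pred_coef:
  "(\<lambda>A. pred_coef E A i) \<in> P_algebra E \<rightarrow>\<^sub>M (\<Pi>\<^sub>M k\<in>preds E i. borel)"
proof -
  have "(\<lambda>A. pred_coef E A i k) \<in> borel_measurable (P_algebra E)" if k: "k \<in> preds E i" for k
  proof -
    have "(\<lambda>A. det (\<chi> p q. if q = k then (if p \<in> preds E i then A $ p $ i else 0)
        else padded (preds E i) A $ p $ q) / det (padded (preds E i) A)) \<in> borel_measurable (P_algebra E)"
    proof (intro borel_measurable_divide borel_measurable_det)
      fix p q
      show p: "(\<lambda>A. padded (preds E i) A $ p $ q) \<in> borel_measurable (P_algebra E)"
        by (cases "p \<in> preds E i \<and> q \<in> preds E i") (auto simp: padded_def)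
      show "(\<lambda>A. (\<chi> p q. if q = k then (if p \<in> preds E i then A $ p $ i else 0)
          else padded (preds E i) A $ p $ q) $ p $ q) \<in> borel_measurable (P_algebra E)"
        using p by (cases "q = k"; cases "p \<in> preds E i") auto
    qed
    then show ?thesis
    proof (rule measurable_cong[THEN iffD1, rotated])
      \<comment> \<open>The quotient has to agree with the coefficient only on the space of
        \<open>P_algebra E\<close>, where every matrix is positive definite.\<close>
      fix A assume "A \<in> space (P_algebra E)"
      then have "pd_on (preds E i) A"
        by (intro positive_definite_imp_pd_on) (simp add: P_algebra_def space_restrict_space P_space_def)
      then show "det (\<chi> p q. if q = k then (if p \<in> preds E i then A $ p $ i else 0)
        else padded (preds E i) A $ p $ q) / det (padded (preds E i) A) = pred_coef E A i k"
        using pred_coef_cramer[OF _ k] by simp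
    qed
  qed
  then have "(\<lambda>A. \<lambda>k\<in>preds E i. pred_coef E A i k) \<in> P_algebra E \<rightarrow>\<^sub>M (\<Pi>\<^sub>M k\<in>preds E i. borel)"
    by (rule measurable_restrict)
  moreover have "(\<lambda>k\<in>preds E i. pred_coef E A i k) = pred_coef E A i" for A
    by (auto simp: pred_coef_def)
  ultimately show ?thesis by simp
qed

subsection \<open>Shears and Gaussian integrals\<close>

lemma product_sigma_finite_lborel: "product_sigma_finite (\<lambda>_. lborel :: 'a::euclidean_space measure)"
  by unfold_locales

text \<open>Integrating out a coordinate of maximal rank first, translation invariance removes its shift,
  and no other coordinate depends on it.\<close>

lemma nn_integral_PiM_lborel_shear:
  fixes G :: "'i \<Rightarrow> ('i \<Rightarrow> real) \<Rightarrow> real" and r :: "'i \<Rightarrow> nat"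
  assumes "finite A"
    and "\<And>e. e \<in> A \<Longrightarrow> G e \<in> borel_measurable (\<Pi>\<^sub>M e\<in>A. lborel)"
    and "\<And>e l l'. e \<in> A \<Longrightarrow> (\<And>e'. e' \<in> A \<Longrightarrow> r e' < r e \<Longrightarrow> l e' = l' e') \<Longrightarrow> G e l = G e l'"
    and "h \<in> borel_measurable (\<Pi>\<^sub>M e\<in>A. lborel)"
  shows "(\<integral>\<^sup>+ l. h (\<lambda>e\<in>A. l e + G e l) \<partial>(\<Pi>\<^sub>M e\<in>A. lborel)) = (\<integral>\<^sup>+ l. h l \<partial>(\<Pi>\<^sub>M e\<in>A. lborel))"
  using assms
proof (induction "card A" arbitrary: A h)
  case 0
  have "A = {}" using 0(1,2) by simp
  then show ?case
    by (intro nn_integral_cong) (auto simp: space_PiM restrict_def)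
next
  case (Suc n)
  interpret product_sigma_finite "\<lambda>_::'i. lborel :: real measure" by (rule product_sigma_finite_lborel)
  have "A \<noteq> {}" using Suc.hyps(2) by auto
  then obtain e where e: "e \<in> A" "\<And>e'. e' \<in> A \<Longrightarrow> r e' \<le> r e"
    using finite_has_maximal[of "r ` A"] Suc.prems(1)
    by (metis (no_types, lifting) Max_ge Max_in finite_imageI image_iff image_is_empty)
  define B where "B = A - {e}"
  have A: "A = insert e B" "e \<notin> B" "finite B" using e(1) Suc.prems(1) by (auto simp: B_def)
  \<comment> \<open>As the rank of \<open>e\<close> is maximal, no shift depends on coordinate
    \<open>e\<close>, not even the shift of \<open>e\<close> itself.\<close>
  have GB: "G e' (l(e := t)) = G e' l" if "e' \<in> A" for e' l t
    using e(2)[OF that] by (intro Suc.prems(3)[OF that]) auto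
  note [measurable] = Suc.prems(2)[unfolded A(1)] Suc.prems(4)[unfolded A(1)]
  \<comment> \<open>The value 0 is arbitrary: by \<open>GB\<close> the shifts ignore coordinate
    \<open>e\<close>, and the update merely turns them into measurable functions of the coordinates
    in \<open>B\<close>.\<close>
  have upd0: "(\<lambda>l. l(e := 0)) \<in> (\<Pi>\<^sub>M e\<in>B. lborel) \<rightarrow>\<^sub>M (\<Pi>\<^sub>M e\<in>insert e B. lborel :: real measure)"
    by measurable
  have GBm: "G e' \<in> borel_measurable (\<Pi>\<^sub>M e\<in>B. lborel)" if "e' \<in> A" for e'
    using measurable_compose[OF upd0 Suc.prems(2)[OF that, unfolded A(1)]] GB[OF that] by simp
  note [measurable] = GBm[unfolded A(1)]
  let ?F = "\<lambda>l. \<lambda>e\<in>B. l e + G e l"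
  have F[measurable]: "?F \<in> (\<Pi>\<^sub>M e\<in>B. lborel) \<rightarrow>\<^sub>M (\<Pi>\<^sub>M e\<in>B. lborel :: real measure)"
    by (intro measurable_restrict) (auto intro!: borel_measurable_add GBm simp: A(1))
  have split: "(\<lambda>e'\<in>A. (l(e := t)) e' + G e' (l(e := t))) = (?F l)(e := t + G e l)"
    if "l \<in> space (\<Pi>\<^sub>M e\<in>B. lborel)" for l t
    using A(2) GB by (auto simp: A(1) fun_eq_iff)
  have hm: "(\<lambda>t. h (l(e := t))) \<in> borel_measurable borel" if "l \<in> space (\<Pi>\<^sub>M e\<in>B. lborel)" for l
    using measurable_compose[OF measurable_component_update[OF that A(2)] Suc.prems(4)[unfolded A(1)]] by simp
  have hA: "(\<lambda>l. h (\<lambda>e\<in>A. l e + G e l)) \<in> borel_measurable (\<Pi>\<^sub>M e\<in>A. lborel)"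
    using Suc.prems(2) by (intro measurable_compose[OF measurable_restrict Suc.prems(4)]) auto
  have "(\<integral>\<^sup>+ l. h (\<lambda>e\<in>A. l e + G e l) \<partial>(\<Pi>\<^sub>M e\<in>A. lborel))
      = (\<integral>\<^sup>+ l. (\<integral>\<^sup>+ t. h (\<lambda>e'\<in>A. (l(e := t)) e' + G e' (l(e := t))) \<partial>lborel) \<partial>(\<Pi>\<^sub>M e\<in>B. lborel))"
    using hA A(2,3) unfolding A(1) by (intro product_nn_integral_insert) auto
  also have "\<dots> = (\<integral>\<^sup>+ l. (\<integral>\<^sup>+ t. h ((?F l)(e := t + G e l)) \<partial>lborel) \<partial>(\<Pi>\<^sub>M e\<in>B. lborel))"
    by (intro nn_integral_cong) (simp only: split)
  also have "\<dots> = (\<integral>\<^sup>+ l. (\<integral>\<^sup>+ t. h ((?F l)(e := t)) \<partial>lborel) \<partial>(\<Pi>\<^sub>M e\<in>B. lborel))"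
  proof (rule nn_integral_cong)
    fix l assume "l \<in> space (\<Pi>\<^sub>M e\<in>B. lborel :: real measure)"
    then have "?F l \<in> space (\<Pi>\<^sub>M e\<in>B. lborel)" using measurable_space[OF F] by auto
    from nn_integral_real_affine[OF hm[OF this], of 1 "G e l"]
    show "(\<integral>\<^sup>+ t. h ((?F l)(e := t + G e l)) \<partial>lborel) = (\<integral>\<^sup>+ t. h ((?F l)(e := t)) \<partial>lborel)"
      by (simp add: add.commute)
  qed
  also have "\<dots> = (\<integral>\<^sup>+ l. (\<integral>\<^sup>+ t. h (l(e := t)) \<partial>lborel) \<partial>(\<Pi>\<^sub>M e\<in>B. lborel))"
  proof (rule Suc.hyps(1)[of B "\<lambda>l. \<integral>\<^sup>+ t. h (l(e := t)) \<partial>lborel"])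
    show "n = card B" using Suc.hyps(2) A by simp
    show "(\<lambda>l. \<integral>\<^sup>+ t. h (l(e := t)) \<partial>lborel) \<in> borel_measurable (\<Pi>\<^sub>M e\<in>B. lborel)"
      by measurable
  next
    fix e' and l l' :: "'i \<Rightarrow> real" assume e': "e' \<in> B" and "\<And>e''. e'' \<in> B \<Longrightarrow> r e'' < r e' \<Longrightarrow> l e'' = l' e''"
    then show "G e' l = G e' l'"
      using e(2)[of e'] by (intro Suc.prems(3)) (auto simp: A(1))
  qed (use A GBm in auto)
  also have "\<dots> = (\<integral>\<^sup>+ l. h l \<partial>(\<Pi>\<^sub>M e\<in>A. lborel))"
    using Suc.prems(4) A(2,3) unfolding A(1) by (intro product_nn_integral_insert[symmetric]) auto
  finally show ?case .
qed

lemma nn_integral_gaussian: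
  assumes "0 < (a::real)"
  shows "(\<integral>\<^sup>+ t. ennreal (exp (- (1/2) * (a * (t - m)\<^sup>2))) \<partial>lborel) = ennreal (sqrt (2 * pi / a))"
proof -
  let ?s = "1 / sqrt a"
  interpret prob_space "density lborel (normal_density m ?s)"
    using assms by (intro prob_space_normal_density) simp
  have "(\<integral>\<^sup>+ t. ennreal (exp (- (1/2) * (a * (t - m)\<^sup>2))) \<partial>lborel)
      = (\<integral>\<^sup>+ t. ennreal (sqrt (2 * pi / a)) * ennreal (normal_density m ?s t) \<partial>lborel)"
    using assms by (intro nn_integral_cong)
      (simp add: ennreal_mult[symmetric] normal_density_def power_divide field_simps real_sqrt_divide)
  also have "\<dots> = ennreal (sqrt (2 * pi / a)) * (\<integral>\<^sup>+ t. ennreal (normal_density m ?s t) \<partial>lborel)"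
    by (intro nn_integral_cmult) simp
  also have "(\<integral>\<^sup>+ t. ennreal (normal_density m ?s t) \<partial>lborel) = 1"
    using emeasure_space_1 by (simp add: emeasure_density)
  finally show ?thesis by simp
qed

lemma borel_measurable_PiM_quadratic_form:
  "(\<lambda>x. ennreal (exp (- (1/2) * (\<Sum>k\<in>I. \<Sum>l\<in>I. (x k - \<mu> k) * A $ k $ l * (x l - \<mu> l)))))
     \<in> borel_measurable (\<Pi>\<^sub>M k\<in>I. lborel)"
proof -
  have [measurable]: "(\<lambda>x. x k :: real) \<in> borel_measurable (\<Pi>\<^sub>M k\<in>I. lborel)" if "k \<in> I" for k
    using measurable_component_singleton[OF that, of "\<lambda>_. lborel :: real measure"] by simp
  have "(\<lambda>x. \<Sum>k\<in>I. \<Sum>l\<in>I. (x k - \<mu> k) * A $ k $ l * (x l - \<mu> l)) \<in> borel_measurable (\<Pi>\<^sub>M k\<in>I. lborel)"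
    by (intro borel_measurable_sum) measurable
  then show ?thesis by measurable
qed

text \<open>Integrating out coordinate \<open>i\<close> gives \<open>sqrt (2 * pi / a)\<close> for
  the pivot \<open>a\<close> and leaves the Gaussian of the Schur complement;
  \<open>sub_det_insert\<close> collects the pivots into the determinant.\<close>

lemma nn_integral_gaussian_PiM:
  fixes A :: "'n::finite sqmat"
  assumes "finite I" "pd_on I A"
  shows "(\<integral>\<^sup>+ x. ennreal (exp (- (1/2) * (\<Sum>k\<in>I. \<Sum>l\<in>I. (x k - \<mu> k) * A $ k $ l * (x l - \<mu> l))))
       \<partial>(\<Pi>\<^sub>M k\<in>I. lborel)) = ennreal (sqrt ((2 * pi) ^ card I / sub_det I A))"
  using assms
proof (induction I arbitrary: A rule: finite_induct)
  case empty
  then show ?case by (simp add: sub_det_def PiM_empty)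
next
  case (insert i J)
  interpret product_sigma_finite "\<lambda>_::'n. lborel :: real measure" by (rule product_sigma_finite_lborel)
  let ?a = "A $ i $ i"
  let ?S = "\<chi> k l. A $ k $ l - A $ k $ i * A $ i $ l / A $ i $ i"
  have a: "0 < ?a" using insert.prems by (rule pd_on_diag_pos) simp
  have schur: "pd_on J ?S" using insert.prems insert.hyps(2) by (rule pd_on_schur)
  let ?q = "\<lambda>I A (x::'n\<Rightarrow>real). \<Sum>k\<in>I. \<Sum>l\<in>I. (x k - \<mu> k) * A $ k $ l * (x l - \<mu> l)"
  \<comment> \<open>The conditional mean of coordinate \<open>i\<close> given the others, when
    \<open>A\<close> is the precision matrix.\<close>
  let ?m = "\<lambda>x. \<mu> i - (\<Sum>j\<in>J. A $ i $ j * (x j - \<mu> j)) / ?a"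
  have q: "?q (insert i J) A (x(i := t)) = ?a * (t - ?m x)\<^sup>2 + ?q J ?S x" for x t
  proof -
    define z where "z k = (x(i := t)) k - \<mu> k" for k
    have zi: "z i = t - \<mu> i" by (simp add: z_def)
    have zj: "z j = x j - \<mu> j" if "j \<in> J" for j using that insert.hyps(2) by (auto simp: z_def)
    have "?q (insert i J) A (x(i := t)) = (\<Sum>k\<in>insert i J. \<Sum>l\<in>insert i J. z k * A $ k $ l * z l)"
      by (simp only: z_def)
    also have "\<dots> = ?a * (z i + (\<Sum>j\<in>J. A $ i $ j * z j) / ?a)\<^sup>2 +
        (\<Sum>k\<in>J. \<Sum>l\<in>J. z k * (A $ k $ l - A $ k $ i * A $ i $ l / A $ i $ i) * z l)"
      using a by (intro quadratic_form_insert insert.hyps pd_on_sym[OF insert.prems]) auto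
    also have "(\<Sum>j\<in>J. A $ i $ j * z j) = (\<Sum>j\<in>J. A $ i $ j * (x j - \<mu> j))"
      by (intro sum.cong refl) (simp add: zj)
    also have "(\<Sum>k\<in>J. \<Sum>l\<in>J. z k * (A $ k $ l - A $ k $ i * A $ i $ l / A $ i $ i) * z l) = ?q J ?S x"
      by (intro sum.cong refl) (simp add: zj)
    finally show ?thesis by (simp add: zi algebra_simps)
  qed
  have "(\<integral>\<^sup>+ x. ennreal (exp (- (1/2) * ?q (insert i J) A x)) \<partial>(\<Pi>\<^sub>M k\<in>insert i J. lborel))
     = (\<integral>\<^sup>+ x. (\<integral>\<^sup>+ t. ennreal (exp (- (1/2) * ?q (insert i J) A (x(i := t)))) \<partial>lborel) \<partial>(\<Pi>\<^sub>M k\<in>J. lborel))"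
    by (rule product_nn_integral_insert[OF insert.hyps borel_measurable_PiM_quadratic_form])
  also have "\<dots> = (\<integral>\<^sup>+ x. (\<integral>\<^sup>+ t. ennreal (exp (- (1/2) * ?q J ?S x)) *
      ennreal (exp (- (1/2) * (?a * (t - ?m x)\<^sup>2))) \<partial>lborel) \<partial>(\<Pi>\<^sub>M k\<in>J. lborel))"
    unfolding q by (simp add: ennreal_mult[symmetric] exp_add[symmetric] distrib_left add.commute)
  also have "\<dots> = (\<integral>\<^sup>+ x. ennreal (exp (- (1/2) * ?q J ?S x)) * ennreal (sqrt (2 * pi / ?a)) \<partial>(\<Pi>\<^sub>M k\<in>J. lborel))"
  proof (rule nn_integral_cong)
    fix x
    have "(\<integral>\<^sup>+ t. ennreal (exp (- (1/2) * ?q J ?S x)) * ennreal (exp (- (1/2) * (?a * (t - ?m x)\<^sup>2))) \<partial>lborel)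
        = ennreal (exp (- (1/2) * ?q J ?S x)) * (\<integral>\<^sup>+ t. ennreal (exp (- (1/2) * (?a * (t - ?m x)\<^sup>2))) \<partial>lborel)"
      by (rule nn_integral_cmult) simp
    then show "(\<integral>\<^sup>+ t. ennreal (exp (- (1/2) * ?q J ?S x)) * ennreal (exp (- (1/2) * (?a * (t - ?m x)\<^sup>2))) \<partial>lborel)
        = ennreal (exp (- (1/2) * ?q J ?S x)) * ennreal (sqrt (2 * pi / ?a))"
      by (simp only: nn_integral_gaussian[OF a])
  qed
  also have "\<dots> = (\<integral>\<^sup>+ x. ennreal (exp (- (1/2) * ?q J ?S x)) \<partial>(\<Pi>\<^sub>M k\<in>J. lborel)) * ennreal (sqrt (2 * pi / ?a))"
    by (intro nn_integral_multc borel_measurable_PiM_quadratic_form)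
  also have "\<dots> = ennreal (sqrt ((2 * pi) ^ card J / sub_det J ?S)) * ennreal (sqrt (2 * pi / ?a))"
    by (simp only: insert.IH[OF schur])
  also have "\<dots> = ennreal (sqrt ((2 * pi) ^ card J / sub_det J ?S) * sqrt (2 * pi / ?a))"
    by (rule ennreal_mult[symmetric]) (use a sub_det_pos[OF insert.hyps(1) schur] in simp_all)
  also have "sqrt ((2 * pi) ^ card J / sub_det J ?S) * sqrt (2 * pi / ?a)
      = sqrt ((2 * pi) ^ card (insert i J) / (?a * sub_det J ?S))"
    using insert.hyps by (simp add: real_sqrt_mult[symmetric] mult_ac)
  also have "?a * sub_det J ?S = sub_det (insert i J) A"
    using a by (intro sub_det_insert[symmetric] insert.hyps) auto
  finally show ?case .
qed

text \<open>The covariance has precision \<open>U / d\<close> and determinant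
  \<open>d ^ card I / sub_det I U\<close>, so the density can be written with \<open>U\<close>
  itself. The power of \<open>d\<close> in the constant is what later enters the inverse gamma
  shape.\<close>

lemma mv_normal_eq:
  fixes U :: "'n::finite sqmat"
  assumes U: "pd_on I U" and d: "0 < d"
  shows "mv_normal I \<mu> (d *\<^sub>R sub_inv I U) = density (\<Pi>\<^sub>M k\<in>I. lborel) (\<lambda>x. ennreal
     (exp (- (1/2) * (\<Sum>k\<in>I. \<Sum>l\<in>I. (x k - \<mu> k) * U $ k $ l * (x l - \<mu> l)) / d)
        * sqrt (sub_det I U / (2 * pi * d) ^ card I)))"
proof -
  have det: "sub_det I U > 0" using U by (intro sub_det_pos) auto
  have "sqrt ((2 * pi) ^ card I * sub_det I (d *\<^sub>R sub_inv I U)) = 1 / sqrt (sub_det I U / (2 * pi * d) ^ card I)"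
    using det by (simp add: sub_det_scaleR sub_det_sub_inv real_sqrt_divide power_mult_distrib)
  moreover have "(\<Sum>k\<in>I. \<Sum>l\<in>I. (x k - \<mu> k) * sub_inv I (d *\<^sub>R sub_inv I U) $ k $ l * (x l - \<mu> l))
      = (\<Sum>k\<in>I. \<Sum>l\<in>I. (x k - \<mu> k) * U $ k $ l * (x l - \<mu> l)) / d" for x
    unfolding sum_divide_distrib using det d
    by (intro sum.cong refl) (simp add: sub_inv_scaleR_sub_inv)
  ultimately show ?thesis unfolding mv_normal_def by simp
qed

lemma nn_integral_gaussian_PiM_scaled:
  fixes U :: "'n::finite sqmat"
  assumes U: "pd_on I U" and d: "0 < d"
  shows "(\<integral>\<^sup>+ x. ennreal (exp (- (1/2) * (\<Sum>k\<in>I. \<Sum>l\<in>I. (x k - \<mu> k) * U $ k $ l * (x l - \<mu> l)) / d))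
       \<partial>(\<Pi>\<^sub>M k\<in>I. lborel)) = ennreal (sqrt ((2 * pi * d) ^ card I / sub_det I U))"
proof -
  have pd: "pd_on I ((1 / d) *\<^sub>R U)"
    unfolding pd_on_def
  proof (intro conjI ballI allI impI)
    fix x :: "'n \<Rightarrow> real" assume "\<exists>k\<in>I. x k \<noteq> 0"
    then obtain k where "k \<in> I" "x k \<noteq> 0" by blast
    then have "0 < (\<Sum>k\<in>I. \<Sum>l\<in>I. x k * U $ k $ l * x l) / d"
      using d by (intro divide_pos_pos pd_on_pos[OF U])
    also have "\<dots> = (\<Sum>k\<in>I. \<Sum>l\<in>I. x k * ((1 / d) *\<^sub>R U) $ k $ l * x l)"
      unfolding sum_divide_distrib by (intro sum.cong refl) simp
    finally show "0 < (\<Sum>k\<in>I. \<Sum>l\<in>I. x k * ((1 / d) *\<^sub>R U) $ k $ l * x l)" .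
  qed (simp add: pd_on_sym[OF U])
  have eq: "(\<Sum>k\<in>I. \<Sum>l\<in>I. (x k - \<mu> k) * ((1 / d) *\<^sub>R U) $ k $ l * (x l - \<mu> l))
      = (\<Sum>k\<in>I. \<Sum>l\<in>I. (x k - \<mu> k) * U $ k $ l * (x l - \<mu> l)) / d" for x
    unfolding sum_divide_distrib by (intro sum.cong refl) simp
  show ?thesis
    using nn_integral_gaussian_PiM[OF _ pd, of \<mu>] d
    unfolding eq by (simp add: sub_det_scaleR power_one_over power_mult_distrib field_simps)
qed

lemma prob_space_mv_normal:
  fixes U :: "'n::finite sqmat"
  assumes U: "pd_on I U" and d: "0 < d"
  shows "prob_space (mv_normal I \<mu> (d *\<^sub>R sub_inv I U))"
proof
  have det: "sub_det I U > 0" using U by (intro sub_det_pos) auto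
  let ?q = "\<lambda>x. - (1/2) * (\<Sum>k\<in>I. \<Sum>l\<in>I. (x k - \<mu> k) * U $ k $ l * (x l - \<mu> l)) / d"
  let ?c = "sub_det I U / (2 * pi * d) ^ card I"
  have [measurable]: "(\<lambda>x. ennreal (exp (?q x))) \<in> borel_measurable (\<Pi>\<^sub>M k\<in>I. lborel)"
    using borel_measurable_PiM_quadratic_form[where I = I and \<mu> = \<mu> and A = "(1/d) *\<^sub>R U"]
    by (simp add: sum_divide_distrib mult_ac)
  have "emeasure (mv_normal I \<mu> (d *\<^sub>R sub_inv I U)) (space (mv_normal I \<mu> (d *\<^sub>R sub_inv I U)))
     = (\<integral>\<^sup>+ x. ennreal (exp (?q x)) * ennreal (sqrt ?c) \<partial>(\<Pi>\<^sub>M k\<in>I. lborel))"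
    unfolding mv_normal_eq[OF U d] using d det
    by (subst emeasure_density)
       (auto simp: ennreal_mult intro!: nn_integral_cong)
  also have "\<dots> = ennreal (sqrt ((2 * pi * d) ^ card I / sub_det I U)) * ennreal (sqrt ?c)"
    by (subst nn_integral_multc) (measurable, simp only: nn_integral_gaussian_PiM_scaled[OF U d])
  also have "\<dots> = 1"
    using d det by (simp add: ennreal_mult[symmetric] real_sqrt_mult[symmetric])
  finally show "emeasure (mv_normal I \<mu> (d *\<^sub>R sub_inv I U)) (space (mv_normal I \<mu> (d *\<^sub>R sub_inv I U))) = 1" .
qed

subsection \<open>Inverse gamma integrals\<close>

text \<open>Substitution \<open>t = b / x\<close> in Euler's integral for
  \<open>Gamma a\<close>.\<close>

lemma has_integral_inverse_gamma:
  assumes a: "0 < a" and b: "0 < (b::real)"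
  shows "((\<lambda>x. x powr (- a - 1) * exp (- b / x)) has_integral Gamma a / b powr a) {0<..}"
proof -
  let ?f = "\<lambda>t::real. t powr (a - 1) / exp t"
  have "(?f has_integral Gamma a) {0..}" using a by (rule Gamma_integral_real)
  \<comment> \<open>The endpoint 0 is a null set; it is dropped because \<open>b / x\<close> maps
    the open half line onto itself.\<close>
  then have f: "(?f has_integral Gamma a) {0<..}"
    by (subst has_integral_spike_set_eq[of _ "{0..}"])
       (auto intro: negligible_subset[OF negligible_sing[of 0]])
  have abs: "?f absolutely_integrable_on {0<..}"
    using f by (intro nonnegative_absolutely_integrable_1) auto
  have img: "(\<lambda>x. b / x) ` {0<..} = {0<..}"
  proof
    show "{0<..} \<subseteq> (\<lambda>x. b / x) ` {0<..}"
    proof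
      fix y :: real assume "y \<in> {0<..}"
      with b show "y \<in> (\<lambda>x. b / x) ` {0<..}"
        by (intro image_eqI[of _ _ "b / y"]) auto
    qed
  qed (use b in auto)
  have "(\<lambda>x. \<bar>- b / x\<^sup>2\<bar> * ?f (b / x)) absolutely_integrable_on {0<..} \<and>
      integral {0<..} (\<lambda>x. \<bar>- b / x\<^sup>2\<bar> * ?f (b / x)) = Gamma a"
  proof (subst has_absolute_integral_change_of_variables_1'[where g = "\<lambda>x. b / x" and f = ?f
        and g' = "\<lambda>x. - b / x\<^sup>2"])
    show "((\<lambda>x. b / x) has_real_derivative - b / x\<^sup>2) (at x within {0<..})" if "x \<in> {0<..}" for x
      using that by (auto intro!: derivative_eq_intros simp: power2_eq_square)
    show "inj_on (\<lambda>x. b / x) {0<..}" using b by (auto simp: inj_on_def field_simps)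
    show "?f absolutely_integrable_on (\<lambda>x. b / x) ` {0<..} \<and>
        integral ((\<lambda>x. b / x) ` {0<..}) ?f = Gamma a"
      unfolding img using abs f by (auto simp: integral_unique)
  qed simp
  then have "((\<lambda>x. \<bar>- b / x\<^sup>2\<bar> * ?f (b / x)) has_integral Gamma a) {0<..}"
    unfolding has_integral_integrable_integral
    by (blast intro: set_lebesgue_integral_eq_integral(1))
  then have "((\<lambda>x. b powr a * (x powr (- a - 1) * exp (- b / x))) has_integral Gamma a) {0<..}"
  proof (rule has_integral_eq[rotated])
    fix x :: real assume "x \<in> {0<..}"
    then have x: "0 < x" by simp
    have "\<bar>- b / x\<^sup>2\<bar> * ?f (b / x) = b / x\<^sup>2 * (b powr (a - 1) / x powr (a - 1)) * exp (- b / x)"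
      using x b by (simp add: powr_divide exp_minus field_simps)
    also have "b / x\<^sup>2 * (b powr (a - 1) / x powr (a - 1)) = b powr a * x powr (- a - 1)"
      using x b by (simp add: powr_diff powr_minus field_simps power2_eq_square)
    finally show "\<bar>- b / x\<^sup>2\<bar> * ?f (b / x) = b powr a * (x powr (- a - 1) * exp (- b / x))"
      by simp
  qed
  from has_integral_mult_right[OF this, of "1 / b powr a"] show ?thesis
    using b by simp
qed

lemma nn_integral_inverse_gamma:
  assumes "0 < a" and "0 < (b::real)"
  shows "(\<integral>\<^sup>+ x. ennreal (indicator {0<..} x * (x powr (- a - 1) * exp (- b / x))) \<partial>lborel)
    = ennreal (Gamma a / b powr a)"
  using nn_integral_has_integral_lebesgue[OF _ has_integral_inverse_gamma[OF assms]] by simp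

text \<open>For \<open>a \<le> 0\<close> and \<open>x \<ge> 1\<close> the integrand is at least
  \<open>exp (- b) / x\<close>, so the integral diverges logarithmically at infinity.\<close>

lemma inverse_gamma_integrable_imp_pos:
  assumes b: "0 < (b::real)"
    and fin: "(\<integral>\<^sup>+ x. ennreal (indicator {0<..} x * (x powr (- a - 1) * exp (- b / x))) \<partial>lborel) < \<infinity>"
  shows "0 < a"
proof (rule ccontr)
  assume "\<not> 0 < a"
  let ?I = "\<integral>\<^sup>+ x. ennreal (indicator {0<..} x * (x powr (- a - 1) * exp (- b / x))) \<partial>lborel"
  have le: "exp (- b) * ln N \<le> enn2real ?I" if N: "1 \<le> N" for N
  proof -
    have "ennreal (exp (- b) * ln N - exp (- b) * ln 1)
       = (\<integral>\<^sup>+ x. ennreal (exp (- b) / x) * indicator {1..N} x \<partial>lborel)"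
      using N by (intro nn_integral_FTC_Icc[symmetric])
        (auto intro!: derivative_eq_intros)
    also have "\<dots> \<le> ?I"
    proof (intro nn_integral_mono)
      fix x :: real
      show "ennreal (exp (- b) / x) * indicator {1..N} x
          \<le> ennreal (indicator {0<..} x * (x powr (- a - 1) * exp (- b / x)))"
      proof (cases "x \<in> {1..N}")
        case True
        then have x: "1 \<le> x" by simp
        have "x powr (- 1) \<le> x powr (- a - 1)"
          using x \<open>\<not> 0 < a\<close> by (intro powr_mono) auto
        moreover have "exp (- b) \<le> exp (- b / x)"
          using x b by (simp add: divide_le_eq mult_le_cancel_left1)
        ultimately have "x powr (- 1) * exp (- b) \<le> x powr (- a - 1) * exp (- b / x)"
          by (intro mult_mono) auto
        then show ?thesis using x True by (simp add: powr_minus field_simps)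
      qed simp
    qed
    also have "?I = ennreal (enn2real ?I)" using fin by (simp add: less_top)
    finally show ?thesis by (subst (asm) ennreal_le_iff) simp_all
  qed
  \<comment> \<open>Chosen so that the lower bound \<open>exp (- b) * ln N\<close> is the supposed
    integral plus 1.\<close>
  define N where "N = exp ((enn2real ?I + 1) * exp b)"
  have "1 \<le> N" by (simp add: N_def)
  from le[OF this] have "exp (- b) * ((enn2real ?I + 1) * exp b) \<le> enn2real ?I" by (simp only: N_def ln_exp)
  then show False by (simp add: exp_minus field_simps)
qed

section \<open>Measurability of matrix-valued maps and Lebesgue products indexed by edges\<close>

lemma borel_measurable_vecI:
  fixes f :: "'a \<Rightarrow> ('b::euclidean_space, 'n::finite) vec"
  assumes "\<And>i. (\<lambda>x. f x $ i) \<in> borel_measurable M"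
  shows "f \<in> borel_measurable M"
proof -
  \<comment> \<open>A vector is a finite sum of \<open>axis\<close> vectors. With a general
    component type the lemma can be applied twice, which covers matrices.\<close>
  have ax: "(axis i :: 'b \<Rightarrow> ('b, 'n) vec) \<in> borel_measurable borel" for i
  proof (rule borel_measurable_continuous_onI)
    show "continuous_on UNIV (axis i :: 'b \<Rightarrow> ('b, 'n) vec)"
      unfolding axis_def
    proof (rule continuous_on_vec_lambda)
      fix j show "continuous_on UNIV (\<lambda>x :: 'b. if j = i then x else 0)"
        by (cases "j = i") auto
    qed
  qed
  have "f = (\<lambda>x. \<Sum>i\<in>UNIV. axis i (f x $ i))"
    by (auto simp: fun_eq_iff vec_eq_iff axis_def sum.delta)
  also have "\<dots> \<in> borel_measurable M"
    by (intro borel_measurable_sum measurable_compose[OF assms ax])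
  finally show ?thesis .
qed

lemma measurable_PiM_lborel_block:
  assumes "\<And>k. k \<in> P \<Longrightarrow> (i, k) \<in> S"
  shows "(\<lambda>y. \<lambda>k\<in>P. y (i, k)) \<in> (\<Pi>\<^sub>M e\<in>S. lborel) \<rightarrow>\<^sub>M (\<Pi>\<^sub>M k\<in>P. lborel :: real measure)"
  using assms by (intro measurable_restrict measurable_component_singleton)

text \<open>Renaming the coordinates \<open>(i, k)\<close> as \<open>k\<close> carries one Lebesgue
  product to the other; it suffices to compare boxes.\<close>

lemma nn_integral_PiM_lborel_row:
  fixes P :: "'b set" and h :: "('b \<Rightarrow> real) \<Rightarrow> ennreal"
  assumes P: "finite P" and h: "h \<in> borel_measurable (\<Pi>\<^sub>M k\<in>P. lborel)"
  shows "(\<integral>\<^sup>+ y. h (\<lambda>k\<in>P. y (i, k)) \<partial>(\<Pi>\<^sub>M e\<in>{i} \<times> P. lborel)) = (\<integral>\<^sup>+ x. h x \<partial>(\<Pi>\<^sub>M k\<in>P. lborel))"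
proof -
  let ?r = "\<lambda>y. \<lambda>k\<in>P. y (i, k)"
  interpret R: product_sigma_finite "\<lambda>_::'a \<times> 'b. lborel :: real measure" by (rule product_sigma_finite_lborel)
  interpret product_sigma_finite "\<lambda>_::'b. lborel :: real measure" by (rule product_sigma_finite_lborel)
  have r: "?r \<in> (\<Pi>\<^sub>M e\<in>{i} \<times> P. lborel) \<rightarrow>\<^sub>M (\<Pi>\<^sub>M k\<in>P. lborel :: real measure)"
    by (rule measurable_PiM_lborel_block) simp
  have "distr (\<Pi>\<^sub>M e\<in>{i} \<times> P. lborel) (\<Pi>\<^sub>M k\<in>P. lborel) ?r = (\<Pi>\<^sub>M k\<in>P. lborel :: real measure)"
  proof (rule PiM_eqI[OF P])
    fix A :: "'b \<Rightarrow> real set" assume A: "\<And>k. k \<in> P \<Longrightarrow> A k \<in> sets lborel"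
    have "emeasure (distr (\<Pi>\<^sub>M e\<in>{i} \<times> P. lborel) (\<Pi>\<^sub>M k\<in>P. lborel) ?r) (Pi\<^sub>E P A)
        = emeasure (\<Pi>\<^sub>M e\<in>{i} \<times> P. lborel) (?r -` Pi\<^sub>E P A \<inter> space (\<Pi>\<^sub>M e\<in>{i} \<times> P. lborel))"
      using A P by (intro emeasure_distr r sets_PiM_I_finite) auto
    also have "?r -` Pi\<^sub>E P A \<inter> space (\<Pi>\<^sub>M e\<in>{i} \<times> P. lborel) = (\<Pi>\<^sub>E e\<in>{i} \<times> P. A (snd e))"
      by (auto simp: space_PiM PiE_def Pi_def extensional_def)
    also have "emeasure (\<Pi>\<^sub>M e\<in>{i} \<times> P. lborel) \<dots> = (\<Prod>e\<in>{i} \<times> P. emeasure lborel (A (snd e)))"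
      using A P by (intro R.emeasure_PiM) auto
    also have "\<dots> = (\<Prod>k\<in>P. emeasure lborel (A k))"
      by (rule prod.reindex_bij_witness[of _ "\<lambda>k. (i, k)" snd]) auto
    finally show "emeasure (distr (\<Pi>\<^sub>M e\<in>{i} \<times> P. lborel) (\<Pi>\<^sub>M k\<in>P. lborel) ?r) (Pi\<^sub>E P A)
      = (\<Prod>k\<in>P. emeasure lborel (A k))" .
  qed simp
  with nn_integral_distr[OF r, of h] h show ?thesis by simp
qed

text \<open>Fubini, one row at a time: the factor of a row depends only on the coordinates in that
  row.\<close>

lemma nn_integral_PiM_lborel_rows:
  fixes P :: "'a \<Rightarrow> 'b set" and h :: "'a \<Rightarrow> ('b \<Rightarrow> real) \<Rightarrow> ennreal"
  assumes "finite J" and "\<And>i. i \<in> J \<Longrightarrow> finite (P i)"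
    and "\<And>i. i \<in> J \<Longrightarrow> h i \<in> borel_measurable (\<Pi>\<^sub>M k\<in>P i. lborel)"
  shows "(\<integral>\<^sup>+ y. (\<Prod>i\<in>J. h i (\<lambda>k\<in>P i. y (i, k))) \<partial>(\<Pi>\<^sub>M e\<in>Sigma J P. lborel)) =
    (\<Prod>i\<in>J. \<integral>\<^sup>+ x. h i x \<partial>(\<Pi>\<^sub>M k\<in>P i. lborel))"
  using assms
proof (induction J rule: finite_induct)
  case empty
  then show ?case by (simp add: PiM_empty)
next
  case (insert i J)
  interpret product_sigma_finite "\<lambda>_::'a \<times> 'b. lborel :: real measure" by (rule product_sigma_finite_lborel)
  let ?I = "{i} \<times> P i" and ?K = "Sigma J P"
  have un: "Sigma (insert i J) P = ?I \<union> ?K" by auto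
  have disj: "?I \<inter> ?K = {}" using insert.hyps by auto
  have fin: "finite ?I" "finite ?K" using insert.hyps insert.prems(1) by auto
  let ?f = "\<lambda>y. \<Prod>j\<in>insert i J. h j (\<lambda>k\<in>P j. y (j, k))"
  have f: "?f \<in> borel_measurable (\<Pi>\<^sub>M e\<in>Sigma (insert i J) P. lborel)"
    by (intro borel_measurable_prod_ennreal measurable_compose[OF measurable_PiM_lborel_block insert.prems(2)])
       auto
  have hK: "(\<lambda>y. \<Prod>j\<in>J. h j (\<lambda>k\<in>P j. y (j, k))) \<in> borel_measurable (\<Pi>\<^sub>M e\<in>?K. lborel)"
    by (intro borel_measurable_prod_ennreal measurable_compose[OF measurable_PiM_lborel_block insert.prems(2)])
       auto
  have hI: "(\<lambda>x. h i (\<lambda>k\<in>P i. x (i, k))) \<in> borel_measurable (\<Pi>\<^sub>M e\<in>?I. lborel)"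
    by (intro measurable_compose[OF measurable_PiM_lborel_block insert.prems(2)]) auto
  have eq: "?f (merge ?I ?K (x, y)) = h i (\<lambda>k\<in>P i. x (i, k)) * (\<Prod>j\<in>J. h j (\<lambda>k\<in>P j. y (j, k)))" for x y
  proof -
    have 1: "(\<lambda>k\<in>P i. merge ?I ?K (x, y) (i, k)) = (\<lambda>k\<in>P i. x (i, k))"
      by (auto simp: merge_def restrict_def)
    have "(\<Prod>j\<in>J. h j (\<lambda>k\<in>P j. merge ?I ?K (x, y) (j, k))) = (\<Prod>j\<in>J. h j (\<lambda>k\<in>P j. y (j, k)))"
    proof (rule prod.cong)
      fix j assume "j \<in> J"
      then have "(\<lambda>k\<in>P j. merge ?I ?K (x, y) (j, k)) = (\<lambda>k\<in>P j. y (j, k))"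
        using insert.hyps by (auto simp: merge_def restrict_def)
      then show "h j (\<lambda>k\<in>P j. merge ?I ?K (x, y) (j, k)) = h j (\<lambda>k\<in>P j. y (j, k))"
        by (simp only:)
    qed simp
    then show ?thesis using insert.hyps by (simp only: prod.insert[OF insert.hyps] 1)
  qed
  have "(\<integral>\<^sup>+ y. ?f y \<partial>(\<Pi>\<^sub>M e\<in>Sigma (insert i J) P. lborel))
      = (\<integral>\<^sup>+ x. (\<integral>\<^sup>+ y. ?f (merge ?I ?K (x, y)) \<partial>(\<Pi>\<^sub>M e\<in>?K. lborel)) \<partial>(\<Pi>\<^sub>M e\<in>?I. lborel))"
    unfolding un by (intro product_nn_integral_fold disj fin f[unfolded un])
  also have "\<dots> = (\<integral>\<^sup>+ x. h i (\<lambda>k\<in>P i. x (i, k)) *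
      (\<integral>\<^sup>+ y. (\<Prod>j\<in>J. h j (\<lambda>k\<in>P j. y (j, k))) \<partial>(\<Pi>\<^sub>M e\<in>?K. lborel)) \<partial>(\<Pi>\<^sub>M e\<in>?I. lborel))"
    unfolding eq by (simp only: nn_integral_cmult[OF hK])
  also have "\<dots> = (\<integral>\<^sup>+ x. h i (\<lambda>k\<in>P i. x (i, k)) \<partial>(\<Pi>\<^sub>M e\<in>?I. lborel)) *
      (\<integral>\<^sup>+ y. (\<Prod>j\<in>J. h j (\<lambda>k\<in>P j. y (j, k))) \<partial>(\<Pi>\<^sub>M e\<in>?K. lborel))"
    by (rule nn_integral_multc[OF hI])
  also have "(\<integral>\<^sup>+ y. (\<Prod>j\<in>J. h j (\<lambda>k\<in>P j. y (j, k))) \<partial>(\<Pi>\<^sub>M e\<in>?K. lborel)) =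
      (\<Prod>j\<in>J. \<integral>\<^sup>+ x. h j x \<partial>(\<Pi>\<^sub>M k\<in>P j. lborel))"
    using insert.prems by (intro insert.IH) auto
  also have "(\<integral>\<^sup>+ x. h i (\<lambda>k\<in>P i. x (i, k)) \<partial>(\<Pi>\<^sub>M e\<in>?I. lborel)) = (\<integral>\<^sup>+ x. h i x \<partial>(\<Pi>\<^sub>M k\<in>P i. lborel))"
    using insert.prems by (intro nn_integral_PiM_lborel_row) auto
  finally show ?case by (simp only: prod.insert[OF insert.hyps])
qed

text \<open>Each set of the sigma-algebra generated by \<open>Y\<close> is a preimage under
  \<open>Y\<close>, so the assumption on rectangles is the characterising property of the
  conditional expectation. The kernel is constrained only for \<open>0 < d\<close>, the range in
  which \<open>d\<close> scales a covariance to a covariance.\<close>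

lemma has_conditional_lawI:
  fixes Y :: "'w \<Rightarrow> real"
  assumes M: "prob_space M" and X: "X \<in> M \<rightarrow>\<^sub>M N" and Y: "Y \<in> borel_measurable M"
    and pos: "\<And>\<omega>. \<omega> \<in> space M \<Longrightarrow> 0 < Y \<omega>"
    and K: "\<And>d. 0 < d \<Longrightarrow> prob_space (K d)" "\<And>d. 0 < d \<Longrightarrow> sets (K d) = sets N"
    and meas: "\<And>B. B \<in> sets N \<Longrightarrow> (\<lambda>d. indicator {0<..} d * emeasure (K d) B) \<in> borel_measurable borel"
    and eq: "\<And>A B. A \<in> sets borel \<Longrightarrow> B \<in> sets N \<Longrightarrow>
      emeasure M {\<omega> \<in> space M. Y \<omega> \<in> A \<and> X \<omega> \<in> B} =
      (\<integral>\<^sup>+ \<omega>. indicator A (Y \<omega>) * emeasure (K (Y \<omega>)) B \<partial>M)"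
  shows "has_conditional_law M X N Y borel K"
proof -
  interpret prob_space M by fact
  define F where "F = vimage_algebra (space M) Y borel"
  have sF: "sets F = {Y -` A \<inter> space M | A. A \<in> sets borel}"
    unfolding F_def by (rule sets_vimage_algebra2) simp
  have subalg: "subalgebra M F"
    unfolding subalgebra_def sF using Y by (auto simp: F_def intro: measurable_sets)
  interpret finite_measure_subalgebra M F by unfold_locales fact
  have YF: "Y \<in> borel_measurable F" unfolding F_def by (rule measurable_vimage_algebra1) simp
  have main: "(\<lambda>\<omega>. measure (K (Y \<omega>)) B) \<in> borel_measurable F \<and>
      (AE \<omega> in M. real_cond_exp M F (indicator (X -` B \<inter> space M)) \<omega> = measure (K (Y \<omega>)) B)"
    if B: "B \<in> sets N" for B
  proof -
    \<comment> \<open>Cutting at 0 gives a Borel function on the whole line; along the positive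
      \<open>Y\<close> the cut is invisible.\<close>
    let ?g0 = "\<lambda>d. enn2real (indicator {0<..} d * emeasure (K d) B)"
    have g0: "?g0 \<in> borel_measurable borel" using meas[OF B] by measurable
    have g_eq: "?g0 (Y \<omega>) = measure (K (Y \<omega>)) B" if "\<omega> \<in> space M" for \<omega>
      using pos[OF that] by (simp add: measure_def)
    have g: "(\<lambda>\<omega>. measure (K (Y \<omega>)) B) \<in> borel_measurable F"
      using measurable_compose[OF YF g0]
      by (subst measurable_cong[where g = "\<lambda>\<omega>. ?g0 (Y \<omega>)"]) (auto simp: F_def g_eq)
    have gM: "(\<lambda>\<omega>. measure (K (Y \<omega>)) B) \<in> borel_measurable M"
      using g subalg by (rule measurable_from_subalg[rotated])
    have em: "emeasure (K (Y \<omega>)) B = ennreal (measure (K (Y \<omega>)) B)" if "\<omega> \<in> space M" for \<omega>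
    proof -
      interpret K: prob_space "K (Y \<omega>)" using K(1) pos[OF that] .
      show ?thesis by (rule K.emeasure_eq_measure)
    qed
    have le1: "measure (K (Y \<omega>)) B \<le> 1" if "\<omega> \<in> space M" for \<omega>
      using prob_space.prob_le_1[OF K(1)[OF pos[OF that]]] .
    have XB: "X -` B \<inter> space M \<in> sets M" using X B by (rule measurable_sets)
    have "AE \<omega> in M. real_cond_exp M F (indicator (X -` B \<inter> space M)) \<omega> = measure (K (Y \<omega>)) B"
    proof (rule real_cond_exp_charact)
      fix C assume "C \<in> sets F"
      then obtain A where A: "A \<in> sets borel" and C: "C = Y -` A \<inter> space M" using sF by auto
      have CM: "C \<in> sets M" unfolding C using Y A by (rule measurable_sets)
      have "(\<integral>\<omega>\<in>C. indicator (X -` B \<inter> space M) \<omega> \<partial>M) = measure M (C \<inter> (X -` B \<inter> space M))"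
        using CM XB by (simp add: set_lebesgue_integral_def indicator_inter_arith[symmetric])
      also have "C \<inter> (X -` B \<inter> space M) = {\<omega> \<in> space M. Y \<omega> \<in> A \<and> X \<omega> \<in> B}"
        by (auto simp: C)
      also have "measure M \<dots> = enn2real (\<integral>\<^sup>+ \<omega>. indicator A (Y \<omega>) * emeasure (K (Y \<omega>)) B \<partial>M)"
        unfolding measure_def eq[OF A B] ..
      also have "(\<integral>\<^sup>+ \<omega>. indicator A (Y \<omega>) * emeasure (K (Y \<omega>)) B \<partial>M)
          = (\<integral>\<^sup>+ \<omega>. ennreal (indicator C \<omega> * measure (K (Y \<omega>)) B) \<partial>M)"
        by (intro nn_integral_cong) (auto simp: C em indicator_def)
      also have "enn2real \<dots> = (\<integral>\<omega>\<in>C. measure (K (Y \<omega>)) B \<partial>M)"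
        unfolding set_lebesgue_integral_def using CM gM
        by (subst integral_eq_nn_integral) auto
      finally show "(\<integral>\<omega>\<in>C. indicator (X -` B \<inter> space M) \<omega> \<partial>M) = (\<integral>\<omega>\<in>C. measure (K (Y \<omega>)) B \<partial>M)" .
    next
      show "integrable M (indicator (X -` B \<inter> space M) :: 'w \<Rightarrow> real)"
        using XB by (simp add: integrable_indicator_iff emeasure_eq_measure)
      show "integrable M (\<lambda>\<omega>. measure (K (Y \<omega>)) B)"
        using le1 gM by (intro integrable_const_bound[of _ 1]) auto
    qed (rule g)
    with g show ?thesis by blast
  qed
  show ?thesis
    unfolding has_conditional_law_def F_def[symmetric]
    using X Y main K pos by auto
qed

subsection \<open>Factorisation over the vertices\<close>

text \<open>Expressed through the covariance alone, so that measurability rests on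
  \<open>P_algebra E\<close> and not on a choice of Cholesky factors. The first component is the
  residual variance, which \<open>block_stat_cov\<close> identifies with
  \<open>D_ii\<close>.\<close>

definition block_stat ::
  "('n::{finite,linorder} \<times> 'n) set \<Rightarrow> 'n sqmat \<Rightarrow> 'n \<Rightarrow> real \<times> ('n \<Rightarrow> real)" where
  "block_stat E S i = (S $ i $ i - pred_quad E S i, pred_coef E S i)"

abbreviation block_space ::
  "('n::{finite,linorder} \<times> 'n) set \<Rightarrow> 'n \<Rightarrow> (real \<times> ('n \<Rightarrow> real)) measure" where
  "block_space E i \<equiv> borel \<Otimes>\<^sub>M (\<Pi>\<^sub>M k\<in>preds E i. borel)"

text \<open>The share of vertex \<open>i\<close> in \<open>kernel_density\<close>, with
  \<open>d\<close> for \<open>D_ii\<close> and \<open>x\<close> for the regression vector, the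
  square being completed around the coefficients of \<open>U\<close>.\<close>

definition block_kernel ::
  "('n::{finite,linorder} \<times> 'n) set \<Rightarrow> 'n sqmat \<Rightarrow> (real, 'n) vec \<Rightarrow> 'n \<Rightarrow> real \<times> ('n \<Rightarrow> real) \<Rightarrow> real" where
  "block_kernel E U \<alpha> i = (\<lambda>(d, x). exp (- (1/2) *
     (((\<Sum>k\<in>preds E i. \<Sum>l\<in>preds E i.
          (x k - pred_coef E U i k) * U $ k $ l * (x l - pred_coef E U i l))
        + (U $ i $ i - pred_quad E U i)) / d + \<alpha> $ i * ln d)))"

abbreviation cov_of :: "'n::{finite,linorder} sqmat \<times> 'n sqmat \<Rightarrow> 'n sqmat" where
  "cov_of \<equiv> \<lambda>(L, D). L ** D ** transpose L"

lemma measurable_block_stat: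
  "(\<lambda>S. block_stat E S i) \<in> P_algebra E \<rightarrow>\<^sub>M block_space E i"
proof -
  have [measurable]: "(\<lambda>S. pred_coef E S i k) \<in> borel_measurable (P_algebra E)" if "k \<in> preds E i" for k
    using measurable_compose[OF measurable_pred_coef measurable_component_singleton[OF that]] .
  have "(\<lambda>S. S $ i $ i - pred_quad E S i) \<in> borel_measurable (P_algebra E)"
    unfolding pred_quad_eq by (intro borel_measurable_diff borel_measurable_sum borel_measurable_times) measurable
  then show ?thesis
    unfolding block_stat_def by (intro measurable_Pair measurable_pred_coef)
qed

lemma measurable_theta_of_coords:
  "theta_of_coords E \<in> (\<Pi>\<^sub>M e\<in>lower_edges E. lborel) \<Otimes>\<^sub>M (\<Pi>\<^sub>M i\<in>UNIV. lborel)
     \<rightarrow>\<^sub>M (borel :: ('n::{finite,linorder} sqmat \<times> 'n sqmat) measure)"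
proof -
  let ?N = "(\<Pi>\<^sub>M e\<in>lower_edges E. lborel) \<Otimes>\<^sub>M (\<Pi>\<^sub>M i\<in>UNIV. lborel) :: (('n \<times> 'n \<Rightarrow> real) \<times> ('n \<Rightarrow> real)) measure"
  have 1: "(\<lambda>x. fst x e) \<in> borel_measurable ?N" if "e \<in> lower_edges E" for e
    using measurable_compose[OF measurable_fst measurable_component_singleton[OF that, of "\<lambda>_. lborel"]] by simp
  have 2: "(\<lambda>x. snd x i) \<in> borel_measurable ?N" for i
    using measurable_compose[OF measurable_snd measurable_component_singleton[of i UNIV "\<lambda>_. lborel"]] by simp
  have "(\<lambda>x. (\<chi> i j. if i = j then 1 else if (i, j) \<in> lower_edges E then fst x (i, j) else 0) :: 'n sqmat)
      \<in> borel_measurable ?N"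
  proof (intro borel_measurable_vecI)
    fix i j
    show "(\<lambda>x. (\<chi> i j. if i = j then 1 else if (i, j) \<in> lower_edges E then fst x (i, j) else 0) $ i $ j)
        \<in> borel_measurable ?N"
      using 1[of "(i, j)"] by (cases "i = j"; cases "(i, j) \<in> lower_edges E") auto
  qed
  moreover have "(\<lambda>x. (\<chi> i j. if i = j then snd x i else 0) :: 'n sqmat) \<in> borel_measurable ?N"
  proof (intro borel_measurable_vecI)
    fix i j
    show "(\<lambda>x. (\<chi> i j. if i = j then snd x i else 0) $ i $ j) \<in> borel_measurable ?N"
      using 2[of i] by (cases "i = j") auto
  qed
  ultimately show ?thesis
    unfolding theta_of_coords_def case_prod_unfold by (rule borel_measurable_Pair)
qed

lemma Theta_measurable: "Theta E \<in> sets (borel :: ('n::{finite,linorder} sqmat \<times> 'n sqmat) measure)"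
proof -
  have [measurable]: "(\<lambda>\<theta>::'n sqmat \<times> 'n sqmat. fst \<theta> $ i $ j) \<in> borel_measurable borel"
    "(\<lambda>\<theta>::'n sqmat \<times> 'n sqmat. snd \<theta> $ i $ j) \<in> borel_measurable borel" for i j
    by (intro borel_measurable_continuous_onI continuous_intros)+
  have "Theta E = {\<theta> \<in> space borel. (\<forall>i\<in>UNIV. fst \<theta> $ i $ i = 1) \<and>
      (\<forall>i\<in>UNIV. \<forall>j\<in>UNIV. i < j \<longrightarrow> fst \<theta> $ i $ j = 0) \<and>
      (\<forall>i\<in>UNIV. \<forall>j\<in>UNIV. j < i \<and> (i, j) \<notin> E \<longrightarrow> fst \<theta> $ i $ j = 0) \<and>
      (\<forall>i\<in>UNIV. \<forall>j\<in>UNIV. i \<noteq> j \<longrightarrow> snd \<theta> $ i $ j = 0) \<and> (\<forall>i\<in>UNIV. 0 < snd \<theta> $ i $ i)}"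
    by (auto simp: Theta_def L_space_def unit_lower_triangular_def positive_diagonal_def)
  also have "\<dots> \<in> sets borel" by measurable
  finally show ?thesis .
qed

lemma space_theta_measure: "space (theta_measure E) = Theta E"
  by (simp add: theta_measure_def space_restrict_space)

lemma theta_of_coords_in_Theta_iff: "theta_of_coords E (l, d) \<in> Theta E \<longleftrightarrow> (\<forall>i. 0 < d i)"
  by (auto simp: theta_of_coords_def Theta_def L_space_def unit_lower_triangular_def
      positive_diagonal_def lower_edges_def)

lemma lower_edges_eq: "lower_edges E = Sigma UNIV (preds E)"
  by (auto simp: lower_edges_def preds_def)

context hasse_graph
begin

lemma measurable_cov_of: "cov_of \<in> theta_measure E \<rightarrow>\<^sub>M P_algebra E"
proof -
  have "continuous_on UNIV (\<lambda>\<theta>::'n sqmat \<times> 'n sqmat. fst \<theta> ** snd \<theta> ** transpose (fst \<theta>))"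
    unfolding matrix_matrix_mult_def transpose_def vec_lambda_beta
    by (intro continuous_intros)
  then have "cov_of \<in> borel_measurable (borel :: ('n sqmat \<times> 'n sqmat) measure)"
    unfolding case_prod_unfold by (rule borel_measurable_continuous_onI)
  then have "cov_of \<in> borel_measurable (theta_measure E)"
    unfolding theta_measure_def by (intro measurable_restrict_space1) simp
  then show ?thesis
    unfolding P_algebra_def
    by (rule measurable_restrict_space2[rotated]) (auto simp: space_theta_measure cov_in_P_space)
qed

text \<open>\<open>regr\<close> solves the normal equations of the covariance, and
  \<open>pred_coef_eqI\<close> makes that solution unique; the residual then comes from
  \<open>cov_residual\<close>.\<close>

lemma block_stat_cov:
  assumes \<theta>: "(L, D) \<in> Theta E"
  shows "block_stat E (L ** D ** transpose L) i =
    (D $ i $ i, \<lambda>k\<in>preds E i. regr E (\<lambda>(i, k). L $ i $ k) i k)"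
proof -
  let ?S = "L ** D ** transpose L" and ?x = "regr E (\<lambda>(i, k). L $ i $ k) i"
  have pd: "positive_definite ?S" using cov_in_P_space[OF \<theta>] by (simp add: P_space_def)
  have coef: "pred_coef E ?S i k = ?x k" if "k \<in> preds E i" for k
  proof (rule pred_coef_eqI[OF positive_definite_imp_pd_on[OF pd] that])
    fix k assume "k \<in> preds E i"
    have "(\<Sum>l\<in>preds E i. ?S $ k $ l * ?x l) = (\<Sum>l\<in>preds E i. ?x l * ?S $ l $ k)"
      by (intro sum.cong refl) (metis mult.commute positive_definite_sym[OF pd])
    also have "\<dots> = ?S $ i $ k" using cov_regr_system[OF \<theta> \<open>k \<in> preds E i\<close>] .
    also have "\<dots> = ?S $ k $ i" using pd by (rule positive_definite_sym)
    finally show "(\<Sum>l\<in>preds E i. ?S $ k $ l * ?x l) = ?S $ k $ i" .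
  qed
  have "pred_quad E ?S i = (\<Sum>k\<in>preds E i. ?x k * ?S $ k $ i)"
    unfolding pred_quad_eq by (intro sum.cong refl) (simp add: coef)
  then have "?S $ i $ i - pred_quad E ?S i = D $ i $ i" using cov_residual[OF \<theta>, of i] by simp
  moreover have "pred_coef E ?S i = (\<lambda>k\<in>preds E i. ?x k)"
    using coef by (auto simp: fun_eq_iff) (simp add: pred_coef_def)
  ultimately show ?thesis by (simp add: block_stat_def)
qed

text \<open>Row \<open>i\<close> of \<open>T\<close> has 1 at \<open>i\<close> and
  \<open>- regr\<close> on the predecessors, so its summand in \<open>trace_inverse_cov\<close> is
  the left side of \<open>residual_form\<close> for \<open>U\<close>.\<close>

lemma kernel_density_eq_prod:
  assumes \<theta>: "(L, D) \<in> Theta E" and U: "positive_definite U"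
  shows "kernel_density U \<alpha> (L, D) =
    (\<Prod>i\<in>UNIV. block_kernel E U \<alpha> i (block_stat E (L ** D ** transpose L) i))"
proof -
  let ?T = "regr_matrix E L"
  have quad: "(\<Sum>j\<in>UNIV. \<Sum>k\<in>UNIV. ?T $ i $ j * ?T $ i $ k * U $ j $ k) =
    (\<Sum>k\<in>preds E i. \<Sum>l\<in>preds E i.
          (regr E (\<lambda>(i, k). L $ i $ k) i k - pred_coef E U i k) * U $ k $ l *
          (regr E (\<lambda>(i, k). L $ i $ k) i l - pred_coef E U i l))
        + (U $ i $ i - pred_quad E U i)" for i
  proof -
    let ?x = "regr E (\<lambda>(i, k). L $ i $ k) i"
    define s where "s = (\<Sum>k\<in>preds E i. ?x k * U $ k $ i)"
    have s': "(\<Sum>k\<in>preds E i. ?x k * U $ i $ k) = s"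
      unfolding s_def by (intro sum.cong refl) (metis positive_definite_sym[OF U])
    have "(\<Sum>j\<in>UNIV. \<Sum>k\<in>UNIV. ?T $ i $ j * ?T $ i $ k * U $ j $ k)
        = (\<Sum>j\<in>UNIV. ?T $ i $ j * (\<Sum>k\<in>UNIV. ?T $ i $ k * U $ j $ k))"
      by (simp add: sum_distrib_left mult.assoc)
    also have "\<dots> = U $ i $ i - s - (s - (\<Sum>j\<in>preds E i. \<Sum>k\<in>preds E i. ?x j * U $ j $ k * ?x k))"
      by (simp only: regr_matrix_sum right_diff_distrib sum_subtractf s' s_def[symmetric])
         (simp add: sum_distrib_left mult_ac)
    also have "\<dots> = U $ i $ i - 2 * s + (\<Sum>j\<in>preds E i. \<Sum>k\<in>preds E i. ?x j * U $ j $ k * ?x k)"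
      by simp
    finally show ?thesis unfolding s_def by (simp only: residual_form[OF U])
  qed
  have "(\<Prod>i\<in>UNIV. block_kernel E U \<alpha> i (block_stat E (L ** D ** transpose L) i)) =
    (\<Prod>i\<in>UNIV. exp (- (1/2) * ((\<Sum>j\<in>UNIV. \<Sum>k\<in>UNIV. ?T $ i $ j * ?T $ i $ k * U $ j $ k) / D $ i $ i
       + \<alpha> $ i * ln (D $ i $ i))))"
    unfolding quad block_stat_cov[OF \<theta>] block_kernel_def by simp
  also have "\<dots> = kernel_density U \<alpha> (L, D)"
    unfolding exp_sum[OF finite, symmetric]
    by (simp only: kernel_density_def prod.case trace_inverse_cov[OF \<theta>] sum.distrib[symmetric] sum_distrib_left)
  finally show ?thesis ..
qed

end

section \<open>Change of variables from Cholesky entries to regression coefficients\<close>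

lemma regr_cong:
  assumes "\<And>i k. k \<in> preds E i \<Longrightarrow> l (i, k) = l' (i, k)" and "k \<in> preds E i"
  shows "regr E l i k = regr E l' i k"
  using assms(2)
proof (induction "card {k<..}" arbitrary: k rule: less_induct)
  case less
  have "regr E l i j * l (j, k) = regr E l' i j * l' (j, k)" if j: "j \<in> preds E i" "k \<in> preds E j" for j
  proof -
    have "k < j" using j(2) by (simp add: preds_def)
    then have "card {j<..} < card {k<..}" by (intro psubset_card_mono) auto
    then show ?thesis using less.hyps[of j] j assms(1) by simp
  qed
  then show ?case
    using assms(1)[OF less.prems] by (subst (1 2) regr.simps) (auto intro!: sum.cong)
qed

text \<open>The correction term in the recursion for \<open>(i, k)\<close> only involves entries \<open>(i, j)\<close> and \<open>(j, k)\<close>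
  with \<open>k < j < i\<close>, which lie closer to the diagonal.\<close>

lemma regr_shift_cong:
  assumes "\<And>p q. q \<in> preds E p \<Longrightarrow> card {q<..p} < card {k<..i} \<Longrightarrow> l (p, q) = l' (p, q)"
  shows "regr E l i k - l (i, k) = regr E l' i k - l' (i, k)"
proof -
  have less_card: "card {q<..p} < card {k<..i}" if "{q<..p} \<subset> {k<..i}" for p q :: 'a
    using that by (intro psubset_card_mono) auto
  \<comment> \<open>For \<open>j\<close> above \<open>k\<close>, each entry met by the recursion
    belongs to an interval strictly inside \<open>{k<..i}\<close>. The entry \<open>(i, k)\<close>
    itself has full length and is the one subtracted in the claim.\<close>
  have "regr E l i j = regr E l' i j" if "j \<in> preds E i" "k < j" for j
    using that
  proof (induction "card {j<..}" arbitrary: j rule: less_induct)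
    case less
    have ji: "j < i" using less.prems by (simp add: preds_def)
    have "{j<..i} \<subset> {k<..i}" using ji less.prems by auto
    then have lij: "l (i, j) = l' (i, j)" using assms less.prems(1) less_card by blast
    have "regr E l i m * l (m, j) = regr E l' i m * l' (m, j)" if m: "m \<in> preds E i" "j \<in> preds E m" for m
    proof -
      have jm: "j < m" "m < i" using m by (simp_all add: preds_def)
      then have "card {m<..} < card {j<..}" by (intro psubset_card_mono) auto
      moreover have "{j<..m} \<subset> {k<..i}" using jm less.prems by auto
      ultimately show ?thesis using less.hyps[of m] less.prems jm m assms less_card
        by (metis less_trans)
    qed
    then show ?case using lij by (subst (1 2) regr.simps) (auto intro!: sum.cong)
  qed
  moreover have "l (j, k) = l' (j, k)" if "j \<in> preds E i" "k \<in> preds E j" for j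
  proof -
    have "i \<in> {k<..i} - {k<..j}" "{k<..j} \<subseteq> {k<..i}" using that by (auto simp: preds_def)
    then have "{k<..j} \<subset> {k<..i}" by blast
    then show ?thesis using assms that(2) less_card by blast
  qed
  ultimately have "regr E l i j * l (j, k) = regr E l' i j * l' (j, k)" if "j \<in> preds E i" "k \<in> preds E j" for j
    using that by (metis (mono_tags, lifting) mem_Collect_eq preds_def)
  then show ?thesis by (subst (1 2) regr.simps) (auto intro!: sum.cong)
qed


lemma borel_measurable_regr:
  assumes "k \<in> preds E i"
  shows "(\<lambda>l. regr E l i k) \<in> borel_measurable (\<Pi>\<^sub>M e\<in>lower_edges E. lborel)"
  using assms
proof (induction "card {k<..}" arbitrary: k rule: less_induct)
  case less
  have comp: "(\<lambda>l. l e :: real) \<in> borel_measurable (\<Pi>\<^sub>M e\<in>lower_edges E. lborel)" if "e \<in> lower_edges E" for e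
    using measurable_component_singleton[OF that, of "\<lambda>_. lborel :: real measure"] by simp
  have "(\<lambda>l. regr E l i j) \<in> borel_measurable (\<Pi>\<^sub>M e\<in>lower_edges E. lborel)"
    if "j \<in> preds E i" "k \<in> preds E j" for j
  proof -
    have "k < j" using that by (simp add: preds_def)
    then have "card {j<..} < card {k<..}" by (intro psubset_card_mono) auto
    then show ?thesis using less.hyps[of j] that by simp
  qed
  then show ?case
    using less.prems unfolding regr.simps[of E _ i k]
    by (intro borel_measurable_diff borel_measurable_sum borel_measurable_times comp)
       (auto simp: lower_edges_eq)
qed

text \<open>The shear lemma with shift \<open>regr - l\<close> and the distance
  \<open>card {k<..i}\<close> from the diagonal as rank.\<close>

lemma nn_integral_regr:
  fixes E :: "('n::{finite,linorder} \<times> 'n) set"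
  assumes h: "h \<in> borel_measurable (\<Pi>\<^sub>M e\<in>lower_edges E. lborel)"
  shows "(\<integral>\<^sup>+ l. h (\<lambda>e\<in>lower_edges E. regr E l (fst e) (snd e)) \<partial>(\<Pi>\<^sub>M e\<in>lower_edges E. lborel)) =
    (\<integral>\<^sup>+ l. h l \<partial>(\<Pi>\<^sub>M e\<in>lower_edges E. lborel))"
proof -
  let ?G = "\<lambda>e l. regr E l (fst e) (snd e) - l e"
  have "(\<integral>\<^sup>+ l. h (\<lambda>e\<in>lower_edges E. l e + ?G e l) \<partial>(\<Pi>\<^sub>M e\<in>lower_edges E. lborel)) =
    (\<integral>\<^sup>+ l. h l \<partial>(\<Pi>\<^sub>M e\<in>lower_edges E. lborel))"
  proof (rule nn_integral_PiM_lborel_shear[where r = "\<lambda>(i, k). card {k<..i}", OF _ _ _ h])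
    fix e assume e: "e \<in> lower_edges E"
    then have "(\<lambda>l. l e :: real) \<in> borel_measurable (\<Pi>\<^sub>M e\<in>lower_edges E. lborel)"
      using measurable_component_singleton[OF e, of "\<lambda>_. lborel :: real measure"] by simp
    then show "?G e \<in> borel_measurable (\<Pi>\<^sub>M e\<in>lower_edges E. lborel)"
      using e by (intro borel_measurable_diff borel_measurable_regr) (auto simp: lower_edges_eq)
  next
    fix e and l l' :: "'n \<times> 'n \<Rightarrow> real" assume "e \<in> lower_edges E"
      and eq: "\<And>e'. e' \<in> lower_edges E \<Longrightarrow> (case e' of (i, k) \<Rightarrow> card {k<..i}) < (case e of (i, k) \<Rightarrow> card {k<..i})
        \<Longrightarrow> l e' = l' e'"
    obtain i k where e: "e = (i, k)" by (cases e)
    have "regr E l i k - l (i, k) = regr E l' i k - l' (i, k)"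
      by (rule regr_shift_cong, rule eq) (auto simp: e lower_edges_eq)
    then show "?G e l = ?G e l'" by (simp add: e)
  qed simp
  then show ?thesis by simp
qed

context hasse_graph
begin

lemma block_stat_coords:
  assumes d: "\<forall>i. 0 < d i"
  shows "block_stat E (cov_of (theta_of_coords E (l, d))) i = (d i, \<lambda>k\<in>preds E i. regr E l i k)"
proof -
  obtain L D where LD: "theta_of_coords E (l, d) = (L, D)" by (cases "theta_of_coords E (l, d)")
  have L: "L $ p $ q = l (p, q)" if "q \<in> preds E p" for p q
    using LD that by (auto simp: theta_of_coords_def lower_edges_eq)
  have D: "D $ i $ i = d i" using LD by (auto simp: theta_of_coords_def)
  have "(L, D) \<in> Theta E" using d LD theta_of_coords_in_Theta_iff by metis
  from block_stat_cov[OF this, of i]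
  have "block_stat E (L ** D ** transpose L) i = (d i, \<lambda>k\<in>preds E i. regr E (\<lambda>(i, k). L $ i $ k) i k)"
    by (simp add: D)
  also have "(\<lambda>k\<in>preds E i. regr E (\<lambda>(i, k). L $ i $ k) i k) = (\<lambda>k\<in>preds E i. regr E l i k)"
    by (intro restrict_ext regr_cong) (simp_all add: L)
  finally show ?thesis by (simp only: LD prod.case)
qed

text \<open>The coordinates \<open>(l, d)\<close> are replaced by \<open>(regr l, d)\<close>, a volume preserving change of variables
  after which the integrand is a product over the vertices.\<close>

lemma nn_integral_theta_measure:
  assumes H: "\<And>i. H i \<in> borel_measurable (block_space E i)"
  shows "(\<integral>\<^sup>+ \<theta>. (\<Prod>i\<in>UNIV. H i (block_stat E (cov_of \<theta>) i)) \<partial>theta_measure E) =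
    (\<Prod>i\<in>UNIV. \<integral>\<^sup>+ d. \<integral>\<^sup>+ x. indicator {0<..} d * H i (d, x) \<partial>(\<Pi>\<^sub>M k\<in>preds E i. lborel) \<partial>lborel)"
proof -
  let ?NE = "\<Pi>\<^sub>M e\<in>lower_edges E. lborel :: real measure"
  let ?NV = "\<Pi>\<^sub>M i\<in>(UNIV :: 'n set). lborel :: real measure"
  let ?g = "\<lambda>\<theta>. \<Prod>i\<in>UNIV. H i (block_stat E (cov_of \<theta>) i)"
  interpret NE: product_sigma_finite "\<lambda>_::'n \<times> 'n. lborel :: real measure" by (rule product_sigma_finite_lborel)
  interpret NV: product_sigma_finite "\<lambda>_::'n. lborel :: real measure" by (rule product_sigma_finite_lborel)
  interpret sE: sigma_finite_measure ?NE by (intro NE.sigma_finite) simp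
  interpret sV: sigma_finite_measure ?NV by (intro NV.sigma_finite) simp
  interpret pair_sigma_finite ?NE ?NV ..
  \<comment> \<open>The indicators take over the restriction to \<open>Theta E\<close>: coordinates
    are mapped into it exactly when all \<open>d i\<close> are positive, while the edge coordinates
    are unconstrained.\<close>
  let ?h = "\<lambda>d i x. indicator {0<..} (d i) * H i (d i, x)"
  let ?K = "\<lambda>(y, d). \<Prod>i\<in>UNIV. ?h d i (\<lambda>k\<in>preds E i. y (i, k))"
  have sets_B: "sets (block_space E i) = sets (lborel \<Otimes>\<^sub>M (\<Pi>\<^sub>M k\<in>preds E i. lborel :: real measure))" for i
    by (intro sets_pair_measure_cong sets_PiM_cong) auto
  have H'[measurable]: "H i \<in> borel_measurable (lborel \<Otimes>\<^sub>M (\<Pi>\<^sub>M k\<in>preds E i. lborel :: real measure))" for i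
    using H[of i] by (subst measurable_cong_sets[OF sets_B[of i, symmetric] refl])
  have g: "?g \<in> borel_measurable (theta_measure E)"
    by (intro borel_measurable_prod_ennreal measurable_compose[OF measurable_compose[OF measurable_cov_of
            measurable_block_stat] H])
  have g': "(\<lambda>\<theta>. ?g \<theta> * indicator (Theta E) \<theta>) \<in> borel_measurable borel"
    using g unfolding theta_measure_def
    by (subst (asm) borel_measurable_restrict_space_iff_ennreal) (auto simp: Theta_measurable)
  have "(\<integral>\<^sup>+ \<theta>. ?g \<theta> \<partial>theta_measure E)
      = (\<integral>\<^sup>+ \<theta>. ?g \<theta> * indicator (Theta E) \<theta> \<partial>(distr (?NE \<Otimes>\<^sub>M ?NV) borel (theta_of_coords E)))"
    unfolding theta_measure_def by (subst nn_integral_restrict_space) (auto simp: Theta_measurable)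
  also have "\<dots> = (\<integral>\<^sup>+ x. ?g (theta_of_coords E x) * indicator (Theta E) (theta_of_coords E x) \<partial>(?NE \<Otimes>\<^sub>M ?NV))"
    by (rule nn_integral_distr[OF measurable_theta_of_coords]) (simp add: g')
  also have "\<dots> = (\<integral>\<^sup>+ x. ?K (\<lambda>e\<in>lower_edges E. regr E (fst x) (fst e) (snd e), snd x) \<partial>(?NE \<Otimes>\<^sub>M ?NV))"
  proof (rule nn_integral_cong)
    fix x :: "('n \<times> 'n \<Rightarrow> real) \<times> ('n \<Rightarrow> real)"
    obtain l d where x: "x = (l, d)" by (cases x)
    have row: "(\<lambda>k\<in>preds E i. (\<lambda>e\<in>lower_edges E. regr E l (fst e) (snd e)) (i, k)) = (\<lambda>k\<in>preds E i. regr E l i k)" for i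
      by (auto simp: lower_edges_eq)
    show "?g (theta_of_coords E x) * indicator (Theta E) (theta_of_coords E x)
        = ?K (\<lambda>e\<in>lower_edges E. regr E (fst x) (fst e) (snd e), snd x)"
    proof (cases "\<forall>i. 0 < d i")
      case True
      have "?g (theta_of_coords E x) = (\<Prod>i\<in>UNIV. H i (d i, \<lambda>k\<in>preds E i. regr E l i k))"
        by (simp only: x block_stat_coords[OF True])
      moreover have "theta_of_coords E x \<in> Theta E" using True by (simp add: x theta_of_coords_in_Theta_iff)
      ultimately show ?thesis using True unfolding x prod.case fst_conv snd_conv row by simp
    next
      case False
      then obtain i where "\<not> 0 < d i" by blast
      then have "(\<Prod>i\<in>UNIV. ?h d i (\<lambda>k\<in>preds E i. (\<lambda>e\<in>lower_edges E. regr E l (fst e) (snd e)) (i, k))) = 0"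
        by (intro prod_zero bexI[of _ i]) auto
      moreover have "theta_of_coords E x \<notin> Theta E" using False by (simp add: x theta_of_coords_in_Theta_iff)
      ultimately show ?thesis by (simp add: x)
    qed
  qed
  \<comment> \<open>The edge coordinates are integrated first, so that the change of variables
    applies with \<open>d\<close> as a fixed parameter.\<close>
  also have "\<dots> = (\<integral>\<^sup>+ d. \<integral>\<^sup>+ l. ?K (\<lambda>e\<in>lower_edges E. regr E l (fst e) (snd e), d) \<partial>?NE \<partial>?NV)"
  proof -
    have row: "(\<lambda>l. \<lambda>e\<in>lower_edges E. regr E l (fst e) (snd e)) \<in> ?NE \<rightarrow>\<^sub>M ?NE"
    proof (rule measurable_restrict)
      fix e assume "e \<in> lower_edges E"
      then have "snd e \<in> preds E (fst e)" by (auto simp: lower_edges_eq)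
      from borel_measurable_regr[OF this]
      show "(\<lambda>l. regr E l (fst e) (snd e)) \<in> ?NE \<rightarrow>\<^sub>M lborel" by simp
    qed
    have "?K \<in> borel_measurable (?NE \<Otimes>\<^sub>M ?NV)"
    proof -
      have [measurable]: "(\<lambda>y. \<lambda>k\<in>preds E i. y (i, k)) \<in> ?NE \<rightarrow>\<^sub>M (\<Pi>\<^sub>M k\<in>preds E i. lborel :: real measure)" for i
        by (rule measurable_PiM_lborel_block) (simp add: lower_edges_eq)
      have [measurable]: "(\<lambda>d. d i) \<in> ?NV \<rightarrow>\<^sub>M lborel" for i
        by (rule measurable_component_singleton) simp
      show ?thesis unfolding case_prod_unfold
        by (intro borel_measurable_prod_ennreal borel_measurable_times_ennreal) measurable
    qed
    then have "(\<lambda>x. ?K (\<lambda>e\<in>lower_edges E. regr E (fst x) (fst e) (snd e), snd x)) \<in> borel_measurable (?NE \<Otimes>\<^sub>M ?NV)"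
      by (intro measurable_compose[OF measurable_Pair[OF measurable_compose[OF measurable_fst row] measurable_snd]])
    from nn_integral_snd[OF this, symmetric] show ?thesis by (simp only: fst_conv snd_conv)
  qed
  also have "\<dots> = (\<integral>\<^sup>+ d. (\<Prod>i\<in>UNIV. \<integral>\<^sup>+ x. ?h d i x \<partial>(\<Pi>\<^sub>M k\<in>preds E i. lborel)) \<partial>?NV)"
  proof (rule nn_integral_cong)
    fix d :: "'n \<Rightarrow> real"
    have h: "?h d i \<in> borel_measurable (\<Pi>\<^sub>M k\<in>preds E i. lborel)" for i
      by measurable
    have "(\<integral>\<^sup>+ l. ?K (\<lambda>e\<in>lower_edges E. regr E l (fst e) (snd e), d) \<partial>?NE) = (\<integral>\<^sup>+ l. ?K (l, d) \<partial>?NE)"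
    proof (rule nn_integral_regr[where h = "\<lambda>l. ?K (l, d)"])
      show "(\<lambda>l. ?K (l, d)) \<in> borel_measurable ?NE"
        unfolding prod.case
        by (intro borel_measurable_prod_ennreal measurable_compose[OF measurable_PiM_lborel_block h])
           (simp add: lower_edges_eq)
    qed
    also have "\<dots> = (\<Prod>i\<in>UNIV. \<integral>\<^sup>+ x. ?h d i x \<partial>(\<Pi>\<^sub>M k\<in>preds E i. lborel))"
      unfolding prod.case lower_edges_eq by (intro nn_integral_PiM_lborel_rows h) auto
    finally show "(\<integral>\<^sup>+ l. ?K (\<lambda>e\<in>lower_edges E. regr E l (fst e) (snd e), d) \<partial>?NE)
      = (\<Prod>i\<in>UNIV. \<integral>\<^sup>+ x. ?h d i x \<partial>(\<Pi>\<^sub>M k\<in>preds E i. lborel))" .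
  qed
  also have "\<dots> = (\<Prod>i\<in>UNIV. \<integral>\<^sup>+ d. \<integral>\<^sup>+ x. indicator {0<..} d * H i (d, x) \<partial>(\<Pi>\<^sub>M k\<in>preds E i. lborel) \<partial>lborel)"
  proof (rule NV.product_nn_integral_prod)
    fix i
    interpret sigma_finite_measure "\<Pi>\<^sub>M k\<in>preds E i. lborel :: real measure" by (intro NV.sigma_finite) simp
    show "(\<lambda>d. \<integral>\<^sup>+ x. indicator {0<..} d * H i (d, x) \<partial>(\<Pi>\<^sub>M k\<in>preds E i. lborel)) \<in> borel_measurable lborel"
      by measurable
  qed simp
  finally show ?thesis .
qed

end

section \<open>A single vertex: normal law of the regression vector and inverse gamma law of the
  residual\<close>

context
  fixes E :: "('n::{finite,linorder} \<times> 'n) set" and U :: "'n sqmat" and \<alpha> :: "(real, 'n) vec"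
begin

abbreviation block_normal :: "'n \<Rightarrow> real \<Rightarrow> ('n \<Rightarrow> real) measure" where
  "block_normal i d \<equiv> mv_normal (preds E i) (pred_coef E U i) (d *\<^sub>R sub_inv (preds E i) U)"

abbreviation ig_shape :: "'n \<Rightarrow> real" where
  "ig_shape i \<equiv> \<alpha> $ i / 2 - real (card (preds E i)) / 2 - 1"

abbreviation ig_rate :: "'n \<Rightarrow> real" where
  "ig_rate i \<equiv> (U $ i $ i - pred_quad E U i) / 2"

abbreviation ig_kernel :: "'n \<Rightarrow> real \<Rightarrow> real" where
  "ig_kernel i d \<equiv> indicator {0<..} d * (d powr (- ig_shape i - 1) * exp (- ig_rate i / d))"

definition normal_kernel :: "'n \<Rightarrow> real \<Rightarrow> ('n \<Rightarrow> real) \<Rightarrow> real" where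
  "normal_kernel i d x =
     exp (- (1/2) * (\<Sum>k\<in>preds E i. \<Sum>l\<in>preds E i.
          (x k - pred_coef E U i k) * U $ k $ l * (x l - pred_coef E U i l)) / d)
        * sqrt (sub_det (preds E i) U / (2 * pi * d) ^ card (preds E i))"

text \<open>The Gaussian integral at \<open>d = 1\<close>; its dependence on \<open>d\<close> is
  moved into \<open>ig_kernel\<close>.\<close>

definition normal_const :: "'n \<Rightarrow> real" where
  "normal_const i = sqrt ((2 * pi) ^ card (preds E i) / sub_det (preds E i) U)"

definition block_integral :: "'n \<Rightarrow> (real \<times> ('n \<Rightarrow> real) \<Rightarrow> ennreal) \<Rightarrow> ennreal" where
  "block_integral i H = (\<integral>\<^sup>+ d. \<integral>\<^sup>+ x. indicator {0<..} d * (ennreal (block_kernel E U \<alpha> i (d, x)) * H (d, x))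
     \<partial>(\<Pi>\<^sub>M k\<in>preds E i. lborel) \<partial>lborel)"

text \<open>The claimed joint law of block \<open>i\<close> as an iterated integral: inverse gamma
  in \<open>d\<close>, then normal given \<open>d\<close>.\<close>

definition block_expectation :: "'n \<Rightarrow> (real \<times> ('n \<Rightarrow> real) \<Rightarrow> ennreal) \<Rightarrow> ennreal" where
  "block_expectation i H = (\<integral>\<^sup>+ d. ennreal (inverse_gamma_density (ig_shape i) (ig_rate i) d) *
     (\<integral>\<^sup>+ x. H (d, x) \<partial>block_normal i d) \<partial>lborel)"

text \<open>The random elements take values in \<open>borel\<close> components, while integrals are
  taken against \<open>lborel\<close>; this allows passing between the two.\<close>

lemma sets_block_space:
  "sets (block_space E i) = sets (lborel \<Otimes>\<^sub>M (\<Pi>\<^sub>M k\<in>preds E i. lborel :: real measure))"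
  by (intro sets_pair_measure_cong sets_PiM_cong) auto

lemma measurable_block_space_iff:
  "H \<in> borel_measurable (block_space E i) \<longleftrightarrow>
     H \<in> borel_measurable (lborel \<Otimes>\<^sub>M (\<Pi>\<^sub>M k\<in>preds E i. lborel :: real measure))"
  by (rule arg_cong[of _ _ "\<lambda>S. H \<in> S"]) (rule measurable_cong_sets[OF sets_block_space refl])

lemma borel_measurable_block_quadratic:
  "(\<lambda>(d :: real, x). \<Sum>k\<in>preds E i. \<Sum>l\<in>preds E i. (x k - \<mu> k) * U $ k $ l * (x l - \<mu> l))
    \<in> borel_measurable (block_space E i)"
proof -
  have [measurable]: "(\<lambda>y. snd y k :: real) \<in> borel_measurable (block_space E i)" if "k \<in> preds E i" for k
    using measurable_compose[OF measurable_snd measurable_component_singleton[OF that]] .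
  show ?thesis unfolding case_prod_unfold by (intro borel_measurable_sum) measurable
qed

lemma borel_measurable_block_kernel:
  "block_kernel E U \<alpha> i \<in> borel_measurable (block_space E i)"
proof -
  note [measurable] = borel_measurable_block_quadratic[unfolded case_prod_unfold]
  show ?thesis unfolding block_kernel_def case_prod_unfold by measurable
qed

lemma borel_measurable_normal_kernel:
  "(\<lambda>(d, x). normal_kernel i d x) \<in> borel_measurable (block_space E i)"
proof -
  note [measurable] = borel_measurable_block_quadratic[unfolded case_prod_unfold]
  show ?thesis unfolding normal_kernel_def case_prod_unfold by measurable
qed

context
  assumes U: "positive_definite U" and G: "hasse_graph E"
begin

lemma pd_preds: "pd_on (preds E i) U"
  using U by (rule positive_definite_imp_pd_on)

lemma sub_det_preds_pos: "0 < sub_det (preds E i) U"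
  by (intro sub_det_pos pd_preds) simp

lemma normal_const_pos: "0 < normal_const i"
  using sub_det_preds_pos[of i] by (simp add: normal_const_def)

lemma ig_rate_pos: "0 < ig_rate i"
  using hasse_graph.residual_pos[OF G U, of i] by simp

lemma block_normal_eq:
  assumes "0 < d"
  shows "block_normal i d = density (\<Pi>\<^sub>M k\<in>preds E i. lborel) (\<lambda>x. ennreal (normal_kernel i d x))"
  unfolding mv_normal_eq[OF pd_preds assms] normal_kernel_def ..

text \<open>Origin of the shape, with \<open>n\<close> the number of predecessors: the kernel
  carries \<open>d powr (- \<alpha>_i / 2)\<close>, and the normalised Gaussian takes
  \<open>d powr (- n / 2)\<close> of it. The remaining exponent
  \<open>- (\<alpha>_i - n) / 2\<close> equals \<open>- ig_shape i - 1\<close>.\<close>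

lemma block_kernel_factor:
  assumes d: "0 < d"
  shows "block_kernel E U \<alpha> i (d, x) = normal_const i * ig_kernel i d * normal_kernel i d x"
proof -
  let ?n = "card (preds E i)" and ?q = "\<Sum>k\<in>preds E i. \<Sum>l\<in>preds E i.
          (x k - pred_coef E U i k) * U $ k $ l * (x l - pred_coef E U i l)"
  have "normal_const i * sqrt (sub_det (preds E i) U / (2 * pi * d) ^ ?n) = sqrt (1 / d ^ ?n)"
    using d sub_det_preds_pos[of i]
    by (simp add: normal_const_def real_sqrt_mult[symmetric] power_mult_distrib)
  also have "\<dots> = d powr (- (real ?n / 2))"
  proof -
    have "1 / d ^ ?n = d powr (- real ?n)" using d by (simp add: powr_minus_divide powr_realpow)
    then have "sqrt (1 / d ^ ?n) = (d powr (- real ?n)) powr (1 / 2)" by (simp add: powr_half_sqrt)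
    then show ?thesis by (simp only: powr_powr) simp
  qed
  finally have c: "normal_const i * sqrt (sub_det (preds E i) U / (2 * pi * d) ^ ?n) = d powr (- (real ?n / 2))" .
  have "normal_const i * ig_kernel i d * normal_kernel i d x
      = (normal_const i * sqrt (sub_det (preds E i) U / (2 * pi * d) ^ ?n)) * d powr (- ig_shape i - 1) *
        exp (- ig_rate i / d) * exp (- (1/2) * ?q / d)"
    using d by (simp add: normal_kernel_def)
  also have "\<dots> = d powr (- (real ?n / 2) + (- ig_shape i - 1)) * exp (- ig_rate i / d) * exp (- (1/2) * ?q / d)"
    unfolding c powr_add ..
  also have "- (real ?n / 2) + (- ig_shape i - 1) = - (\<alpha> $ i / 2)" by (simp add: field_simps)
  also have "d powr (- (\<alpha> $ i / 2)) = exp (- (\<alpha> $ i / 2) * ln d)" using d by (simp add: powr_def)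
  also have "exp (- (\<alpha> $ i / 2) * ln d) * exp (- ig_rate i / d) * exp (- (1/2) * ?q / d)
      = exp (- (\<alpha> $ i / 2) * ln d + - ig_rate i / d + - (1/2) * ?q / d)"
    by (simp only: exp_add)
  also have "- (\<alpha> $ i / 2) * ln d + - ig_rate i / d + - (1/2) * ?q / d
     = - (1/2) * ((?q + (U $ i $ i - pred_quad E U i)) / d + \<alpha> $ i * ln d)"
    using d by (simp add: field_simps)
  finally show ?thesis by (simp only: block_kernel_def prod.case)
qed

lemma nn_integral_block_normal:
  assumes H: "H \<in> borel_measurable (block_space E i)" and d: "0 < d"
  shows "(\<integral>\<^sup>+ x. H (d, x) \<partial>block_normal i d) =
    (\<integral>\<^sup>+ x. ennreal (normal_kernel i d x) * H (d, x) \<partial>(\<Pi>\<^sub>M k\<in>preds E i. lborel))"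
proof -
  note [measurable] = H[unfolded measurable_block_space_iff]
    borel_measurable_normal_kernel[of i, unfolded measurable_block_space_iff]
  have "(\<lambda>x. H (d, x)) \<in> borel_measurable (\<Pi>\<^sub>M k\<in>preds E i. lborel)" by measurable
  moreover have "(\<lambda>x. normal_kernel i d x) \<in> borel_measurable (\<Pi>\<^sub>M k\<in>preds E i. lborel)"
    using measurable_Pair2[OF borel_measurable_normal_kernel[of i, unfolded measurable_block_space_iff], of d]
    by simp
  ultimately show ?thesis unfolding block_normal_eq[OF d] by (intro nn_integral_density) auto
qed

text \<open>The measure itself varies with \<open>d\<close>. For \<open>0 < d\<close> it has a
  jointly measurable density against a fixed sigma-finite measure, so measurability of parameter
  integrals applies; the indicator removes the other \<open>d\<close>.\<close>

lemma measurable_nn_integral_block_normal: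
  assumes H: "H \<in> borel_measurable (block_space E i)"
  shows "(\<lambda>d. indicator {0<..} d * (\<integral>\<^sup>+ x. H (d, x) \<partial>block_normal i d)) \<in> borel_measurable borel"
proof -
  interpret product_sigma_finite "\<lambda>_::'n. lborel :: real measure" by (rule product_sigma_finite_lborel)
  interpret sigma_finite_measure "\<Pi>\<^sub>M k\<in>preds E i. lborel :: real measure" by (intro sigma_finite) simp
  note [measurable] = H[unfolded measurable_block_space_iff]
    borel_measurable_normal_kernel[of i, unfolded measurable_block_space_iff]
  have "(\<lambda>(d, x). ennreal (normal_kernel i d x) * H (d, x))
      \<in> borel_measurable (lborel \<Otimes>\<^sub>M (\<Pi>\<^sub>M k\<in>preds E i. lborel :: real measure))"
    by measurable
  from borel_measurable_nn_integral[OF this]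
  have "(\<lambda>d. indicator {0<..} d * (\<integral>\<^sup>+ x. ennreal (normal_kernel i d x) * H (d, x) \<partial>(\<Pi>\<^sub>M k\<in>preds E i. lborel)))
      \<in> borel_measurable borel"
    by simp
  then show ?thesis
    by (rule measurable_cong[THEN iffD1, rotated])
       (auto simp: indicator_def nn_integral_block_normal[OF H])
qed

lemma block_integral_eq:
  assumes H: "H \<in> borel_measurable (block_space E i)"
  shows "block_integral i H = ennreal (normal_const i) *
    (\<integral>\<^sup>+ d. ennreal (ig_kernel i d) * (\<integral>\<^sup>+ x. H (d, x) \<partial>block_normal i d) \<partial>lborel)"
proof -
  note [measurable] = H[unfolded measurable_block_space_iff]
    borel_measurable_normal_kernel[of i, unfolded measurable_block_space_iff]
    measurable_nn_integral_block_normal[OF H]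
  have "block_integral i H = (\<integral>\<^sup>+ d. ennreal (normal_const i) *
      (ennreal (ig_kernel i d) * (indicator {0<..} d * (\<integral>\<^sup>+ x. H (d, x) \<partial>block_normal i d))) \<partial>lborel)"
    unfolding block_integral_def
  proof (rule nn_integral_cong)
    fix d :: real
    show "(\<integral>\<^sup>+ x. indicator {0<..} d * (ennreal (block_kernel E U \<alpha> i (d, x)) * H (d, x)) \<partial>(\<Pi>\<^sub>M k\<in>preds E i. lborel))
      = ennreal (normal_const i) *
        (ennreal (ig_kernel i d) * (indicator {0<..} d * (\<integral>\<^sup>+ x. H (d, x) \<partial>block_normal i d)))"
    proof (cases "0 < d")
      case True
      have nk: "0 \<le> normal_kernel i d x" for x
        using sub_det_preds_pos[of i] True by (simp add: normal_kernel_def)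
      have "(\<integral>\<^sup>+ x. indicator {0<..} d * (ennreal (block_kernel E U \<alpha> i (d, x)) * H (d, x)) \<partial>(\<Pi>\<^sub>M k\<in>preds E i. lborel))
        = (\<integral>\<^sup>+ x. ennreal (normal_const i * ig_kernel i d) * (ennreal (normal_kernel i d x) * H (d, x))
            \<partial>(\<Pi>\<^sub>M k\<in>preds E i. lborel))"
        using True nk normal_const_pos[of i]
        by (intro nn_integral_cong) (simp add: block_kernel_factor ennreal_mult mult.assoc)
      also have "\<dots> = ennreal (normal_const i * ig_kernel i d) * (\<integral>\<^sup>+ x. H (d, x) \<partial>block_normal i d)"
        unfolding nn_integral_block_normal[OF H True] by (rule nn_integral_cmult) measurable
      finally show ?thesis using True normal_const_pos[of i] by (simp add: ennreal_mult mult.assoc)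
    qed simp
  qed
  also have "\<dots> = ennreal (normal_const i) * (\<integral>\<^sup>+ d. ennreal (ig_kernel i d) *
      (indicator {0<..} d * (\<integral>\<^sup>+ x. H (d, x) \<partial>block_normal i d)) \<partial>lborel)"
    by (rule nn_integral_cmult) measurable
  also have "(\<integral>\<^sup>+ d. ennreal (ig_kernel i d) * (indicator {0<..} d * (\<integral>\<^sup>+ x. H (d, x) \<partial>block_normal i d)) \<partial>lborel)
      = (\<integral>\<^sup>+ d. ennreal (ig_kernel i d) * (\<integral>\<^sup>+ x. H (d, x) \<partial>block_normal i d) \<partial>lborel)"
    by (intro nn_integral_cong) (auto simp: indicator_def)
  finally show ?thesis .
qed

lemma emeasure_block_normal_space:
  assumes "0 < d"
  shows "(\<integral>\<^sup>+ x. 1 \<partial>block_normal i d) = 1"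
  using prob_space.emeasure_space_1[OF prob_space_mv_normal[OF pd_preds assms]] by simp

lemma block_integral_1:
  "block_integral i (\<lambda>_. 1) = ennreal (normal_const i) * (\<integral>\<^sup>+ d. ennreal (ig_kernel i d) \<partial>lborel)"
proof -
  have "(\<integral>\<^sup>+ d. ennreal (ig_kernel i d) * (\<integral>\<^sup>+ x. 1 \<partial>block_normal i d) \<partial>lborel) = (\<integral>\<^sup>+ d. ennreal (ig_kernel i d) \<partial>lborel)"
  proof (rule nn_integral_cong)
    fix d :: real
    show "ennreal (ig_kernel i d) * (\<integral>\<^sup>+ x. 1 \<partial>block_normal i d) = ennreal (ig_kernel i d)"
      by (cases "0 < d") (simp_all only: emeasure_block_normal_space mult_1_right, simp)
  qed
  then show ?thesis by (subst block_integral_eq) simp_all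
qed

lemma ig_kernel_integral:
  assumes "0 < ig_shape i"
  shows "(\<integral>\<^sup>+ d. ennreal (ig_kernel i d) \<partial>lborel) = ennreal (Gamma (ig_shape i) / ig_rate i powr ig_shape i)"
  by (rule nn_integral_inverse_gamma[OF assms ig_rate_pos])

lemma block_integral_finite_imp:
  assumes "block_integral i (\<lambda>_. 1) < \<infinity>"
  shows "0 < ig_shape i"
proof -
  have "ennreal (normal_const i) * (\<integral>\<^sup>+ d. ennreal (ig_kernel i d) \<partial>lborel) < \<infinity>"
    using assms by (simp only: block_integral_1)
  then have "(\<integral>\<^sup>+ d. ennreal (ig_kernel i d) \<partial>lborel) < \<infinity>"
    using normal_const_pos[of i] by (auto simp: ennreal_mult_less_top less_top[symmetric])
  then show ?thesis by (rule inverse_gamma_integrable_imp_pos[OF ig_rate_pos])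
qed

text \<open>If the integral vanished it would be finite, so the shape would be positive and the
  explicit Gamma value would apply, which is positive. Thus nonvanishing is available before
  finiteness is known.\<close>

lemma block_integral_pos: "block_integral i (\<lambda>_. 1) \<noteq> 0"
proof
  assume 0: "block_integral i (\<lambda>_. 1) = 0"
  then have a: "0 < ig_shape i" by (intro block_integral_finite_imp) simp
  then have "0 < normal_const i * (Gamma (ig_shape i) / ig_rate i powr ig_shape i)"
    using ig_rate_pos[of i] normal_const_pos[of i] Gamma_real_pos[OF a]
    by (intro mult_pos_pos divide_pos_pos) auto
  moreover have "block_integral i (\<lambda>_. 1) = ennreal (normal_const i * (Gamma (ig_shape i) / ig_rate i powr ig_shape i))"
    unfolding block_integral_1 ig_kernel_integral[OF a]
    using normal_const_pos[of i] by (simp only: ennreal_mult'[OF less_imp_le])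
  ultimately show False using 0 by (metis ennreal_eq_0_iff not_le)
qed

lemma block_integral_normalise:
  assumes a: "0 < ig_shape i" and H: "H \<in> borel_measurable (block_space E i)"
  shows "block_integral i H = block_integral i (\<lambda>_. 1) * block_expectation i H"
proof -
  let ?c = "Gamma (ig_shape i) / ig_rate i powr ig_shape i"
  have c: "0 < ?c" using ig_rate_pos[of i] Gamma_real_pos[OF a] by (intro divide_pos_pos) auto
  have dens: "ig_kernel i d = ?c * inverse_gamma_density (ig_shape i) (ig_rate i) d" for d
    using c by (auto simp: inverse_gamma_density_def indicator_def)
  have nonneg: "0 \<le> inverse_gamma_density (ig_shape i) (ig_rate i) d" for d
    using Gamma_real_pos[OF a] by (simp add: inverse_gamma_density_def)
  note [measurable] = measurable_nn_integral_block_normal[OF H]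
  have meas: "(\<lambda>d. ennreal (inverse_gamma_density (ig_shape i) (ig_rate i) d) *
      (\<integral>\<^sup>+ x. H (d, x) \<partial>block_normal i d)) \<in> borel_measurable lborel"
  proof -
    have [measurable]: "inverse_gamma_density (ig_shape i) (ig_rate i) \<in> borel_measurable borel"
      unfolding inverse_gamma_density_def[abs_def] by measurable
    have "(\<lambda>d. ennreal (inverse_gamma_density (ig_shape i) (ig_rate i) d) *
      (indicator {0<..} d * (\<integral>\<^sup>+ x. H (d, x) \<partial>block_normal i d))) \<in> borel_measurable lborel"
      by measurable
    then show ?thesis
      by (rule measurable_cong[THEN iffD1, rotated]) (auto simp: inverse_gamma_density_def indicator_def)
  qed
  have "(\<integral>\<^sup>+ d. ennreal (ig_kernel i d) * (\<integral>\<^sup>+ x. H (d, x) \<partial>block_normal i d) \<partial>lborel)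
      = (\<integral>\<^sup>+ d. ennreal ?c * (ennreal (inverse_gamma_density (ig_shape i) (ig_rate i) d) *
          (\<integral>\<^sup>+ x. H (d, x) \<partial>block_normal i d)) \<partial>lborel)"
    unfolding dens using c nonneg by (simp only: ennreal_mult[OF less_imp_le nonneg] mult.assoc)
  also have "\<dots> = ennreal ?c * block_expectation i H"
    unfolding block_expectation_def by (rule nn_integral_cmult[OF meas])
  finally show ?thesis
    unfolding block_integral_eq[OF H] block_integral_1 ig_kernel_integral[OF a] by (simp only: mult.assoc)
qed

lemma block_expectation_fst:
  "block_expectation i (\<lambda>(d, x). f d) =
    (\<integral>\<^sup>+ d. ennreal (inverse_gamma_density (ig_shape i) (ig_rate i) d) * f d \<partial>lborel)"
  unfolding block_expectation_def
proof (rule nn_integral_cong)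
  fix d :: real
  show "ennreal (inverse_gamma_density (ig_shape i) (ig_rate i) d) * (\<integral>\<^sup>+ x. (case (d, x) of (d, x) \<Rightarrow> f d) \<partial>block_normal i d)
      = ennreal (inverse_gamma_density (ig_shape i) (ig_rate i) d) * f d"
  proof (cases "0 < d")
    case True
    have "(\<integral>\<^sup>+ x. f d \<partial>block_normal i d) = f d"
      using prob_space.emeasure_space_1[OF prob_space_mv_normal[OF pd_preds True]] by simp
    then show ?thesis by simp
  qed (simp add: inverse_gamma_density_def)
qed

text \<open>The total mass follows by cancelling the finite nonzero factor in
  \<open>block_integral_normalise\<close> for the constant 1.\<close>

lemma block_expectation_1:
  assumes a: "0 < ig_shape i" and fin: "block_integral i (\<lambda>_. 1) < \<infinity>"
  shows "block_expectation i (\<lambda>_. 1) = 1"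
proof -
  have "block_integral i (\<lambda>_. 1) * block_expectation i (\<lambda>_. 1) = block_integral i (\<lambda>_. 1) * 1"
    using block_integral_normalise[OF a, of "\<lambda>_. 1"] by simp
  then show ?thesis
    using block_integral_pos[of i] fin by (subst (asm) ennreal_mult_cancel_left) auto
qed

end

end

text \<open>The normalising constant is the product of the one-vertex integrals. It cancels vertex
  by vertex, leaving a law under which the blocks factorise for arbitrary nonnegative test
  functions.\<close>

lemma nn_integral_blocks:
  fixes E :: "('n::{finite,linorder} \<times> 'n) set" and U :: "'n sqmat" and \<alpha> :: "(real, 'n) vec"
  assumes G: "hasse_graph E" and U: "positive_definite U" and z: "z_const E U \<alpha> < \<infinity>"
  shows "0 < \<alpha> $ i / 2 - real (card (preds E i)) / 2 - 1"
    and "block_integral E U \<alpha> i (\<lambda>_. 1) < \<infinity>"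
    and "(\<And>i. H i \<in> borel_measurable (block_space E i)) \<Longrightarrow>
      (\<integral>\<^sup>+ S. (\<Prod>i\<in>UNIV. H i (block_stat E S i)) \<partial>pi_P E U \<alpha>) = (\<Prod>i\<in>UNIV. block_expectation E U \<alpha> i (H i))"
proof -
  interpret hasse_graph E by fact
  let ?F = "\<lambda>i y. ennreal (block_kernel E U \<alpha> i y)"
  have kernel: "ennreal (kernel_density U \<alpha> \<theta>) = (\<Prod>i\<in>UNIV. ?F i (block_stat E (cov_of \<theta>) i))"
    if "\<theta> \<in> space (theta_measure E)" for \<theta>
  proof -
    obtain L D where \<theta>: "\<theta> = (L, D)" by (cases \<theta>)
    then have "(L, D) \<in> Theta E" using that by (simp add: space_theta_measure)
    from kernel_density_eq_prod[OF this U, of \<alpha>]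
    have "kernel_density U \<alpha> \<theta> = (\<Prod>i\<in>UNIV. block_kernel E U \<alpha> i (block_stat E (cov_of \<theta>) i))"
      by (simp only: \<theta> prod.case)
    moreover have "0 \<le> block_kernel E U \<alpha> i y" for i y
      by (simp add: block_kernel_def case_prod_unfold)
    ultimately show ?thesis by (simp only: prod_ennreal)
  qed
  have F: "?F i \<in> borel_measurable (block_space E i)" for i
    using borel_measurable_block_kernel[of E U \<alpha> i] by measurable
  have stat: "(\<lambda>\<theta>. block_stat E (cov_of \<theta>) i) \<in> theta_measure E \<rightarrow>\<^sub>M block_space E i" for i
    by (rule measurable_compose[OF measurable_cov_of measurable_block_stat])
  have z_eq: "z_const E U \<alpha> = (\<Prod>i\<in>UNIV. block_integral E U \<alpha> i (\<lambda>_. 1))"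
  proof -
    have "z_const E U \<alpha> = (\<integral>\<^sup>+ \<theta>. (\<Prod>i\<in>UNIV. ?F i (block_stat E (cov_of \<theta>) i)) \<partial>theta_measure E)"
      unfolding z_const_def by (intro nn_integral_cong kernel)
    also have "\<dots> = (\<Prod>i\<in>UNIV. block_integral E U \<alpha> i (\<lambda>_. 1))"
      unfolding nn_integral_theta_measure[OF F] block_integral_def by simp
    finally show ?thesis .
  qed
  have nz: "block_integral E U \<alpha> i (\<lambda>_. 1) \<noteq> 0" for i
    by (rule block_integral_pos[OF U G])
  show fin: "block_integral E U \<alpha> i (\<lambda>_. 1) < \<infinity>" for i
  proof (rule ccontr)
    assume "\<not> block_integral E U \<alpha> i (\<lambda>_. 1) < \<infinity>"
    then have "\<exists>i\<in>UNIV. block_integral E U \<alpha> i (\<lambda>_. 1) = top" by (auto simp: less_top[symmetric])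
    \<comment> \<open>In \<open>ennreal\<close> one has \<open>0 * top = 0\<close>; the infinite
      factor dominates because no factor is zero.\<close>
    then have "z_const E U \<alpha> = top" unfolding z_eq ennreal_prod_eq_top using nz by simp
    then show False using z by simp
  qed
  show a: "0 < \<alpha> $ i / 2 - real (card (preds E i)) / 2 - 1" for i
    by (rule block_integral_finite_imp[OF U G fin])
  assume H: "\<And>i. H i \<in> borel_measurable (block_space E i)"
  have FH: "(\<lambda>y. ?F i y * H i y) \<in> borel_measurable (block_space E i)" for i
    by (intro borel_measurable_times_ennreal F H)
  let ?g = "\<lambda>S. \<Prod>i\<in>UNIV. H i (block_stat E S i)"
  have g: "?g \<in> borel_measurable (P_algebra E)"
    by (intro borel_measurable_prod_ennreal measurable_compose[OF measurable_block_stat H])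
  have cov: "cov_of \<in> pi_Theta E U \<alpha> \<rightarrow>\<^sub>M P_algebra E"
    unfolding pi_Theta_def by (subst measurable_density_eq1) (rule measurable_cov_of)
  have dens: "(\<lambda>\<theta>. ennreal (kernel_density U \<alpha> \<theta>) / z_const E U \<alpha>) \<in> borel_measurable (theta_measure E)"
  proof -
    have "(\<lambda>\<theta>. \<Prod>i\<in>UNIV. ?F i (block_stat E (cov_of \<theta>) i)) \<in> borel_measurable (theta_measure E)"
      by (intro borel_measurable_prod_ennreal measurable_compose[OF stat F])
    then have "(\<lambda>\<theta>. ennreal (kernel_density U \<alpha> \<theta>)) \<in> borel_measurable (theta_measure E)"
      by (rule measurable_cong[THEN iffD2, rotated]) (rule kernel)
    then show ?thesis by measurable
  qed
  have "(\<integral>\<^sup>+ S. ?g S \<partial>pi_P E U \<alpha>) = (\<integral>\<^sup>+ \<theta>. ?g (cov_of \<theta>) \<partial>pi_Theta E U \<alpha>)"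
    unfolding pi_P_def by (rule nn_integral_distr[OF cov]) (simp add: g)
  also have "\<dots> = (\<integral>\<^sup>+ \<theta>. ennreal (kernel_density U \<alpha> \<theta>) / z_const E U \<alpha> * ?g (cov_of \<theta>) \<partial>theta_measure E)"
    unfolding pi_Theta_def
    by (rule nn_integral_density[OF dens measurable_compose[OF measurable_cov_of g]])
  also have "\<dots> = (\<integral>\<^sup>+ \<theta>. (\<Prod>i\<in>UNIV. ?F i (block_stat E (cov_of \<theta>) i) * H i (block_stat E (cov_of \<theta>) i))
      / z_const E U \<alpha> \<partial>theta_measure E)"
    by (intro nn_integral_cong) (simp only: kernel prod.distrib ennreal_divide_times ennreal_times_divide)
  also have "\<dots> = (\<integral>\<^sup>+ \<theta>. (\<Prod>i\<in>UNIV. ?F i (block_stat E (cov_of \<theta>) i) * H i (block_stat E (cov_of \<theta>) i))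
      \<partial>theta_measure E) / z_const E U \<alpha>"
    by (intro nn_integral_divide borel_measurable_prod_ennreal measurable_compose[OF stat FH])
  also have "(\<integral>\<^sup>+ \<theta>. (\<Prod>i\<in>UNIV. ?F i (block_stat E (cov_of \<theta>) i) * H i (block_stat E (cov_of \<theta>) i))
      \<partial>theta_measure E) = (\<Prod>i\<in>UNIV. block_integral E U \<alpha> i (H i))"
    unfolding nn_integral_theta_measure[OF FH] block_integral_def ..
  also have "\<dots> = (\<Prod>i\<in>UNIV. block_integral E U \<alpha> i (\<lambda>_. 1) * block_expectation E U \<alpha> i (H i))"
    by (intro prod.cong refl block_integral_normalise[OF U G a H])
  also have "\<dots> = (\<Prod>i\<in>UNIV. block_expectation E U \<alpha> i (H i)) * z_const E U \<alpha>"
    unfolding z_eq prod.distrib by (rule mult.commute)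
  also have "\<dots> / z_const E U \<alpha> = (\<Prod>i\<in>UNIV. block_expectation E U \<alpha> i (H i))"
  proof (rule mult_divide_eq_ennreal)
    show "z_const E U \<alpha> \<noteq> 0" unfolding z_eq using nz by simp
    show "z_const E U \<alpha> \<noteq> top" using z by simp
  qed
  finally show "(\<integral>\<^sup>+ S. ?g S \<partial>pi_P E U \<alpha>) = (\<Prod>i\<in>UNIV. block_expectation E U \<alpha> i (H i))" .
qed

theorem theorem3:
  fixes E :: "('n::{finite,linorder} \<times> 'n) set"
    and U :: "'n sqmat"
    and \<alpha> :: "(real, 'n) vec"
    and M :: "'w measure"
    and \<Sigma> L D :: "'w \<Rightarrow> 'n sqmat"
  assumes "sym E" and "irrefl E"
    and "homogeneous E"
    and "hasse_ordered E"
    and "positive_definite U"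
    and "\<And>i. 0 \<le> \<alpha> $ i"
    and "z_const E U \<alpha> < \<infinity>"
    and "prob_space M"
    and "\<Sigma> \<in> M \<rightarrow>\<^sub>M P_algebra E"
    and "distr M (P_algebra E) \<Sigma> = pi_P E U \<alpha>"
    and "\<And>\<omega>. \<omega> \<in> space M \<Longrightarrow> modified_cholesky (\<Sigma> \<omega>) (L \<omega>) (D \<omega>)"
  shows "prob_space.indep_vars M
           (\<lambda>i. borel \<Otimes>\<^sub>M (\<Pi>\<^sub>M k\<in>preds E i. borel))
           (\<lambda>i \<omega>. (D \<omega> $ i $ i, pred_coef E (\<Sigma> \<omega>) i)) UNIV
       \<and> (\<forall>i. has_conditional_law M
                (\<lambda>\<omega>. pred_coef E (\<Sigma> \<omega>) i) (\<Pi>\<^sub>M k\<in>preds E i. borel)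
                (\<lambda>\<omega>. D \<omega> $ i $ i) borel
                (\<lambda>d. mv_normal (preds E i) (pred_coef E U i) (d *\<^sub>R sub_inv (preds E i) U)))
       \<and> (\<forall>i. distributed M lborel (\<lambda>\<omega>. D \<omega> $ i $ i)
                (\<lambda>x. ennreal (inverse_gamma_density
                   (\<alpha> $ i / 2 - real (card (preds E i)) / 2 - 1)
                   ((U $ i $ i - pred_quad E U i) / 2) x)))"
proof -
  interpret hasse_graph E by standard (use assms(1-4) in auto)
  have G: "hasse_graph E" ..
  interpret prob_space M by fact
  note U = assms(5) and \<Sigma> = assms(9)
  let ?X = "\<lambda>i \<omega>. (D \<omega> $ i $ i, pred_coef E (\<Sigma> \<omega>) i)"
  let ?ig = "\<lambda>i x. inverse_gamma_density (\<alpha> $ i / 2 - real (card (preds E i)) / 2 - 1)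
                   ((U $ i $ i - pred_quad E U i) / 2) x"
  let ?K = "\<lambda>i d. mv_normal (preds E i) (pred_coef E U i) (d *\<^sub>R sub_inv (preds E i) U)"
  note a = nn_integral_blocks(1)[OF G U assms(7)] and fin = nn_integral_blocks(2)[OF G U assms(7)]
  \<comment> \<open>\<open>modified_cholesky\<close> says nothing about the zeros of
    \<open>L\<close>. They are inherited from the covariance, after which
    \<open>block_stat_cov\<close> applies.\<close>
  have \<Theta>: "(L \<omega>, D \<omega>) \<in> Theta E" if "\<omega> \<in> space M" for \<omega>
    using measurable_space[OF \<Sigma> that] assms(11)[OF that]
    by (intro cholesky_in_Theta) (auto simp: P_algebra_def space_restrict_space)
  have X_eq: "?X i \<omega> = block_stat E (\<Sigma> \<omega>) i" if "\<omega> \<in> space M" for i \<omega>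
  proof -
    have "\<Sigma> \<omega> = L \<omega> ** D \<omega> ** transpose (L \<omega>)"
      using assms(11)[OF that] by (simp add: modified_cholesky_def)
    with block_stat_cov[OF \<Theta>[OF that], of i] show ?thesis by (simp add: block_stat_def)
  qed
  \<comment> \<open>On the space of \<open>M\<close> the pair is \<open>block_stat\<close> of the
    covariance, so measurability of \<open>D_ii\<close> comes from that of
    \<open>\<Sigma>\<close>.\<close>
  have X[measurable]: "?X i \<in> M \<rightarrow>\<^sub>M block_space E i" for i
    using measurable_compose[OF \<Sigma> measurable_block_stat]
    by (subst measurable_cong[OF X_eq]) auto
  have Dm[measurable]: "(\<lambda>\<omega>. D \<omega> $ i $ i) \<in> borel_measurable M" for i
    using measurable_compose[OF X measurable_fst] by simp
  have Cm[measurable]: "(\<lambda>\<omega>. pred_coef E (\<Sigma> \<omega>) i) \<in> M \<rightarrow>\<^sub>M (\<Pi>\<^sub>M k\<in>preds E i. borel)" for i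
    using measurable_compose[OF X measurable_snd] by simp
  \<comment> \<open>The source of all three claims: indicators of boxes give independence, and a
    single nontrivial factor gives the law of one block.\<close>
  have joint: "(\<integral>\<^sup>+ \<omega>. (\<Prod>i\<in>UNIV. H i (?X i \<omega>)) \<partial>M) = (\<Prod>i\<in>UNIV. block_expectation E U \<alpha> i (H i))"
    if H: "\<And>i. H i \<in> borel_measurable (block_space E i)" for H
  proof -
    have "(\<integral>\<^sup>+ \<omega>. (\<Prod>i\<in>UNIV. H i (?X i \<omega>)) \<partial>M) = (\<integral>\<^sup>+ \<omega>. (\<Prod>i\<in>UNIV. H i (block_stat E (\<Sigma> \<omega>) i)) \<partial>M)"
      by (intro nn_integral_cong) (simp only: X_eq)
    also have "\<dots> = (\<integral>\<^sup>+ S. (\<Prod>i\<in>UNIV. H i (block_stat E S i)) \<partial>distr M (P_algebra E) \<Sigma>)"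
      by (rule nn_integral_distr[OF \<Sigma>, symmetric])
         (simp, intro borel_measurable_prod_ennreal measurable_compose[OF measurable_block_stat H])
    finally show ?thesis using nn_integral_blocks(3)[OF G U assms(7) H] by (simp only: assms(10))
  qed
  have marginal: "(\<integral>\<^sup>+ \<omega>. h (?X i \<omega>) \<partial>M) = block_expectation E U \<alpha> i h"
    if h: "h \<in> borel_measurable (block_space E i)" for h i
  proof -
    \<comment> \<open>The other vertices are tested with the constant 1, whose
      \<open>block_expectation\<close> is 1.\<close>
    let ?H = "\<lambda>j. if j = i then h else (\<lambda>_. 1)"
    have "(\<integral>\<^sup>+ \<omega>. (\<Prod>j\<in>UNIV. ?H j (?X j \<omega>)) \<partial>M) = (\<Prod>j\<in>UNIV. block_expectation E U \<alpha> j (?H j))"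
      using h by (intro joint) auto
    also have "\<dots> = (\<Prod>j\<in>UNIV. if j = i then block_expectation E U \<alpha> i h else 1)"
      by (intro prod.cong refl) (simp add: block_expectation_1[OF U G a fin])
    also have "\<dots> = block_expectation E U \<alpha> i h" by simp
    also have "(\<integral>\<^sup>+ \<omega>. (\<Prod>j\<in>UNIV. ?H j (?X j \<omega>)) \<partial>M) = (\<integral>\<^sup>+ \<omega>. (\<Prod>j\<in>UNIV. if j = i then h (?X i \<omega>) else 1) \<partial>M)"
      by (intro nn_integral_cong prod.cong refl) simp
    finally show ?thesis by simp
  qed
  have indep: "indep_vars (\<lambda>i. block_space E i) ?X UNIV"
  proof (subst indep_vars_iff_distr_eq_PiM')
    interpret Q: product_sigma_finite "\<lambda>i. distr M (block_space E i) (?X i)"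
      by (intro product_sigma_finite.intro finite_measure.sigma_finite_measure
          prob_space.finite_measure prob_space_distr X)
    show "distr M (\<Pi>\<^sub>M i\<in>UNIV. block_space E i) (\<lambda>\<omega>. \<lambda>i\<in>UNIV. ?X i \<omega>)
        = (\<Pi>\<^sub>M i\<in>UNIV. distr M (block_space E i) (?X i))"
    proof (rule Q.PiM_eqI)
      fix A assume "\<And>i. i \<in> UNIV \<Longrightarrow> A i \<in> sets (distr M (block_space E i) (?X i))"
      then have A: "A i \<in> sets (block_space E i)" for i by simp
      have Xm: "(\<lambda>\<omega>. \<lambda>i\<in>UNIV. ?X i \<omega>) \<in> M \<rightarrow>\<^sub>M (\<Pi>\<^sub>M i\<in>UNIV. block_space E i)"
        by (intro measurable_restrict X)
      have PA: "Pi\<^sub>E UNIV A \<in> sets (\<Pi>\<^sub>M i\<in>UNIV. block_space E i)"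
        using A by (intro sets_PiM_I_finite) auto
      have "emeasure (distr M (\<Pi>\<^sub>M i\<in>UNIV. block_space E i) (\<lambda>\<omega>. \<lambda>i\<in>UNIV. ?X i \<omega>)) (Pi\<^sub>E UNIV A)
          = (\<integral>\<^sup>+ \<omega>. indicator (Pi\<^sub>E UNIV A) (\<lambda>i\<in>UNIV. ?X i \<omega>) \<partial>M)"
        using Xm PA by (simp only: nn_integral_indicator[symmetric] sets_distr nn_integral_distr[OF Xm] borel_measurable_indicator)
      also have "\<dots> = (\<integral>\<^sup>+ \<omega>. (\<Prod>i\<in>UNIV. indicator (A i) (?X i \<omega>)) \<partial>M)"
      proof (rule nn_integral_cong)
        fix \<omega>
        show "(indicator (Pi\<^sub>E UNIV A) (\<lambda>i\<in>UNIV. ?X i \<omega>) :: ennreal) = (\<Prod>i\<in>UNIV. indicator (A i) (?X i \<omega>))"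
        proof (cases "\<forall>i. ?X i \<omega> \<in> A i")
          case False
          then obtain i where "?X i \<omega> \<notin> A i" by blast
          then have "(\<Prod>i\<in>UNIV. indicator (A i) (?X i \<omega>)) = (0 :: ennreal)"
            by (intro prod_zero bexI[of _ i]) auto
          then show ?thesis using False by (auto simp: PiE_iff)
        qed (auto simp: PiE_iff)
      qed
      also have "\<dots> = (\<Prod>i\<in>UNIV. block_expectation E U \<alpha> i (indicator (A i)))"
        using A by (intro joint) auto
      also have "\<dots> = (\<Prod>i\<in>UNIV. emeasure (distr M (block_space E i) (?X i)) (A i))"
      proof (rule prod.cong)
        fix i
        have "block_expectation E U \<alpha> i (indicator (A i)) = (\<integral>\<^sup>+ \<omega>. indicator (A i) (?X i \<omega>) \<partial>M)"
          using A[of i] by (intro marginal[symmetric]) auto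
        also have "\<dots> = (\<integral>\<^sup>+ y. indicator (A i) y \<partial>distr M (block_space E i) (?X i))"
          using A[of i] by (intro nn_integral_distr[OF X, symmetric]) auto
        also have "\<dots> = emeasure (distr M (block_space E i) (?X i)) (A i)"
          using A[of i] by simp
        finally show "block_expectation E U \<alpha> i (indicator (A i)) = emeasure (distr M (block_space E i) (?X i)) (A i)" .
      qed simp
      finally show "emeasure (distr M (\<Pi>\<^sub>M i\<in>UNIV. block_space E i) (\<lambda>\<omega>. \<lambda>i\<in>UNIV. ?X i \<omega>)) (Pi\<^sub>E UNIV A)
          = (\<Prod>i\<in>UNIV. emeasure (distr M (block_space E i) (?X i)) (A i))" .
    qed (simp_all cong: sets_PiM_cong)
  qed (simp_all add: X)
  have D_law: "(\<integral>\<^sup>+ \<omega>. f (D \<omega> $ i $ i) \<partial>M) = (\<integral>\<^sup>+ d. ennreal (?ig i d) * f d \<partial>lborel)"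
    if f[measurable]: "f \<in> borel_measurable borel" for f i
    using marginal[of "\<lambda>(d, x). f d" i] by (simp add: block_expectation_fst[OF U G])
  have ig_meas: "?ig i \<in> borel_measurable borel" for i
    unfolding inverse_gamma_density_def by measurable
  have D_dist: "distributed M lborel (\<lambda>\<omega>. D \<omega> $ i $ i) (\<lambda>x. ennreal (?ig i x))" for i
    unfolding distributed_def
  proof (intro conjI)
    show "distr M lborel (\<lambda>\<omega>. D \<omega> $ i $ i) = density lborel (\<lambda>x. ennreal (?ig i x))"
    proof (rule measure_eqI)
      fix A assume "A \<in> sets (distr M lborel (\<lambda>\<omega>. D \<omega> $ i $ i))"
      then have A[measurable]: "A \<in> sets borel" by simp
      have "emeasure (distr M lborel (\<lambda>\<omega>. D \<omega> $ i $ i)) A = (\<integral>\<^sup>+ x. indicator A x \<partial>distr M lborel (\<lambda>\<omega>. D \<omega> $ i $ i))"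
        by simp
      also have "\<dots> = (\<integral>\<^sup>+ \<omega>. indicator A (D \<omega> $ i $ i) \<partial>M)"
        by (rule nn_integral_distr) measurable
      also have "\<dots> = (\<integral>\<^sup>+ d. ennreal (?ig i d) * indicator A d \<partial>lborel)"
        by (rule D_law) measurable
      also have "\<dots> = emeasure (density lborel (\<lambda>x. ennreal (?ig i x))) A"
        using ig_meas by (subst emeasure_density) auto
      finally show "emeasure (distr M lborel (\<lambda>\<omega>. D \<omega> $ i $ i)) A = emeasure (density lborel (\<lambda>x. ennreal (?ig i x))) A" .
    qed simp
  qed (use ig_meas[of i] Dm[of i] in auto)
  have cond: "has_conditional_law M (\<lambda>\<omega>. pred_coef E (\<Sigma> \<omega>) i) (\<Pi>\<^sub>M k\<in>preds E i. borel)
      (\<lambda>\<omega>. D \<omega> $ i $ i) borel (?K i)" for i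
  proof (rule has_conditional_lawI[OF assms(8) Cm Dm])
    show "0 < D \<omega> $ i $ i" if "\<omega> \<in> space M" for \<omega>
      using \<Theta>[OF that] by (simp add: Theta_def positive_diagonal_def)
    show "prob_space (?K i d)" if "0 < d" for d
      by (rule prob_space_mv_normal[OF pd_preds[OF U G] that])
    show sets_K: "sets (?K i d) = sets (\<Pi>\<^sub>M k\<in>preds E i. borel)" for d
      unfolding mv_normal_def sets_density by (intro sets_PiM_cong) auto
    have K_ind: "emeasure (?K i d) B = (\<integral>\<^sup>+ x. indicator B x \<partial>?K i d)"
      if "B \<in> sets (\<Pi>\<^sub>M k\<in>preds E i. borel)" for B d
      using that by (simp add: sets_K)
    show K_meas: "(\<lambda>d. indicator {0<..} d * emeasure (?K i d) B) \<in> borel_measurable borel"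
      if B[measurable]: "B \<in> sets (\<Pi>\<^sub>M k\<in>preds E i. borel)" for B
    proof -
      have "(\<lambda>(d, x). indicator B x :: ennreal) \<in> borel_measurable (block_space E i)" by measurable
      from measurable_nn_integral_block_normal[OF U G this] show ?thesis by (simp only: prod.case K_ind[OF B])
    qed
    fix A :: "real set" and B :: "('n \<Rightarrow> real) set"
    assume A[measurable]: "A \<in> sets borel" and B[measurable]: "B \<in> sets (\<Pi>\<^sub>M k\<in>preds E i. borel)"
    note [measurable] = K_meas[OF B]
    let ?S = "{\<omega> \<in> space M. D \<omega> $ i $ i \<in> A \<and> pred_coef E (\<Sigma> \<omega>) i \<in> B}"
    have S: "?S \<in> sets M" by measurable
    have "emeasure M ?S = (\<integral>\<^sup>+ \<omega>. indicator ?S \<omega> \<partial>M)" using S by simp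
    also have "\<dots> = (\<integral>\<^sup>+ \<omega>. (\<lambda>(d, x). indicator A d * indicator B x) (?X i \<omega>) \<partial>M)"
      by (intro nn_integral_cong) (auto simp: indicator_def)
    also have "\<dots> = block_expectation E U \<alpha> i (\<lambda>(d, x). indicator A d * indicator B x)"
      by (rule marginal) measurable
    \<comment> \<open>The inner integral over \<open>B\<close> is the mass given by the kernel. The
      inserted indicator is harmless, as the inverse gamma density vanishes for
      \<open>d \<le> 0\<close>, and it makes the integrand measurable.\<close>
    also have "\<dots> = (\<integral>\<^sup>+ d. ennreal (?ig i d) * (indicator A d * (indicator {0<..} d * emeasure (?K i d) B)) \<partial>lborel)"
      unfolding block_expectation_def
    proof (rule nn_integral_cong)
      fix d :: real
      have Bm: "(indicator B :: _ \<Rightarrow> ennreal) \<in> borel_measurable (?K i d)"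
        by (intro borel_measurable_indicator) (simp add: sets_K)
      show "ennreal (?ig i d) * (\<integral>\<^sup>+ x. (case (d, x) of (d, x) \<Rightarrow> indicator A d * indicator B x) \<partial>?K i d)
          = ennreal (?ig i d) * (indicator A d * (indicator {0<..} d * emeasure (?K i d) B))"
        by (cases "0 < d")
           (simp_all add: nn_integral_cmult[OF Bm] K_ind[OF B] inverse_gamma_density_def del: nn_integral_indicator)
    qed
    \<comment> \<open>\<open>D_law\<close> read from right to left: the integral over
      \<open>d\<close> becomes an expectation of the kernel evaluated at
      \<open>D_ii\<close>.\<close>
    also have "\<dots> = (\<integral>\<^sup>+ \<omega>. indicator A (D \<omega> $ i $ i) *
        (indicator {0<..} (D \<omega> $ i $ i) * emeasure (?K i (D \<omega> $ i $ i)) B) \<partial>M)"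
      by (rule D_law[symmetric]) measurable
    also have "\<dots> = (\<integral>\<^sup>+ \<omega>. indicator A (D \<omega> $ i $ i) * emeasure (?K i (D \<omega> $ i $ i)) B \<partial>M)"
      using \<Theta> by (intro nn_integral_cong) (simp add: Theta_def positive_diagonal_def)
    finally show "emeasure M ?S = (\<integral>\<^sup>+ \<omega>. indicator A (D \<omega> $ i $ i) * emeasure (?K i (D \<omega> $ i $ i)) B \<partial>M)" .
  qed
  show ?thesis using indep cond D_dist by blast
qed

end
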